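(* Let $\mathcal{S}$ be a compact, virtually special cube complex and suppose that $\pi_1\mathcal{S}$ is relatively hyperbolic (with respect to some finite collection $\mathcal{P}$ of subgroups). For any hyperbolic element $\gamma\in\pi_1\mathcal{S}$, the cyclic subgroup $\langle\gamma\rangle$ is a virtual retract of $\pi_1\mathcal{S}$.
   Context: Special cube complexes (Haglund--Wise). A hyperplane of a cube complex $X$ is a connected component of the complex assembled from the midcubes of the cubes of $X$; it is dual to the edges of $X$ whose midpoints it contains (equivalently, hyperplanes correspond to classes of edges under the equivalence relation generated by being opposite in a square). A hyperplane self-intersects if it is dual to two distinct edges that are consecutive in some square. It is two-sided if its dual edges can be oriented so that opposite edges of squares are oriented in parallel, and one-sided otherwise. Two distinct edges sharing a vertex $v$ osculate at $v$ if they are not consecutive edges at $v$ of any square. A two-sided hyperplane, with its dual edges so oriented, directly self-osculates if two distinct dual edges osculate at a vertex that is initial for both or terminal for both, and indirectly self-osculates if two dual edges osculate at a vertex that is initial for one and terminal for the other. Two distinct hyperplanes inter-osculate if they are dual to edges that are consecutive in some square and also dual to edges that osculate. A cube complex is $C$-special if it is non-positively curved, its one-skeleton is bipartite, and no hyperplane self-intersects, is one-sided, or directly or indirectly self-osculates, and no two hyperplanes inter-osculate. It is virtually special if it has a finite-sheeted $C$-special cover. Relative hyperbolicity is the standard notion. An element of a group hyperbolic relative to $\mathcal{P}$ is called hyperbolic if it is not conjugate into a parabolic (peripheral) subgroup $P\in\mathcal{P}$. A subgroup $H$ of a group $G$ is a virtual retract if $H$ is contained in a finite-index subgroup $K$ of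 $G$ and the inclusion $H\hookrightarrow K$ has a left inverse homomorphism $K\to H$. *)

theory Defs
  imports "HOL-Analysis.Analysis" "HOL-Algebra.Generated_Groups"
begin

section \<open>Cube complexes\<close>

definition cube_top :: "nat \<Rightarrow> (nat \<Rightarrow> real) topology" where
  "cube_top n = product_topology (\<lambda>_. top_of_set {0..1}) {..<n}"

definition cube :: "nat \<Rightarrow> (nat \<Rightarrow> real) set" where
  "cube n = {..<n} \<rightarrow>\<^sub>E {0..1}"

definition open_cube :: "nat \<Rightarrow> (nat \<Rightarrow> real) set" where
  "open_cube n = {..<n} \<rightarrow>\<^sub>E {0<..<1}"

definition cube_vertices :: "nat \<Rightarrow> (nat \<Rightarrow> real) set" where
  "cube_vertices n = {..<n} \<rightarrow>\<^sub>E {0, 1}"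

text \<open>
  Isometric embeddings of the unit \<open>m\<close>-cube onto an \<open>m\<close>-dimensional face of the unit
  \<open>n\<close>-cube: coordinate \<open>i\<close> is sent to coordinate \<open>s i\<close>, possibly reflected, and the remaining
  coordinates are constantly \<open>0\<close> or \<open>1\<close>.  For \<open>m = n\<close> these are the symmetries of the cube.
\<close>
definition cube_face_map :: "nat \<Rightarrow> nat \<Rightarrow> ((nat \<Rightarrow> real) \<Rightarrow> (nat \<Rightarrow> real)) \<Rightarrow> bool" where
  "cube_face_map m n \<phi> \<longleftrightarrow>
     (\<exists>(s :: nat \<Rightarrow> nat) (b :: nat \<Rightarrow> bool) (a :: nat \<Rightarrow> real).
        inj_on s {..<m} \<and> s ` {..<m} \<subseteq> {..<n} \<and> (\<forall>j<n. a j \<in> {0, 1}) \<and>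
        (\<forall>u\<in>cube m.
           \<phi> u \<in> extensional {..<n} \<and>
           (\<forall>i<m. \<phi> u (s i) = (if b i then 1 - u i else u i)) \<and>
           (\<forall>j\<in>{..<n} - s ` {..<m}. \<phi> u j = a j)))"

text \<open>A space of points \<open>'a\<close> with a set of cells labelled by \<open>'c\<close> and their characteristic maps.\<close>
record ('a, 'c) cell_structure =
  points :: "'a topology"
  cells :: "'c set"
  cdim :: "'c \<Rightarrow> nat"
  cmap :: "'c \<Rightarrow> (nat \<Rightarrow> real) \<Rightarrow> 'a"

text \<open>
  A CW complex whose cells are unit cubes, glued along faces by isometries: the open cubes
  partition the space, the characteristic map of a cube restricts on each of its faces to the
  characteristic map of a cube precomposed with an isometry, and the space carries the weak
  topology (in particular the characteristic maps are continuous).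
\<close>
definition cube_complex :: "('a, 'c) cell_structure \<Rightarrow> bool" where
  "cube_complex X \<longleftrightarrow>
     bij_betw (\<lambda>(c, u). cmap X c u) (SIGMA c:cells X. open_cube (cdim X c)) (topspace (points X)) \<and>
     (\<forall>c\<in>cells X. \<forall>m \<phi>. cube_face_map m (cdim X c) \<phi> \<longrightarrow>
        (\<exists>d\<in>cells X. cdim X d = m \<and>
           (\<exists>\<psi>. cube_face_map m m \<psi> \<and> (\<forall>u\<in>cube m. cmap X c (\<phi> u) = cmap X d (\<psi> u))))) \<and>
     (\<forall>U. openin (points X) U \<longleftrightarrow>
        U \<subseteq> topspace (points X) \<and>
        (\<forall>c\<in>cells X. openin (cube_top (cdim X c)) {u \<in> cube (cdim X c). cmap X c u \<in> U}))"

definition edges :: "('a, 'c) cell_structure \<Rightarrow> 'c set" where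
  "edges X = {e \<in> cells X. cdim X e = 1}"

definition squares :: "('a, 'c) cell_structure \<Rightarrow> 'c set" where
  "squares X = {s \<in> cells X. cdim X s = 2}"

text \<open>
  An oriented edge is a pair \<open>(e, b)\<close>: the edge \<open>e\<close> traversed along its characteristic map if
  \<open>b\<close> holds and backwards otherwise.  The oriented edges with initial vertex \<open>v\<close> are thus the
  half-edges at \<open>v\<close>; a loop has two of them.
\<close>
definition oriented_edges :: "('a, 'c) cell_structure \<Rightarrow> ('c \<times> bool) set" where
  "oriented_edges X = edges X \<times> UNIV"

definition edge_path :: "('a, 'c) cell_structure \<Rightarrow> 'c \<times> bool \<Rightarrow> real \<Rightarrow> 'a" where
  "edge_path X = (\<lambda>(e, b) t. cmap X e (\<lambda>i\<in>{..<1}. if b then t else 1 - t))"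

definition initial :: "('a, 'c) cell_structure \<Rightarrow> 'c \<times> bool \<Rightarrow> 'a" where
  "initial X \<alpha> = edge_path X \<alpha> 0"

definition terminal :: "('a, 'c) cell_structure \<Rightarrow> 'c \<times> bool \<Rightarrow> 'a" where
  "terminal X \<alpha> = edge_path X \<alpha> 1"

text \<open>
  \<open>\<alpha>\<close> is the oriented edge issuing from the corner \<open>p\<close> of the cube \<open>c\<close> in the direction of the
  \<open>i\<close>-th coordinate: \<open>\<bar>p i - t\<bar>\<close> moves from \<open>p i\<close> to \<open>1 - p i\<close> as \<open>t\<close> moves from \<open>0\<close> to \<open>1\<close>.
\<close>
definition edge_at ::
    "('a, 'c) cell_structure \<Rightarrow> 'c \<Rightarrow> (nat \<Rightarrow> real) \<Rightarrow> nat \<Rightarrow> 'c \<times> bool \<Rightarrow> bool" where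
  "edge_at X c p i \<alpha> \<longleftrightarrow>
     \<alpha> \<in> oriented_edges X \<and> (\<forall>t\<in>{0..1}. edge_path X \<alpha> t = cmap X c (p(i := \<bar>p i - t\<bar>)))"

text \<open>Opposite sides of a square, oriented in parallel.\<close>
definition parallel :: "('a, 'c) cell_structure \<Rightarrow> 'c \<times> bool \<Rightarrow> 'c \<times> bool \<Rightarrow> bool" where
  "parallel X \<alpha> \<beta> \<longleftrightarrow>
     (\<exists>s\<in>squares X. \<exists>p\<in>cube_vertices 2. \<exists>i<2. \<exists>j<2. i \<noteq> j \<and>
        edge_at X s p i \<alpha> \<and> edge_at X s (p(j := 1 - p j)) i \<beta>)"

text \<open>The two oriented edges issuing from a corner of a square.\<close>
definition corner :: "('a, 'c) cell_structure \<Rightarrow> 'c \<times> bool \<Rightarrow> 'c \<times> bool \<Rightarrow> bool" where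
  "corner X \<alpha> \<beta> \<longleftrightarrow>
     (\<exists>s\<in>squares X. \<exists>p\<in>cube_vertices 2. \<exists>i<2. \<exists>j<2. i \<noteq> j \<and>
        edge_at X s p i \<alpha> \<and> edge_at X s p j \<beta>)"

definition opposite :: "('a, 'c) cell_structure \<Rightarrow> 'c \<Rightarrow> 'c \<Rightarrow> bool" where
  "opposite X e e' \<longleftrightarrow> (\<exists>b b'. parallel X (e, b) (e', b'))"

definition consecutive :: "('a, 'c) cell_structure \<Rightarrow> 'c \<Rightarrow> 'c \<Rightarrow> bool" where
  "consecutive X e e' \<longleftrightarrow> (\<exists>b b'. corner X (e, b) (e', b'))"

definition consecutive_at :: "('a, 'c) cell_structure \<Rightarrow> 'a \<Rightarrow> 'c \<Rightarrow> 'c \<Rightarrow> bool" where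
  "consecutive_at X v e e' \<longleftrightarrow>
     (\<exists>b b'. initial X (e, b) = v \<and> initial X (e', b') = v \<and> corner X (e, b) (e', b'))"

subsection \<open>Non-positive curvature\<close>

text \<open>
  The simplex spanned in the link of the vertex \<open>cmap X c p\<close> by the corner \<open>p\<close> of the cube \<open>c\<close>,
  as a set of half-edges.
\<close>
definition link_simplex :: "('a, 'c) cell_structure \<Rightarrow> 'c \<Rightarrow> (nat \<Rightarrow> real) \<Rightarrow> ('c \<times> bool) set" where
  "link_simplex X c p = {\<alpha>. \<exists>i<cdim X c. edge_at X c p i \<alpha>}"

text \<open>
  Gromov's link condition: every vertex link is a flag simplicial complex.  Simplicial means that
  the vertices of each simplex of the link are distinct and that no two simplices have the same
  vertex set; flag means that pairwise adjacent vertices span a simplex.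
\<close>
definition simplicial_links :: "('a, 'c) cell_structure \<Rightarrow> bool" where
  "simplicial_links X \<longleftrightarrow>
     (\<forall>c\<in>cells X. \<forall>p\<in>cube_vertices (cdim X c). card (link_simplex X c p) = cdim X c) \<and>
     (\<forall>c\<in>cells X. \<forall>c'\<in>cells X. \<forall>p\<in>cube_vertices (cdim X c). \<forall>p'\<in>cube_vertices (cdim X c').
        cmap X c p = cmap X c' p' \<and> link_simplex X c p = link_simplex X c' p' \<longrightarrow> c = c' \<and> p = p')"

definition flag_links :: "('a, 'c) cell_structure \<Rightarrow> bool" where
  "flag_links X \<longleftrightarrow>
     (\<forall>A. finite A \<and> A \<noteq> {} \<and> A \<subseteq> oriented_edges X \<and>
          (\<forall>\<alpha>\<in>A. \<forall>\<beta>\<in>A. initial X \<alpha> = initial X \<beta>) \<and>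
          (\<forall>\<alpha>\<in>A. \<forall>\<beta>\<in>A. \<alpha> \<noteq> \<beta> \<longrightarrow> corner X \<alpha> \<beta>) \<longrightarrow>
          (\<exists>c\<in>cells X. \<exists>p\<in>cube_vertices (cdim X c). link_simplex X c p = A))"

definition nonpositively_curved :: "('a, 'c) cell_structure \<Rightarrow> bool" where
  "nonpositively_curved X \<longleftrightarrow> simplicial_links X \<and> flag_links X"

definition bipartite_skeleton :: "('a, 'c) cell_structure \<Rightarrow> bool" where
  "bipartite_skeleton X \<longleftrightarrow>
     (\<exists>f :: 'a \<Rightarrow> bool. \<forall>\<alpha>\<in>oriented_edges X. f (initial X \<alpha>) \<noteq> f (terminal X \<alpha>))"

subsection \<open>Hyperplanes\<close>

text \<open>A hyperplane is represented by the set of its dual edges.\<close>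
definition hyperplanes :: "('a, 'c) cell_structure \<Rightarrow> 'c set set" where
  "hyperplanes X = edges X // {(e, e'). e \<in> edges X \<and> e' \<in> edges X \<and> equivclp (opposite X) e e'}"

definition self_intersects :: "('a, 'c) cell_structure \<Rightarrow> 'c set \<Rightarrow> bool" where
  "self_intersects X H \<longleftrightarrow> (\<exists>e\<in>H. \<exists>e'\<in>H. e \<noteq> e' \<and> consecutive X e e')"

text \<open>\<open>(e, dir e)\<close> is the chosen orientation of the edge \<open>e\<close>.\<close>
definition parallel_orientation :: "('a, 'c) cell_structure \<Rightarrow> 'c set \<Rightarrow> ('c \<Rightarrow> bool) \<Rightarrow> bool" where
  "parallel_orientation X H dir \<longleftrightarrow>
     (\<forall>e\<in>H. \<forall>e'\<in>H. \<forall>b b'. parallel X (e, b) (e', b') \<longrightarrow> (b = dir e \<longleftrightarrow> b' = dir e'))"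

definition two_sided :: "('a, 'c) cell_structure \<Rightarrow> 'c set \<Rightarrow> bool" where
  "two_sided X H \<longleftrightarrow> (\<exists>dir. parallel_orientation X H dir)"

definition osculate_at :: "('a, 'c) cell_structure \<Rightarrow> 'a \<Rightarrow> 'c \<Rightarrow> 'c \<Rightarrow> bool" where
  "osculate_at X v e e' \<longleftrightarrow>
     e \<in> edges X \<and> e' \<in> edges X \<and> e \<noteq> e' \<and>
     (\<exists>b. initial X (e, b) = v) \<and> (\<exists>b'. initial X (e', b') = v) \<and> \<not> consecutive_at X v e e'"

definition directly_self_osculates :: "('a, 'c) cell_structure \<Rightarrow> 'c set \<Rightarrow> bool" where
  "directly_self_osculates X H \<longleftrightarrow>
     (\<exists>dir. parallel_orientation X H dir \<and>
       (\<exists>e\<in>H. \<exists>e'\<in>H. \<exists>v. osculate_at X v e e' \<and>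
          (initial X (e, dir e) = v \<and> initial X (e', dir e') = v \<or>
           terminal X (e, dir e) = v \<and> terminal X (e', dir e') = v)))"

definition indirectly_self_osculates :: "('a, 'c) cell_structure \<Rightarrow> 'c set \<Rightarrow> bool" where
  "indirectly_self_osculates X H \<longleftrightarrow>
     (\<exists>dir. parallel_orientation X H dir \<and>
       (\<exists>e\<in>H. \<exists>e'\<in>H. \<exists>v. osculate_at X v e e' \<and>
          initial X (e, dir e) = v \<and> terminal X (e', dir e') = v))"

definition inter_osculate :: "('a, 'c) cell_structure \<Rightarrow> 'c set \<Rightarrow> 'c set \<Rightarrow> bool" where
  "inter_osculate X H H' \<longleftrightarrow>
     H \<noteq> H' \<and> (\<exists>e\<in>H. \<exists>e'\<in>H'. consecutive X e e') \<and>
     (\<exists>e\<in>H. \<exists>e'\<in>H'. \<exists>v. osculate_at X v e e')"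

definition C_special :: "('a, 'c) cell_structure \<Rightarrow> bool" where
  "C_special X \<longleftrightarrow>
     cube_complex X \<and> nonpositively_curved X \<and> bipartite_skeleton X \<and>
     (\<forall>H\<in>hyperplanes X. \<not> self_intersects X H \<and> two_sided X H \<and>
        \<not> directly_self_osculates X H \<and> \<not> indirectly_self_osculates X H) \<and>
     (\<forall>H\<in>hyperplanes X. \<forall>H'\<in>hyperplanes X. \<not> inter_osculate X H H')"

subsection \<open>Covers\<close>

text \<open>The library's \<open>covering_space\<close>, for topologies that need not come from a type class.\<close>
definition covering_map :: "'b topology \<Rightarrow> 'a topology \<Rightarrow> ('b \<Rightarrow> 'a) \<Rightarrow> bool" where
  "covering_map Y X p \<longleftrightarrow>
     continuous_map Y X p \<and> p ` topspace Y = topspace X \<and>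
     (\<forall>x\<in>topspace X. \<exists>U. x \<in> U \<and> openin X U \<and>
        (\<exists>\<V>. \<Union>\<V> = {y \<in> topspace Y. p y \<in> U} \<and>
             (\<forall>V\<in>\<V>. openin Y V) \<and> pairwise disjnt \<V> \<and>
             (\<forall>V\<in>\<V>. homeomorphic_map (subtopology Y V) (subtopology X U) p)))"

text \<open>Covers of cube complexes carry the lifted cube structure.\<close>
definition finite_cube_cover ::
    "('b, 'd) cell_structure \<Rightarrow> ('a, 'c) cell_structure \<Rightarrow> ('b \<Rightarrow> 'a) \<Rightarrow> bool" where
  "finite_cube_cover Y X p \<longleftrightarrow>
     cube_complex Y \<and> cube_complex X \<and>
     covering_map (points Y) (points X) p \<and>
     (\<forall>x\<in>topspace (points X). finite {y \<in> topspace (points Y). p y = x}) \<and>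
     (\<forall>d\<in>cells Y. \<exists>c\<in>cells X. cdim X c = cdim Y d \<and>
        (\<exists>\<psi>. cube_face_map (cdim Y d) (cdim Y d) \<psi> \<and>
             (\<forall>u\<in>cube (cdim Y d). p (cmap Y d u) = cmap X c (\<psi> u))))"

text \<open>
  The type argument fixes the types of points and of cells of the cover, over which one cannot
  quantify inside the formula.  Up to isomorphism every finite-sheeted cover of a connected
  complex with points in \<open>'a\<close> and cells in \<open>'c\<close> lives on \<open>'a \<times> nat\<close> and \<open>'c \<times> nat\<close>.
\<close>
definition virtually_special :: "('b \<times> 'd) itself \<Rightarrow> ('a, 'c) cell_structure \<Rightarrow> bool" where
  "virtually_special _ X \<longleftrightarrow>
     (\<exists>(Y :: ('b, 'd) cell_structure) p. finite_cube_cover Y X p \<and> C_special Y)"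


section \<open>The fundamental group\<close>

definition loops :: "'a topology \<Rightarrow> 'a \<Rightarrow> (real \<Rightarrow> 'a) set" where
  "loops X x = {p. pathin X p \<and> p 0 = x \<and> p 1 = x}"

definition loop_homotopic :: "'a topology \<Rightarrow> 'a \<Rightarrow> (real \<Rightarrow> 'a) \<Rightarrow> (real \<Rightarrow> 'a) \<Rightarrow> bool" where
  "loop_homotopic X x = homotopic_with (\<lambda>r. r 0 = x \<and> r 1 = x) (top_of_set {0..1}) X"

definition loop_class :: "'a topology \<Rightarrow> 'a \<Rightarrow> (real \<Rightarrow> 'a) \<Rightarrow> (real \<Rightarrow> 'a) set" where
  "loop_class X x p = {q \<in> loops X x. loop_homotopic X x p q}"

text \<open>Concatenation; the library's \<open>+++\<close> is restricted to topological type classes.\<close>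
definition path_concat :: "(real \<Rightarrow> 'a) \<Rightarrow> (real \<Rightarrow> 'a) \<Rightarrow> real \<Rightarrow> 'a" where
  "path_concat p q = (\<lambda>t. if t \<le> 1/2 then p (2 * t) else q (2 * t - 1))"

definition fundamental_group :: "'a topology \<Rightarrow> 'a \<Rightarrow> (real \<Rightarrow> 'a) set monoid" where
  "fundamental_group X x =
     \<lparr>carrier = loop_class X x ` loops X x,
      mult = (\<lambda>A B. \<Union>p\<in>A. \<Union>q\<in>B. loop_class X x (path_concat p q)),
      one = loop_class X x (\<lambda>_. x)\<rparr>"


section \<open>Relatively hyperbolic groups\<close>

text \<open>
  Osin's definition: \<open>G\<close> is hyperbolic relative to a family \<open>\<P>\<close> of subgroups if it is finitely
  presented relative to \<open>\<P>\<close> and has a linear relative isoperimetric function.  Elements of the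
  free product of the free group on \<open>X\<close> and all \<open>P \<in> \<P>\<close> are represented by words:
  \<open>Gen x True\<close> is \<open>x\<close>, \<open>Gen x False\<close> its formal inverse, and \<open>Per P h\<close> is the copy of
  \<open>h \<in> P - {1}\<close> in the factor \<open>P\<close>.
\<close>
datatype 'g letter = Gen 'g bool | Per "'g set" 'g

fun letter_over :: "('g, 'm) monoid_scheme \<Rightarrow> 'g set \<Rightarrow> 'g set set \<Rightarrow> 'g letter \<Rightarrow> bool" where
  "letter_over G X \<P> (Gen x b) \<longleftrightarrow> x \<in> X"
| "letter_over G X \<P> (Per P h) \<longleftrightarrow> P \<in> \<P> \<and> h \<in> P \<and> h \<noteq> \<one>\<^bsub>G\<^esub>"

definition relative_words ::
    "('g, 'm) monoid_scheme \<Rightarrow> 'g set \<Rightarrow> 'g set set \<Rightarrow> 'g letter list set" where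
  "relative_words G X \<P> = {w. \<forall>l\<in>set w. letter_over G X \<P> l}"

fun letter_value :: "('g, 'm) monoid_scheme \<Rightarrow> 'g letter \<Rightarrow> 'g" where
  "letter_value G (Gen x b) = (if b then x else inv\<^bsub>G\<^esub> x)"
| "letter_value G (Per P h) = h"

definition word_value :: "('g, 'm) monoid_scheme \<Rightarrow> 'g letter list \<Rightarrow> 'g" where
  "word_value G w = foldr (\<lambda>l g. letter_value G l \<otimes>\<^bsub>G\<^esub> g) w \<one>\<^bsub>G\<^esub>"

fun letter_inverse :: "('g, 'm) monoid_scheme \<Rightarrow> 'g letter \<Rightarrow> 'g letter" where
  "letter_inverse G (Gen x b) = Gen x (\<not> b)"
| "letter_inverse G (Per P h) = Per P (inv\<^bsub>G\<^esub> h)"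

definition word_inverse :: "('g, 'm) monoid_scheme \<Rightarrow> 'g letter list \<Rightarrow> 'g letter list" where
  "word_inverse G w = rev (map (letter_inverse G) w)"

inductive free_product_step ::
    "('g, 'm) monoid_scheme \<Rightarrow> 'g set \<Rightarrow> 'g set set \<Rightarrow> 'g letter list \<Rightarrow> 'g letter list \<Rightarrow> bool"
  for G X \<P> where
  cancel_gen: "x \<in> X \<Longrightarrow> free_product_step G X \<P> (u @ [Gen x b, Gen x (\<not> b)] @ v) (u @ v)"
| cancel_per: "P \<in> \<P> \<Longrightarrow> h \<in> P - {\<one>\<^bsub>G\<^esub>} \<Longrightarrow> k \<in> P - {\<one>\<^bsub>G\<^esub>} \<Longrightarrow> h \<otimes>\<^bsub>G\<^esub> k = \<one>\<^bsub>G\<^esub> \<Longrightarrow>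
    free_product_step G X \<P> (u @ [Per P h, Per P k] @ v) (u @ v)"
| merge_per: "P \<in> \<P> \<Longrightarrow> h \<in> P - {\<one>\<^bsub>G\<^esub>} \<Longrightarrow> k \<in> P - {\<one>\<^bsub>G\<^esub>} \<Longrightarrow> h \<otimes>\<^bsub>G\<^esub> k \<noteq> \<one>\<^bsub>G\<^esub> \<Longrightarrow>
    free_product_step G X \<P> (u @ [Per P h, Per P k] @ v) (u @ [Per P (h \<otimes>\<^bsub>G\<^esub> k)] @ v)"

text \<open>Equality of words in the free product.\<close>
definition free_product_eq ::
    "('g, 'm) monoid_scheme \<Rightarrow> 'g set \<Rightarrow> 'g set set \<Rightarrow> 'g letter list \<Rightarrow> 'g letter list \<Rightarrow> bool" where
  "free_product_eq G X \<P> = equivclp (free_product_step G X \<P>)"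

text \<open>
  \<open>X\<close> is a finite relative generating set, \<open>R\<close> a finite set of relators, and every word \<open>w\<close>
  representing \<open>1\<close> is in the free product a product of at most \<open>C * length w\<close> conjugates of
  elements of \<open>R\<close> and their inverses; in particular \<open>R\<close> normally generates the kernel.
\<close>
definition relatively_hyperbolic :: "('g, 'm) monoid_scheme \<Rightarrow> 'g set set \<Rightarrow> bool" where
  "relatively_hyperbolic G \<P> \<longleftrightarrow>
     (\<forall>P\<in>\<P>. subgroup P G) \<and>
     (\<exists>X R. finite X \<and> X \<subseteq> carrier G \<and> generate G (X \<union> \<Union>\<P>) = carrier G \<and>
        finite R \<and> R \<subseteq> relative_words G X \<P> \<and> (\<forall>r\<in>R. word_value G r = \<one>\<^bsub>G\<^esub>) \<and>
        (\<exists>C :: nat. \<forall>w\<in>relative_words G X \<P>. word_value G w = \<one>\<^bsub>G\<^esub> \<longrightarrow>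
           (\<exists>fs. length fs \<le> C * length w \<and>
              set fs \<subseteq> relative_words G X \<P> \<times> (R \<union> word_inverse G ` R) \<and>
              free_product_eq G X \<P> w
                (concat (map (\<lambda>(f, r). word_inverse G f @ r @ f) fs)))))"

definition hyperbolic_element :: "('g, 'm) monoid_scheme \<Rightarrow> 'g set set \<Rightarrow> 'g \<Rightarrow> bool" where
  "hyperbolic_element G \<P> g \<longleftrightarrow>
     g \<in> carrier G \<and> (\<forall>P\<in>\<P>. \<forall>h\<in>carrier G. h \<otimes>\<^bsub>G\<^esub> g \<otimes>\<^bsub>G\<^esub> inv\<^bsub>G\<^esub> h \<notin> P)"


section \<open>Virtual retracts\<close>

definition virtual_retract :: "('g, 'm) monoid_scheme \<Rightarrow> 'g set \<Rightarrow> bool" where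
  "virtual_retract G H \<longleftrightarrow>
     subgroup H G \<and>
     (\<exists>K. subgroup K G \<and> finite (rcosets\<^bsub>G\<^esub> K) \<and> H \<subseteq> K \<and>
        (\<exists>r \<in> hom (G\<lparr>carrier := K\<rparr>) (G\<lparr>carrier := H\<rparr>). \<forall>h\<in>H. r h = h))"

end

theory Submission
  imports Defs
begin

text \<open>
  It suffices to find, for every non-trivial element \<open>g\<close> of a subgroup
  \<open>G\<^sub>0\<close> of finite index of the fundamental group \<open>G\<close>, a subgroup \<open>K\<close> of finite index that contains
  \<open>g\<close> and a homomorphism from \<open>K\<close> to the integers that does not vanish at \<open>g\<close>.  Indeed, if a power
  of \<open>\<gamma>\<close> is a non-trivial element of \<open>G\<^sub>0\<close>, then averaging such a homomorphism over the conjugates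
  by powers of \<open>\<gamma>\<close> gives one whose kernel is normalised by \<open>\<gamma>\<close> and is a complement of \<open>\<langle>\<gamma>\<rangle>\<close> in a
  subgroup of finite index; otherwise the normal core of \<open>G\<^sub>0\<close> is such a complement
  (\<open>cyclic_virtual_retract\<close>).  Here \<open>G\<^sub>0\<close> consists of the classes of the
  loops whose lift from a fixed point of the C-special finite cover \<open>Y\<close> is closed.

  Homomorphisms come from right-angled Artin groups.  In \<open>Y\<close> every oriented edge has a label: its
  dual hyperplane, with a sign.  Let two hyperplanes commute if they cross.  An action of the
  resulting right-angled Artin group on a set \<open>E\<close> defines a covering of \<open>Y\<close> with fibre \<open>E\<close> in which
  the lift of an edge moves the fibre by the label of the edge; it exists because the labels of
  the directions of a cube commute (\<open>openin_gluing_eq\<close>, \<open>covering_map_total\<close>).  The actions used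
  are on products of a finite set with the integers and commute with the translations of the
  integers: the stabiliser of a point of the finite set has finite index, and the translation
  is a homomorphism to the integers (\<open>essential_loop_homomorphism\<close>).

  A loop in \<open>Y\<close> that is not null-homotopic is, up to the choice of a base point, homotopic to an
  edge loop (\<open>path_to_walk\<close>), and specialness allows every cancellation in the label word of an
  edge path to be carried out by a homotopy (\<open>walk_cancel\<close>).  So its label word may be taken to
  be reduced and not empty (\<open>walk_reduce\<close>).  A reduced non-empty word is moved by a translation in
  some action of the above kind (\<open>reduced_word_translates\<close>).  This is an induction on the length:
  if the exponent sum of the first generator is not zero, that generator can act by translation
  and the others trivially; if it is zero, the word lies in the subgroup of index two where this
  exponent sum is even, which is again a right-angled Artin group, and in which the word is
  shorter.
\<close>

section \<open>Virtual retracts onto cyclic subgroups\<close>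

context group
begin

lemma finite_rcosetsI:
  assumes "subgroup K G" "finite (\<phi> ` carrier G)"
    and "\<And>g h. g \<in> carrier G \<Longrightarrow> h \<in> carrier G \<Longrightarrow> \<phi> g = \<phi> h \<Longrightarrow> g \<otimes> inv h \<in> K"
  shows "finite (rcosets K)"
proof -
  have "K #> g = K #> inv_into (carrier G) \<phi> (\<phi> g)" if g: "g \<in> carrier G" for g
  proof -
    let ?h = "inv_into (carrier G) \<phi> (\<phi> g)"
    have h: "?h \<in> carrier G" "\<phi> g = \<phi> ?h"
      using g by (simp_all add: inv_into_into f_inv_into_f)
    then have "g \<otimes> inv ?h \<in> K"
      using assms(3) g by blast
    then have "g \<otimes> inv ?h \<otimes> ?h \<in> K #> ?h"
      by (auto simp: r_coset_def)
    then have "g \<in> K #> ?h"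
      using g h(1) by (simp add: m_assoc)
    then show ?thesis
      using repr_independence[OF _ h(1) assms(1)] by metis
  qed
  then have "rcosets K \<subseteq> (\<lambda>y. K #> inv_into (carrier G) \<phi> y) ` \<phi> ` carrier G"
    by (auto simp: RCOSETS_def)
  then show ?thesis
    using assms(2) finite_subset by blast
qed

lemma rcoset_eqD:
  assumes "subgroup K G" "g \<in> carrier G" "h \<in> carrier G" "K #> g = K #> h"
  shows "g \<otimes> inv h \<in> K"
proof -
  have "g \<in> K #> h"
    using rcos_self[OF assms(2,1)] assms(4) by simp
  then obtain k where "k \<in> K" "g = k \<otimes> h"
    by (auto simp: r_coset_def)
  then show ?thesis
    using assms subgroup.mem_carrier[OF assms(1)] by (simp add: m_assoc)
qed

lemma finite_rcosets_mono:
  assumes "subgroup K G" "subgroup L G" "finite (rcosets K)" "K \<subseteq> L"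
  shows "finite (rcosets L)"
proof (rule finite_rcosetsI[OF assms(2), of "\<lambda>g. K #> g"])
  have "(\<lambda>g. K #> g) ` carrier G = rcosets K"
    by (auto simp: RCOSETS_def)
  then show "finite ((\<lambda>g. K #> g) ` carrier G)"
    using assms(3) by simp
qed (use assms rcoset_eqD in blast)

lemma finite_rcosets_power:
  assumes "subgroup K G" "finite (rcosets K)" "g \<in> carrier G"
  obtains n :: nat where "n > 0" "g [^] n \<in> K"
proof -
  have "(\<lambda>n::nat. K #> g [^] n) ` UNIV \<subseteq> rcosets K"
    using assms(3) by (auto simp: RCOSETS_def)
  then have "\<not> inj (\<lambda>n::nat. K #> g [^] n)"
    using assms(2) finite_subset finite_imageD infinite_UNIV_nat by blast
  then obtain i j :: nat where ij: "i < j" "K #> g [^] i = K #> g [^] j"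
    by (auto simp: inj_def) (metis linorder_neqE_nat)
  then have "g [^] j \<otimes> inv (g [^] i) \<in> K"
    using rcoset_eqD[OF assms(1)] assms(3) by simp
  moreover have "g [^] j = g [^] (j - i) \<otimes> g [^] i"
    using ij assms(3) by (simp add: nat_pow_mult)
  ultimately have "g [^] (j - i) \<in> K"
    using assms(3) by (simp add: m_assoc)
  then show ?thesis
    using that[of "j - i"] ij by simp
qed

definition normal_core :: "'a set \<Rightarrow> 'a set" where
  "normal_core K = {n \<in> carrier G. \<forall>g\<in>carrier G. g \<otimes> n \<otimes> inv g \<in> K}"

lemma normal_core_subset: "normal_core K \<subseteq> K"
proof
  fix n assume "n \<in> normal_core K"
  then have "\<one> \<otimes> n \<otimes> inv \<one> \<in> K" "n \<in> carrier G"
    unfolding normal_core_def by blast+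
  then show "n \<in> K"
    by simp
qed

lemma subgroup_normal_core:
  assumes "subgroup K G"
  shows "subgroup (normal_core K) G"
proof
  show "normal_core K \<subseteq> carrier G"
    by (auto simp: normal_core_def)
  show "\<one> \<in> normal_core K"
    using subgroup.one_closed[OF assms] by (auto simp: normal_core_def)
  fix x assume x: "x \<in> normal_core K"
  show "inv x \<in> normal_core K"
  proof -
    have "g \<otimes> inv x \<otimes> inv g = inv (g \<otimes> x \<otimes> inv g)" if "g \<in> carrier G" for g
      using x that by (auto simp: normal_core_def inv_mult_group m_assoc)
    then show ?thesis
      using x subgroup.m_inv_closed[OF assms] by (auto simp: normal_core_def)
  qed
  fix y assume y: "y \<in> normal_core K"
  have "g \<otimes> (x \<otimes> y) \<otimes> inv g = (g \<otimes> x \<otimes> inv g) \<otimes> (g \<otimes> y \<otimes> inv g)" if "g \<in> carrier G" for g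
    using x y that by (auto simp: normal_core_def m_assoc inv_solve_left)
  then show "x \<otimes> y \<in> normal_core K"
    using x y subgroup.m_closed[OF assms] by (auto simp: normal_core_def)
qed

lemma normal_core_conj:
  assumes "n \<in> normal_core K" "h \<in> carrier G"
  shows "h \<otimes> n \<otimes> inv h \<in> normal_core K"
proof -
  have "g \<otimes> (h \<otimes> n \<otimes> inv h) \<otimes> inv g = (g \<otimes> h) \<otimes> n \<otimes> inv (g \<otimes> h)" if "g \<in> carrier G" for g
    using assms that by (auto simp: normal_core_def m_assoc inv_mult_group)
  then show ?thesis
    using assms by (auto simp: normal_core_def)
qed

lemma finite_rcosets_normal_core:
  assumes "subgroup K G" "finite (rcosets K)"
  shows "finite (rcosets (normal_core K))"
proof (rule finite_rcosetsI[OF subgroup_normal_core[OF assms(1)], of "\<lambda>g. \<lambda>C\<in>rcosets K. C #> g"])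
  have KG: "K \<subseteq> carrier G"
    by (rule subgroup.subset[OF assms(1)])
  have "C #> g \<in> rcosets K" if "C \<in> rcosets K" "g \<in> carrier G" for C g
  proof -
    have "\<exists>a\<in>carrier G. C = K #> a"
      using that(1) by (simp add: RCOSETS_def)
    then obtain a where "a \<in> carrier G" "C = K #> a"
      by blast
    then have "C #> g = K #> (a \<otimes> g)" "a \<otimes> g \<in> carrier G"
      using that(2) KG by (simp_all add: coset_mult_assoc)
    then show ?thesis
      by (auto simp: RCOSETS_def)
  qed
  then have "(\<lambda>g. \<lambda>C\<in>rcosets K. C #> g) ` carrier G \<subseteq> rcosets K \<rightarrow>\<^sub>E rcosets K"
    by auto
  then show "finite ((\<lambda>g. \<lambda>C\<in>rcosets K. C #> g) ` carrier G)"
    using assms(2) finite_PiE finite_subset by (metis (no_types, lifting))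
  fix g h assume gh: "g \<in> carrier G" "h \<in> carrier G"
    "(\<lambda>C\<in>rcosets K. C #> g) = (\<lambda>C\<in>rcosets K. C #> h)"
  have "t \<otimes> (g \<otimes> inv h) \<otimes> inv t \<in> K" if t: "t \<in> carrier G" for t
  proof -
    have "K #> t \<in> rcosets K"
      using t by (auto simp: RCOSETS_def)
    then have "K #> t #> g = K #> t #> h"
      using gh(3) by (metis restrict_apply')
    then have "K #> (t \<otimes> g) = K #> (t \<otimes> h)"
      using gh t KG by (simp add: coset_mult_assoc)
    then have "(t \<otimes> g) \<otimes> inv (t \<otimes> h) \<in> K"
      using rcoset_eqD[OF assms(1)] gh t by simp
    then show ?thesis
      using gh t by (simp add: inv_mult_group m_assoc)
  qed
  then show "g \<otimes> inv h \<in> normal_core K"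
    using gh by (simp add: normal_core_def)
qed

text \<open>
  The retraction sends \<open>a \<otimes> c\<close> with \<open>a \<in> A\<close> and \<open>c \<in> C\<close> to \<open>c\<close>; it is well defined as \<open>A\<close> meets \<open>C\<close>
  trivially, and multiplicative as \<open>C\<close> normalises \<open>A\<close>.
\<close>
lemma virtual_retract_complement:
  assumes A: "subgroup A G" and C: "subgroup C G"
    and conj: "\<And>a c. a \<in> A \<Longrightarrow> c \<in> C \<Longrightarrow> c \<otimes> a \<otimes> inv c \<in> A"
    and triv: "A \<inter> C \<subseteq> {\<one>}"
    and fin: "finite (rcosets (A <#> C))" and AC: "subgroup (A <#> C) G"
  shows "virtual_retract G C"
proof -
  have AG: "a \<in> carrier G" if "a \<in> A" for a
    using that subgroup.mem_carrier[OF A] by blast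
  have CG: "c \<in> carrier G" if "c \<in> C" for c
    using that subgroup.mem_carrier[OF C] by blast
  define r where "r = (\<lambda>k. SOME c. c \<in> C \<and> k \<otimes> inv c \<in> A)"
  have r: "r (a \<otimes> c) = c" if a: "a \<in> A" and c: "c \<in> C" for a c
    unfolding r_def
  proof (rule some_equality)
    show "c \<in> C \<and> a \<otimes> c \<otimes> inv c \<in> A"
      using a c AG CG by (simp add: m_assoc)
    fix d assume d: "d \<in> C \<and> a \<otimes> c \<otimes> inv d \<in> A"
    then have "inv a \<otimes> (a \<otimes> c \<otimes> inv d) \<in> A"
      using a A by (simp add: subgroup.m_closed subgroup.m_inv_closed)
    then have "c \<otimes> inv d \<in> A"
      using a c d AG CG by (simp add: m_assoc[symmetric])
    moreover have "c \<otimes> inv d \<in> C"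
      using c d C by (simp add: subgroup.m_closed subgroup.m_inv_closed)
    ultimately have "c \<otimes> inv d = \<one>"
      using triv by blast
    then show "d = c"
      using c d CG inv_equality[of c "inv d"] by simp
  qed
  have "r \<in> hom (G\<lparr>carrier := A <#> C\<rparr>) (G\<lparr>carrier := C\<rparr>)"
  proof (rule homI)
    fix x assume "x \<in> carrier (G\<lparr>carrier := A <#> C\<rparr>)"
    then obtain a c where x: "a \<in> A" "c \<in> C" "x = a \<otimes> c"
      by (auto simp: set_mult_def)
    then show "r x \<in> carrier (G\<lparr>carrier := C\<rparr>)"
      using r by simp
    fix y assume "y \<in> carrier (G\<lparr>carrier := A <#> C\<rparr>)"
    then obtain b d where y: "b \<in> A" "d \<in> C" "y = b \<otimes> d"
      by (auto simp: set_mult_def)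
    have "x \<otimes> y = (a \<otimes> (c \<otimes> b \<otimes> inv c)) \<otimes> (c \<otimes> d)"
      using x y AG CG by (simp add: m_assoc inv_solve_left)
    moreover have "a \<otimes> (c \<otimes> b \<otimes> inv c) \<in> A" "c \<otimes> d \<in> C"
      using x y conj A C by (simp_all add: subgroup.m_closed)
    ultimately show "r (x \<otimes>\<^bsub>G\<lparr>carrier := A <#> C\<rparr>\<^esub> y) = r x \<otimes>\<^bsub>G\<lparr>carrier := C\<rparr>\<^esub> r y"
      using r x y by simp
  qed
  moreover have "r c = c" if "c \<in> C" for c
    using r[OF subgroup.one_closed[OF A] that] that CG by simp
  moreover have "C \<subseteq> A <#> C"
    using subgroup.one_closed[OF A] CG by (force simp: set_mult_def)
  ultimately show ?thesis
    unfolding virtual_retract_def using C AC fin by blast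
qed

lemma subgroup_normalized_mult:
  assumes A: "subgroup A G" and C: "subgroup C G"
    and conj: "\<And>a c. a \<in> A \<Longrightarrow> c \<in> C \<Longrightarrow> c \<otimes> a \<otimes> inv c \<in> A"
  shows "subgroup (A <#> C) G"
proof
  have AG: "a \<in> carrier G" if "a \<in> A" for a
    using that subgroup.mem_carrier[OF A] by blast
  have CG: "c \<in> carrier G" if "c \<in> C" for c
    using that subgroup.mem_carrier[OF C] by blast
  show "A <#> C \<subseteq> carrier G"
    using AG CG by (auto simp: set_mult_def)
  show "\<one> \<in> A <#> C"
    using subgroup.one_closed[OF A] subgroup.one_closed[OF C] by (force simp: set_mult_def)
  fix x assume "x \<in> A <#> C"
  then obtain a c where x: "a \<in> A" "c \<in> C" "x = a \<otimes> c"
    by (auto simp: set_mult_def)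
  have ic: "inv a \<in> A" "inv c \<in> C"
    using x A C by (simp_all add: subgroup.m_inv_closed)
  have "inv x = (inv c \<otimes> inv a \<otimes> inv (inv c)) \<otimes> inv c"
    using x AG CG by (simp add: m_assoc inv_mult_group)
  then show "inv x \<in> A <#> C"
    using conj[OF ic] ic(2) by (auto simp: set_mult_def)
  fix y assume "y \<in> A <#> C"
  then obtain b d where y: "b \<in> A" "d \<in> C" "y = b \<otimes> d"
    by (auto simp: set_mult_def)
  have "x \<otimes> y = (a \<otimes> (c \<otimes> b \<otimes> inv c)) \<otimes> (c \<otimes> d)"
    using x y AG CG by (simp add: m_assoc inv_solve_left)
  moreover have "a \<otimes> (c \<otimes> b \<otimes> inv c) \<in> A" "c \<otimes> d \<in> C"
    using x y conj A C by (simp_all add: subgroup.m_closed)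
  ultimately show "x \<otimes> y \<in> A <#> C"
    by (auto simp: set_mult_def)
qed

lemma additive_int_pow:
  fixes f :: "'a \<Rightarrow> int" and k :: int
  assumes K: "subgroup K G" and f: "\<And>a b. a \<in> K \<Longrightarrow> b \<in> K \<Longrightarrow> f (a \<otimes> b) = f a + f b" and "a \<in> K"
  shows "f (a [^] k) = k * f a"
proof -
  have aG: "a \<in> carrier G"
    using assms by (simp add: subgroup.mem_carrier)
  have one: "f \<one> = 0"
    using f[of \<one> \<one>] subgroup.one_closed[OF K] by simp
  have pow_in: "a [^] (n::nat) \<in> K" for n
    using assms by (induction n) (simp_all add: subgroup.one_closed subgroup.m_closed)
  have pow: "f (a [^] (n::nat)) = int n * f a" for n
    by (induction n) (simp_all add: one f pow_in \<open>a \<in> K\<close> algebra_simps)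
  show ?thesis
  proof (cases k rule: int_cases2)
    case (nonneg n)
    then show ?thesis by (simp add: pow int_pow_int)
  next
    case (nonpos n)
    have "f (inv (a [^] n)) + f (a [^] n) = f (inv (a [^] n) \<otimes> a [^] n)"
      using pow_in subgroup.m_inv_closed[OF K] by (simp add: f)
    then have "f (inv (a [^] n)) = - (int n * f a)"
      using aG one pow[of n] by simp
    then show ?thesis
      using nonpos aG by (simp add: int_pow_neg_int)
  qed
qed

text \<open>
  If no non-trivial power of \<open>\<gamma>\<close> lies in \<open>G0\<close>, the normal core of \<open>G0\<close> is a complement of \<open>\<langle>\<gamma>\<rangle>\<close> in
  a subgroup of finite index.  Otherwise a homomorphism \<open>f\<close> to the integers is given that does not
  vanish at a power of \<open>\<gamma>\<close>.  Its sum \<open>F\<close> over the conjugates by the powers of \<open>\<gamma>\<close> is invariant under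
  conjugation by \<open>\<gamma>\<close>, so that the kernel of \<open>F\<close> is normalised by \<open>\<gamma>\<close>; it is a complement of \<open>\<langle>\<gamma>\<rangle>\<close> in
  a group that contains every element at which \<open>F\<close> is a multiple of its value at a power of \<open>\<gamma>\<close>.
\<close>
lemma cyclic_virtual_retract:
  fixes \<gamma> :: 'a
  assumes g: "\<gamma> \<in> carrier G" and G0: "subgroup G0 G" "finite (rcosets G0)"
    and ex: "\<And>g. g \<in> G0 \<Longrightarrow> g \<noteq> \<one> \<Longrightarrow> \<exists>K (f :: 'a \<Rightarrow> int). subgroup K G \<and> finite (rcosets K) \<and> g \<in> K \<and>
      (\<forall>a\<in>K. \<forall>b\<in>K. f (a \<otimes> b) = f a + f b) \<and> f g \<noteq> 0"
  shows "virtual_retract G (generate G {\<gamma>})"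
proof -
  let ?C = "generate G {\<gamma>}"
  have C: "subgroup ?C G"
    using g by (simp add: generate_is_subgroup)
  have C_pow: "?C = {\<gamma> [^] (k::int) | k. k \<in> UNIV}"
    using generate_pow[OF g] by simp
  have powG: "\<gamma> [^] (k::int) \<in> carrier G" for k
    using g by simp
  show ?thesis
  proof (cases "\<forall>k::int. \<gamma> [^] k \<in> G0 \<longrightarrow> \<gamma> [^] k = \<one>")
    case True
    let ?A = "normal_core G0"
    have A: "subgroup ?A G"
      by (rule subgroup_normal_core[OF G0(1)])
    have conj: "c \<otimes> a \<otimes> inv c \<in> ?A" if "a \<in> ?A" "c \<in> ?C" for a c
      using that normal_core_conj subgroup.mem_carrier[OF C] by blast
    have AC: "subgroup (?A <#> ?C) G"
      by (rule subgroup_normalized_mult[OF A C conj])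
    moreover have "?A \<subseteq> ?A <#> ?C"
      using subgroup.one_closed[OF C] subgroup.mem_carrier[OF A] by (force simp: set_mult_def)
    ultimately have "finite (rcosets (?A <#> ?C))"
      using finite_rcosets_mono[OF A _ finite_rcosets_normal_core[OF G0]] by blast
    moreover have "?A \<inter> ?C \<subseteq> {\<one>}"
      using normal_core_subset True by (auto simp: C_pow)
    ultimately show ?thesis
      using virtual_retract_complement[OF A C conj] AC by blast
  next
    case False
    then obtain k :: int and K and f :: "'a \<Rightarrow> int" where K: "subgroup K G" "finite (rcosets K)" "\<gamma> [^] k \<in> K"
      and f: "\<And>a b. a \<in> K \<Longrightarrow> b \<in> K \<Longrightarrow> f (a \<otimes> b) = f a + f b" and fk: "f (\<gamma> [^] k) \<noteq> 0"
      using ex by metis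
    let ?N = "normal_core K"
    have N: "subgroup ?N G" and finN: "finite (rcosets ?N)"
      using subgroup_normal_core finite_rcosets_normal_core K by blast+
    have NK: "n \<in> K" and NG: "n \<in> carrier G" if "n \<in> ?N" for n
      using that normal_core_subset subgroup.mem_carrier[OF N] by blast+
    obtain M :: nat where M: "M > 0" "\<gamma> [^] M \<in> ?N"
      using finite_rcosets_power[OF N finN g] by blast
    have fM: "f (\<gamma> [^] M) \<noteq> 0"
    proof -
      have "k * f (\<gamma> [^] M) = f ((\<gamma> [^] M) [^] k)"
        using additive_int_pow[OF K(1) f NK[OF M(2)]] by simp
      also have "(\<gamma> [^] M) [^] k = (\<gamma> [^] k) [^] int M"
        using g by (simp add: int_pow_pow mult.commute flip: int_pow_int)
      also have "f \<dots> = int M * f (\<gamma> [^] k)"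
        by (rule additive_int_pow[OF K(1) f K(3)])
      finally show ?thesis
        using fk M(1) by auto
    qed
    define c where "c i h = \<gamma> [^] i \<otimes> h \<otimes> inv (\<gamma> [^] i)" for i :: nat and h
    have cN: "c i h \<in> ?N" if "h \<in> ?N" for i h
      unfolding c_def using that g by (intro normal_core_conj) auto
    have c_mult: "c i (a \<otimes> b) = c i a \<otimes> c i b" if "a \<in> ?N" "b \<in> ?N" for i a b
      using that NG g by (simp add: c_def m_assoc inv_solve_left)
    define F where "F h = (\<Sum>i<M. f (c i h))" for h
    have F: "F (a \<otimes> b) = F a + F b" if "a \<in> ?N" "b \<in> ?N" for a b
      using that by (simp add: F_def c_mult f NK cN sum.distrib)
    have F_conj: "F (\<gamma> \<otimes> h \<otimes> inv \<gamma>) = F h" if h: "h \<in> ?N" for h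
    proof -
      have shift: "c i (\<gamma> \<otimes> h \<otimes> inv \<gamma>) = c (Suc i) h" for i
        using NG[OF h] g by (simp add: c_def m_assoc inv_mult_group)
      have "f (c M h) = f h"
      proof -
        have "f (inv (\<gamma> [^] M)) = - f (\<gamma> [^] M)"
          using additive_int_pow[OF K(1) f NK[OF M(2)], of "-1"] g by (simp add: int_pow_neg)
        then show ?thesis
          using NK[OF h] NK[OF M(2)] subgroup.m_closed[OF K(1)] subgroup.m_inv_closed[OF K(1)]
          by (simp add: c_def f)
      qed
      moreover have "c 0 h = h"
        using NG[OF h] by (simp add: c_def)
      ultimately show ?thesis
        using sum.lessThan_Suc_shift[of "\<lambda>i. f (c i h)" M] by (simp add: F_def shift)
    qed
    let ?D = "F (\<gamma> [^] M)"
    have D: "?D \<noteq> 0"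
    proof -
      have "c i (\<gamma> [^] M) = \<gamma> [^] M" for i
        using g by (simp add: c_def nat_pow_mult m_assoc add.commute[of i M] flip: m_assoc)
          (simp add: nat_pow_mult[symmetric] m_assoc)
      then show ?thesis
        using fM M(1) by (simp add: F_def)
    qed
    define A where "A = {h \<in> ?N. F h = 0}"
    have F_pow: "F (a [^] (j::int)) = j * F a" if "a \<in> ?N" for a j
      using additive_int_pow[OF N F that] by simp
    have F_inv: "F (inv a) = - F a" if "a \<in> ?N" for a
      using F_pow[OF that, of "-1"] NG[OF that] by (simp add: int_pow_neg)
    have A: "subgroup A G"
    proof
      show "A \<subseteq> carrier G" using NG by (auto simp: A_def)
      show "\<one> \<in> A"
        using subgroup.one_closed[OF N] F[of \<one> \<one>] by (simp add: A_def)
      show "inv x \<in> A" if "x \<in> A" for x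
        using that subgroup.m_inv_closed[OF N] by (simp add: A_def F_inv)
      show "x \<otimes> y \<in> A" if "x \<in> A" "y \<in> A" for x y
        using that subgroup.m_closed[OF N] by (simp add: A_def F)
    qed
    have F_conj_pow: "F (\<gamma> [^] (j::nat) \<otimes> h \<otimes> inv (\<gamma> [^] j)) = F h" if h: "h \<in> ?N" for j h
    proof (induction j)
      case 0
      then show ?case using NG[OF h] by simp
    next
      case (Suc j)
      have "\<gamma> [^] Suc j \<otimes> h \<otimes> inv (\<gamma> [^] Suc j) = \<gamma> \<otimes> c j h \<otimes> inv \<gamma>"
        unfolding nat_pow_Suc2[OF g] using NG[OF h] g by (simp add: c_def m_assoc inv_mult_group)
      then show ?case
        using F_conj[OF cN[OF h]] Suc by (simp add: c_def)
    qed
    have conj: "d \<otimes> a \<otimes> inv d \<in> A" if a: "a \<in> A" and d: "d \<in> ?C" for a d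
    proof -
      have aN: "a \<in> ?N" "F a = 0"
        using a by (auto simp: A_def)
      obtain j :: int where d: "d = \<gamma> [^] j"
        using d by (auto simp: C_pow)
      have dN: "d \<otimes> a \<otimes> inv d \<in> ?N"
        using aN d g by (intro normal_core_conj) auto
      have "F (d \<otimes> a \<otimes> inv d) = F a"
      proof (cases j rule: int_cases2)
        case (nonneg n)
        then show ?thesis using F_conj_pow[OF aN(1), of n] d by (simp add: int_pow_int)
      next
        case (nonpos n)
        have "\<gamma> [^] n \<otimes> (d \<otimes> a \<otimes> inv d) \<otimes> inv (\<gamma> [^] n) = a"
          using nonpos d g NG[OF aN(1)] m_assoc[of "\<gamma> [^] n" "inv (\<gamma> [^] n)" a]
          by (simp add: int_pow_neg_int m_assoc)
        then show ?thesis
          using F_conj_pow[OF dN, of n] by simp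
      qed
      then show ?thesis
        using dN aN by (simp add: A_def)
    qed
    have AC: "subgroup (A <#> ?C) G"
      by (rule subgroup_normalized_mult[OF A C conj])
    have "A \<inter> ?C \<subseteq> {\<one>}"
    proof
      fix a assume a: "a \<in> A \<inter> ?C"
      then obtain j :: int where j: "a = \<gamma> [^] j"
        by (auto simp: C_pow)
      have "0 = int M * F a" using a by (simp add: A_def)
      also have "\<dots> = F (a [^] int M)"
        using a by (subst F_pow) (auto simp: A_def)
      also have "a [^] int M = (\<gamma> [^] M) [^] j"
        using g by (simp add: j int_pow_pow mult.commute flip: int_pow_int)
      also have "F \<dots> = j * ?D"
        by (rule F_pow[OF M(2)])
      finally show "a \<in> {\<one>}" using D j by simp
    qed
    moreover have "finite (rcosets (A <#> ?C))"
    proof (rule finite_rcosetsI[OF AC])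
      \<comment> \<open>a representative of the coset of \<open>g\<close>, relative to which \<open>F\<close> modulo its value at \<open>\<gamma> [^] M\<close> is taken\<close>
      define t where "t = (\<lambda>g. inv_into (carrier G) (\<lambda>g. ?N #> g) (?N #> g))"
      have t: "t h \<in> carrier G" "?N #> h = ?N #> t h" if "h \<in> carrier G" for h
        unfolding t_def using that
        by (auto intro!: inv_into_into f_inv_into_f[where f = "\<lambda>g. ?N #> g", symmetric])
      let ?\<phi> = "\<lambda>g. (?N #> g, F (g \<otimes> inv (t g)) mod ?D)"
      have fin: "finite {x. \<exists>y::int. x = y mod ?D}"
      proof (rule finite_subset)
        show "{x. \<exists>y. x = y mod ?D} \<subseteq> {- \<bar>?D\<bar>..\<bar>?D\<bar>}"
        proof (clarify, unfold atLeastAtMost_iff)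
          fix y show "- \<bar>?D\<bar> \<le> y mod ?D \<and> y mod ?D \<le> \<bar>?D\<bar>"
            using abs_mod_less[OF D, of y] by linarith
        qed
      qed simp
      have "?\<phi> ` carrier G \<subseteq> (rcosets ?N) \<times> {x. \<exists>y. x = y mod ?D}"
        by (auto simp: RCOSETS_def)
      then show "finite (?\<phi> ` carrier G)"
        by (rule finite_subset) (rule finite_cartesian_product[OF finN fin])
      fix x y assume xy: "x \<in> carrier G" "y \<in> carrier G" "?\<phi> x = ?\<phi> y"
      have ty: "t y = t x"
        using xy by (simp add: t_def)
      have in_N: "x \<otimes> inv (t x) \<in> ?N" "y \<otimes> inv (t x) \<in> ?N"
        using rcoset_eqD[OF N xy(1) t(1)[OF xy(1)] t(2)[OF xy(1)]]
          rcoset_eqD[OF N xy(2) t(1)[OF xy(2)] t(2)[OF xy(2)]] ty by simp_all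
      have "x \<otimes> inv y = (x \<otimes> inv (t x)) \<otimes> inv (y \<otimes> inv (t x))"
        using xy t(1)[OF xy(1)] by (simp add: inv_mult_group m_assoc inv_solve_left)
      then have h: "x \<otimes> inv y \<in> ?N" and "F (x \<otimes> inv y) = F (x \<otimes> inv (t x)) - F (y \<otimes> inv (t x))"
        using in_N subgroup.m_closed[OF N] subgroup.m_inv_closed[OF N] by (simp_all add: F F_inv)
      then have "?D dvd F (x \<otimes> inv y)"
        using xy(3) ty by (simp add: mod_eq_dvd_iff)
      then obtain j where j: "F (x \<otimes> inv y) = ?D * j"
        by auto
      let ?c = "(\<gamma> [^] M) [^] j"
      have cN: "?c \<in> ?N" and cC: "?c \<in> ?C"
        using subgroup_int_pow_closed[OF N M(2)] g by (auto simp: C_pow int_pow_pow simp flip: int_pow_int)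
      have "F (x \<otimes> inv y \<otimes> inv ?c) = 0"
        using h cN j subgroup.m_inv_closed[OF N] by (simp add: F F_inv F_pow M(2))
      then have "x \<otimes> inv y \<otimes> inv ?c \<in> A"
        using h cN subgroup.m_closed[OF N] subgroup.m_inv_closed[OF N] by (simp add: A_def)
      moreover have "x \<otimes> inv y = (x \<otimes> inv y \<otimes> inv ?c) \<otimes> ?c"
        using NG[OF h] NG[OF cN] by (simp add: m_assoc)
      ultimately show "x \<otimes> inv y \<in> A <#> ?C"
        using cC unfolding set_mult_def by blast
    qed
    ultimately show ?thesis
      using virtual_retract_complement[OF A C conj] AC by blast
  qed
qed

end

section \<open>Reduced words in partially commuting letters\<close>

text \<open>
  Words in letters \<open>x\<^sup>\<plusminus>\<^sup>1\<close> are lists of pairs of a generator and a sign.  \<open>cm x y\<close> says that the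
  generators \<open>x\<close> and \<open>y\<close> commute.  A letter \<open>x\<^sup>b\<close> in front of \<open>w\<close> can be cancelled if it can be
  moved across commuting letters up to the first occurrence of its inverse.
\<close>
primrec cancels_into :: "('g \<Rightarrow> 'g \<Rightarrow> bool) \<Rightarrow> 'g \<Rightarrow> bool \<Rightarrow> ('g \<times> bool) list \<Rightarrow> bool" where
  "cancels_into cm x b [] \<longleftrightarrow> False"
| "cancels_into cm x b (l # w) \<longleftrightarrow>
     (if fst l = x then snd l \<noteq> b else cm x (fst l) \<and> cancels_into cm x b w)"

primrec reduced :: "('g \<Rightarrow> 'g \<Rightarrow> bool) \<Rightarrow> ('g \<times> bool) list \<Rightarrow> bool" where
  "reduced cm [] \<longleftrightarrow> True"
| "reduced cm (l # w) \<longleftrightarrow> \<not> cancels_into cm (fst l) (snd l) w \<and> reduced cm w"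

definition translate :: "int \<Rightarrow> bool list \<times> int \<Rightarrow> bool list \<times> int" where
  "translate k e = (fst e, snd e + k)"

text \<open>
  Actions of the right-angled Artin group with commutation relation \<open>cm\<close> on \<open>bool list \<times> int\<close>
  that commute with the translations of \<open>int\<close>.  Since the length of the list is preserved, the
  action on the first coordinate has finite orbits, so that the stabiliser of a list is a subgroup
  of finite index, and the second coordinate gives a homomorphism from it to \<open>int\<close>.
\<close>
definition raag_action :: "('g \<Rightarrow> 'g \<Rightarrow> bool) \<Rightarrow> ('g \<Rightarrow> bool list \<times> int \<Rightarrow> bool list \<times> int) \<Rightarrow> bool" where
  "raag_action cm \<rho> \<longleftrightarrow>
     (\<forall>x. bij (\<rho> x)) \<and> (\<forall>x e. length (fst (\<rho> x e)) = length (fst e)) \<and>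
     (\<forall>x k e. \<rho> x (translate k e) = translate k (\<rho> x e)) \<and>
     (\<forall>x y e. cm x y \<longrightarrow> \<rho> x (\<rho> y e) = \<rho> y (\<rho> x e))"

lemma raag_actionD:
  assumes "raag_action cm \<rho>"
  shows "bij (\<rho> x)" "length (fst (\<rho> x e)) = length (fst e)"
    "\<rho> x (translate k e) = translate k (\<rho> x e)" "cm x y \<Longrightarrow> \<rho> x (\<rho> y e) = \<rho> y (\<rho> x e)"
  using assms unfolding raag_action_def by blast+

definition letter_act :: "('g \<Rightarrow> 'e \<Rightarrow> 'e) \<Rightarrow> 'g \<times> bool \<Rightarrow> 'e \<Rightarrow> 'e" where
  "letter_act \<rho> l = (if snd l then \<rho> (fst l) else inv_into UNIV (\<rho> (fst l)))"

definition word_act :: "('g \<Rightarrow> 'e \<Rightarrow> 'e) \<Rightarrow> ('g \<times> bool) list \<Rightarrow> 'e \<Rightarrow> 'e" where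
  "word_act \<rho> w = fold (letter_act \<rho>) w"

lemma word_act_simps [simp]:
  "word_act \<rho> [] e = e" "word_act \<rho> (l # w) e = word_act \<rho> w (letter_act \<rho> l e)"
  by (simp_all add: word_act_def)

primrec exponent_sum :: "'g \<Rightarrow> ('g \<times> bool) list \<Rightarrow> int" where
  "exponent_sum v [] = 0"
| "exponent_sum v (l # w) = (if fst l = v then if snd l then 1 else -1 else 0) + exponent_sum v w"

lemma translate_translate [simp]: "translate i (translate j e) = translate (i + j) e"
  by (simp add: translate_def)

lemma translate_0 [simp]: "translate 0 e = e"
  by (simp add: translate_def)

lemma bij_translate: "bij (translate k)"
  by (rule o_bij [of "translate (- k)"]) (auto simp: fun_eq_iff)

lemma inv_translate: "inv_into UNIV (translate k) = translate (- k)"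
  by (rule inv_unique_comp) (auto simp: fun_eq_iff)

subsection \<open>The index two subgroup of words of even exponent\<close>

text \<open>
  Fix a generator \<open>v\<close>.  The elements in which the exponent sum of \<open>v\<close> is even form a right-angled
  Artin group again: its generators are \<open>v\<^sup>2\<close>, one copy of each \<open>x\<close> that commutes with \<open>v\<close>, and the
  two elements \<open>x\<close> and \<open>v x v\<^sup>-\<^sup>1\<close> for each other generator \<open>x\<close>.  Copies are told apart by a bit
  that is put in front of a list.  The generator \<open>v\<^sup>2\<close> is \<open>copy False v\<close>.
\<close>
definition copy :: "bool \<Rightarrow> 'g \<times> bool list \<Rightarrow> 'g \<times> bool list" where
  "copy s x = (fst x, s # snd x)"

lemma copy_inject [simp]: "copy s x = copy t y \<longleftrightarrow> s = t \<and> x = y"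
  by (auto simp: copy_def prod_eq_iff)

definition even_comm ::
    "('g \<times> bool list \<Rightarrow> 'g \<times> bool list \<Rightarrow> bool) \<Rightarrow> 'g \<times> bool list \<Rightarrow>
     'g \<times> bool list \<Rightarrow> 'g \<times> bool list \<Rightarrow> bool" where
  "even_comm cm v a b \<longleftrightarrow>
     (\<exists>s t x y. a = copy s x \<and> b = copy t y \<and> cm x y \<and> (s = t \<or> cm v x \<or> cm v y))"

lemma even_comm_copy [simp]:
  "even_comm cm v (copy s x) (copy t y) \<longleftrightarrow> cm x y \<and> (s = t \<or> cm v x \<or> cm v y)"
  by (auto simp: even_comm_def)

lemma symp_even_comm: "symp cm \<Longrightarrow> symp (even_comm cm v)"
  unfolding symp_def even_comm_def by metis

lemma irreflp_even_comm: "irreflp cm \<Longrightarrow> irreflp (even_comm cm v)"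
  unfolding irreflp_def even_comm_def by (metis copy_inject)

text \<open>
  Rewriting in the new generators (Reidemeister--Schreier with transversal \<open>{1, v}\<close>): the state
  \<open>s\<close> is the coset reached so far, and a letter \<open>v\<^sup>\<plusminus>\<^sup>1\<close> either only changes the coset or
  contributes \<open>v\<^sup>\<plusminus>\<^sup>2\<close>.
\<close>
primrec even_word ::
    "('g \<times> bool list \<Rightarrow> 'g \<times> bool list \<Rightarrow> bool) \<Rightarrow> 'g \<times> bool list \<Rightarrow> bool \<Rightarrow>
     (('g \<times> bool list) \<times> bool) list \<Rightarrow> (('g \<times> bool list) \<times> bool) list" where
  "even_word cm v s [] = []"
| "even_word cm v s (l # w) =
     (if fst l = v then
        if snd l = s then (copy False v, s) # even_word cm v (\<not> s) w else even_word cm v (\<not> s) w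
      else (copy (s \<and> \<not> cm v (fst l)) (fst l), snd l) # even_word cm v s w)"

lemma length_even_word: "length (even_word cm v s w) \<le> length w"
  by (induction w arbitrary: s) (auto intro: le_SucI)

lemma even_word_cancels_commuting:
  assumes "symp cm" "cm v x" "x \<noteq> v"
    and "cancels_into (even_comm cm v) (copy False x) b (even_word cm v s w)"
  shows "cancels_into cm x b w"
proof -
  have "cm x v"
    using assms(1,2) by (rule sympD)
  then show ?thesis
    using assms(4) by (induction w arbitrary: s) (use assms(2,3) in \<open>auto split: if_splits\<close>)
qed

text \<open>
  If \<open>x\<close> does not commute with \<open>v\<close>, then the inverse of one of its copies can only be reached once a
  change of the coset has been undone.  The letter that changed the coset and the next one that
  changes it enclose only letters that commute with \<open>v\<close>, so these two cancel.
\<close>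
lemma even_word_cancels_other_coset:
  assumes "irreflp cm" "\<not> cm v x" "symp cm" "x \<noteq> v"
    and "cancels_into (even_comm cm v) (copy s x) b (even_word cm v (\<not> s) w)"
  shows "cancels_into cm v (\<not> s) w"
proof -
  have "\<not> cm x v" "\<not> cm x x"
    using assms(2) sympD[OF assms(3), of x v] irreflpD[OF assms(1), of x] by auto
  then show ?thesis
    using assms(5) by (induction w) (use assms(2,4) in \<open>auto split: if_splits\<close>)
qed

lemma even_word_cancels_noncommuting:
  assumes "irreflp cm" "\<not> cm v x" "symp cm" "x \<noteq> v" "reduced cm w"
    and "cancels_into (even_comm cm v) (copy s x) b (even_word cm v s w)"
  shows "cancels_into cm x b w"
  using assms(5,6)
proof (induction w)
  case (Cons l w)
  have nc: "\<not> cm x v" "\<not> cm x x"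
    using assms(2) sympD[OF assms(3), of x v] irreflpD[OF assms(1), of x] by auto
  show ?case
  proof (cases "fst l = v")
    case True
    moreover from this Cons.prems have "snd l \<noteq> s"
      using assms(2,4) nc by (auto split: if_splits)
    ultimately show ?thesis
      using even_word_cancels_other_coset[OF assms(1-4), of s b w] Cons.prems by auto
  next
    case False
    then show ?thesis
      using Cons assms(2,4) nc by (auto split: if_splits)
  qed
qed simp

text \<open>
  Likewise, a letter that changes the coset between \<open>v\<^sup>\<plusminus>\<^sup>2\<close> and its inverse cancels with the next
  occurrence of \<open>v\<close> or \<open>v\<^sup>-\<^sup>1\<close>, as only letters that commute with \<open>v\<close> lie between them.
\<close>
lemma even_word_cancels_square_other_coset:
  assumes "irreflp cm" "symp cm"
    and "cancels_into (even_comm cm v) (copy False v) b (even_word cm v b w)"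
  shows "cancels_into cm v b w"
proof -
  have "\<not> cm v v"
    using irreflpD[OF assms(1)] by auto
  then show ?thesis
    using assms(3) by (induction w) (auto split: if_splits)
qed

lemma even_word_cancels_square:
  assumes "irreflp cm" "symp cm" "reduced cm w"
    and "cancels_into (even_comm cm v) (copy False v) b (even_word cm v (\<not> b) w)"
  shows "cancels_into cm v b w"
  using assms(3,4)
proof (induction w)
  case (Cons l w)
  show ?case
  proof (cases "fst l = v")
    case True
    then show ?thesis
      using even_word_cancels_square_other_coset[OF assms(1,2), of v b w] Cons.prems
      by (cases "snd l = b") auto
  next
    case False
    then show ?thesis
      using Cons by (auto split: if_splits)
  qed
qed simp

text \<open>
  A cancellation in the new generators comes from one in the old generators, so the induction can
  go on with reduced words.
\<close>
lemma reduced_even_word: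
  assumes "irreflp cm" "symp cm" "reduced cm w"
  shows "reduced (even_comm cm v) (even_word cm v s w)"
  using assms(3)
proof (induction w arbitrary: s)
  case (Cons l w)
  have IH: "reduced (even_comm cm v) (even_word cm v t w)" for t
    using Cons by simp
  show ?case
  proof (cases "fst l = v")
    case True
    then show ?thesis
      using IH even_word_cancels_square[OF assms(1,2), of w v s] Cons.prems by auto
  next
    case False
    then show ?thesis
      using IH even_word_cancels_commuting[OF assms(2), of v "fst l" "snd l" s w]
        even_word_cancels_noncommuting[OF assms(1) _ assms(2), of v "fst l" w s "snd l"] Cons.prems
      by (cases "cm v (fst l)") auto
  qed
qed simp

lemma even_word_eq_Nil:
  assumes "reduced cm w" "even_word cm v s w = []" "exponent_sum v w = 0"
  shows "w = []"
proof (cases w)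
  case (Cons l w')
  then show ?thesis
    using assms by (cases w') (auto split: if_splits)
qed simp

subsection \<open>Induced actions\<close>

definition push :: "bool \<Rightarrow> bool list \<times> int \<Rightarrow> bool list \<times> int" where
  "push s e = (s # fst e, snd e)"

definition induced_action ::
    "('g \<times> bool list \<Rightarrow> 'g \<times> bool list \<Rightarrow> bool) \<Rightarrow> 'g \<times> bool list \<Rightarrow>
     ('g \<times> bool list \<Rightarrow> bool list \<times> int \<Rightarrow> bool list \<times> int) \<Rightarrow>
     'g \<times> bool list \<Rightarrow> bool list \<times> int \<Rightarrow> bool list \<times> int" where
  "induced_action cm v \<rho> x e =
     (if fst e = [] then e
      else let s = hd (fst e); e' = (tl (fst e), snd e) in
        if x = v then if s then push False (\<rho> (copy False v) e') else push True e'
        else push s (\<rho> (copy (s \<and> \<not> cm v x) x) e'))"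

definition induced_inverse ::
    "('g \<times> bool list \<Rightarrow> 'g \<times> bool list \<Rightarrow> bool) \<Rightarrow> 'g \<times> bool list \<Rightarrow>
     ('g \<times> bool list \<Rightarrow> bool list \<times> int \<Rightarrow> bool list \<times> int) \<Rightarrow>
     'g \<times> bool list \<Rightarrow> bool list \<times> int \<Rightarrow> bool list \<times> int" where
  "induced_inverse cm v \<rho> x e =
     (if fst e = [] then e
      else let s = hd (fst e); e' = (tl (fst e), snd e) in
        if x = v then if s then push False e' else push True (inv_into UNIV (\<rho> (copy False v)) e')
        else push s (inv_into UNIV (\<rho> (copy (s \<and> \<not> cm v x) x)) e'))"

lemma push_cases: obtains k where "e = ([], k)" | s e' where "e = push s e'"
proof (cases e)
  case (Pair l k)
  then show ?thesis
    using that by (cases l) (auto simp: push_def)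
qed

lemma induced_simps:
  "induced_action cm v \<rho> x ([], k) = ([], k)"
  "induced_action cm v \<rho> x (push s e) =
     (if x = v then if s then push False (\<rho> (copy False v) e) else push True e
      else push s (\<rho> (copy (s \<and> \<not> cm v x) x) e))"
  "induced_inverse cm v \<rho> x ([], k) = ([], k)"
  "induced_inverse cm v \<rho> x (push s e) =
     (if x = v then if s then push False e else push True (inv_into UNIV (\<rho> (copy False v)) e)
      else push s (inv_into UNIV (\<rho> (copy (s \<and> \<not> cm v x) x)) e))"
  by (simp_all add: induced_action_def induced_inverse_def push_def)

lemma induced_action_inverse:
  assumes "\<And>x. bij (\<rho> x)"
  shows "bij (induced_action cm v \<rho> x)" "inv_into UNIV (induced_action cm v \<rho> x) = induced_inverse cm v \<rho> x"
proof -
  have r: "\<rho> x (inv_into UNIV (\<rho> x) e) = e" "inv_into UNIV (\<rho> x) (\<rho> x e) = e" for x e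
    using assms by (simp_all add: bij_is_surj surj_f_inv_f bij_is_inj)
  have 1: "induced_action cm v \<rho> x \<circ> induced_inverse cm v \<rho> x = id"
  proof
    fix e show "(induced_action cm v \<rho> x \<circ> induced_inverse cm v \<rho> x) e = id e"
      by (cases e rule: push_cases) (auto simp: induced_simps r)
  qed
  have 2: "induced_inverse cm v \<rho> x \<circ> induced_action cm v \<rho> x = id"
  proof
    fix e show "(induced_inverse cm v \<rho> x \<circ> induced_action cm v \<rho> x) e = id e"
      by (cases e rule: push_cases) (auto simp: induced_simps r)
  qed
  show "bij (induced_action cm v \<rho> x)" "inv_into UNIV (induced_action cm v \<rho> x) = induced_inverse cm v \<rho> x"
    using 1 2 o_bij inv_unique_comp by blast+
qed

lemma raag_action_induced:
  assumes "raag_action (even_comm cm v) \<rho>" "symp cm" "irreflp cm"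
  shows "raag_action cm (induced_action cm v \<rho>)"
  unfolding raag_action_def
proof (intro conjI allI impI)
  show "bij (induced_action cm v \<rho> x)" for x
    using induced_action_inverse raag_actionD(1)[OF assms(1)] by blast
  show "length (fst (induced_action cm v \<rho> x e)) = length (fst e)" for x e
  proof -
    have "length (fst (push s e)) = Suc (length (fst e))" for s e
      by (simp add: push_def)
    then show ?thesis
      by (cases e rule: push_cases) (simp_all add: induced_simps raag_actionD(2)[OF assms(1)])
  qed
  have tp: "translate k (push s e) = push s (translate k e)" for k s e
    by (simp add: translate_def push_def)
  show "induced_action cm v \<rho> x (translate k e) = translate k (induced_action cm v \<rho> x e)" for x k e
  proof (cases e rule: push_cases)
    case (1 j)
    then show ?thesis by (simp add: translate_def induced_simps)
  next
    case (2 s e')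
    then show ?thesis
      by (simp add: tp induced_simps raag_actionD(3)[OF assms(1)])
  qed
  have comm: "\<rho> (copy s x) (\<rho> (copy t y) e) = \<rho> (copy t y) (\<rho> (copy s x) e)"
    if "cm x y" "s = t \<or> cm v x \<or> cm v y" for x y s t e
    by (rule raag_actionD(4)[OF assms(1)]) (use that in simp)
  fix x y e assume xy: "cm x y"
  then have "x \<noteq> y" "cm y x"
    using irreflpD[OF assms(3), of x] sympD[OF assms(2), of x y] by auto
  then show "induced_action cm v \<rho> x (induced_action cm v \<rho> y e) =
      induced_action cm v \<rho> y (induced_action cm v \<rho> x e)"
    using xy by (cases e rule: push_cases) (auto simp: induced_simps intro!: arg_cong[of _ _ "push _"] comm)
qed

lemma word_act_induced:
  assumes "\<And>x. bij (\<rho> x)"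
  shows "word_act (induced_action cm v \<rho>) w (push s e) =
     push (s \<noteq> odd (exponent_sum v w)) (word_act \<rho> (even_word cm v s w) e)"
proof (induction w arbitrary: s e)
  case (Cons l w)
  have "letter_act (induced_action cm v \<rho>) l (push s e) =
     (if fst l = v then push (\<not> s) (if snd l = s then letter_act \<rho> (copy False v, s) e else e)
      else push s (letter_act \<rho> (copy (s \<and> \<not> cm v (fst l)) (fst l), snd l) e))"
    by (auto simp: letter_act_def induced_simps induced_action_inverse(2)[OF assms])
  then show ?case
    using Cons.IH by auto
qed simp

lemma raag_action_exponent_sum:
  "raag_action cm (\<lambda>x. if x = v then translate 1 else id)" (is "raag_action cm ?\<rho>")
  "word_act (\<lambda>x. if x = v then translate 1 else id) w e = translate (exponent_sum v w) e"
proof -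
  show "raag_action cm ?\<rho>"
    by (simp add: raag_action_def bij_translate) (simp add: translate_def)
  show "word_act ?\<rho> w e = translate (exponent_sum v w) e"
    by (induction w arbitrary: e) (auto simp: letter_act_def inv_translate add.commute)
qed

text \<open>
  Either the first generator \<open>v\<close> of the word has non-zero exponent sum, and the action in which
  \<open>v\<close> translates detects the word; or the word lies in the index two subgroup for \<open>v\<close>, where it is
  shorter because its first letter disappears, and an action of that subgroup is induced up.
\<close>
lemma reduced_word_translates_aux:
  fixes cm :: "'g \<times> bool list \<Rightarrow> 'g \<times> bool list \<Rightarrow> bool"
  assumes "symp cm" "irreflp cm" "reduced cm w" "w \<noteq> []"
  shows "\<exists>\<rho> l k. raag_action cm \<rho> \<and> k \<noteq> 0 \<and> word_act \<rho> w (l, 0) = (l, k)"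
  using assms
proof (induction "length w" arbitrary: w cm rule: less_induct)
  case less
  obtain v b w' where w: "w = (v, b) # w'"
    using less.prems(4) by (metis list.exhaust surj_pair)
  show ?case
  proof (cases "exponent_sum v w = 0")
    case False
    have "word_act (\<lambda>x. if x = v then translate 1 else id) w ([], 0) = ([], exponent_sum v w)"
      by (simp only: raag_action_exponent_sum(2)) (simp add: translate_def)
    then show ?thesis
      using raag_action_exponent_sum(1)[of cm v] False by blast
  next
    case True
    \<comment> \<open>starting in this coset, the first letter \<open>v\<^sup>b\<close> only changes the coset and disappears\<close>
    let ?w = "even_word cm v (\<not> b) w"
    have shorter: "length ?w < length w"
      using length_even_word[of cm v b w'] by (simp add: w)
    have "?w \<noteq> []"
      using even_word_eq_Nil[OF less.prems(3) _ True] less.prems(4) by auto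
    then obtain \<rho> l k where r: "raag_action (even_comm cm v) \<rho>" "k \<noteq> 0"
        "word_act \<rho> ?w (l, 0) = (l, k)"
      using less.hyps[OF shorter symp_even_comm[OF less.prems(1)] irreflp_even_comm[OF less.prems(2)]
          reduced_even_word[OF less.prems(2,1,3)]] by auto
    have "word_act (induced_action cm v \<rho>) w (push (\<not> b) (l, 0)) = push (\<not> b) (l, k)"
      using r True by (simp add: word_act_induced raag_actionD(1)[OF r(1)])
    then show ?thesis
      using raag_action_induced[OF r(1) less.prems(1,2)] r(2)
      by (intro exI[of _ "induced_action cm v \<rho>"] exI[of _ "(\<not> b) # l"] exI[of _ k])
         (simp add: push_def)
  qed
qed

theorem reduced_word_translates:
  fixes cm :: "'g \<Rightarrow> 'g \<Rightarrow> bool"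
  assumes "symp cm" "irreflp cm" "reduced cm w" "w \<noteq> []"
  obtains \<rho> l k where "raag_action cm \<rho>" "k \<noteq> 0" "word_act \<rho> w (l, 0) = (l, k)"
proof -
  define c where "c = (\<lambda>(a :: 'g \<times> bool list) (b :: 'g \<times> bool list). cm (fst a) (fst b) \<and> snd a = [] \<and> snd b = [])"
  define f :: "'g \<times> bool \<Rightarrow> ('g \<times> bool list) \<times> bool" where "f = (\<lambda>l. ((fst l, []), snd l))"
  have f [simp]: "fst (f l) = (fst l, [])" "snd (f l) = snd l" for l
    by (simp_all add: f_def)
  have c: "cancels_into c (x, []) b (map f w) = cancels_into cm x b w" for x b w
    by (induction w) (simp_all add: c_def)
  have "reduced c (map f w) = reduced cm w" for w
    by (induction w) (simp_all add: c)
  moreover have "symp c"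
    by (rule sympI) (simp add: c_def sympD[OF assms(1)])
  moreover have "irreflp c"
    by (rule irreflpI) (simp add: c_def irreflpD[OF assms(2)])
  ultimately obtain \<rho> l k where r: "raag_action c \<rho>" "k \<noteq> 0" "word_act \<rho> (map f w) (l, 0) = (l, k)"
    using reduced_word_translates_aux[of c "map f w"] assms(3,4) by auto
  let ?\<rho> = "\<lambda>x. \<rho> (x, [])"
  have "word_act ?\<rho> w e = word_act \<rho> (map f w) e" for e
    by (induction w arbitrary: e) (simp_all add: letter_act_def)
  then have "word_act ?\<rho> w (l, 0) = (l, k)"
    using r(3) by simp
  moreover have "?\<rho> x (?\<rho> y e) = ?\<rho> y (?\<rho> x e)" if "cm x y" for x y e
    by (rule raag_actionD(4)[OF r(1)]) (simp add: c_def that)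
  then have "raag_action cm ?\<rho>"
    unfolding raag_action_def using raag_actionD(1-3)[OF r(1)] by blast
  ultimately show ?thesis
    using that r(2) by blast
qed

section \<open>Homotopies of paths relative to the end points\<close>

abbreviation I01 :: "real topology" where
  "I01 \<equiv> top_of_set {0..1}"

definition path_homotopic :: "'a topology \<Rightarrow> (real \<Rightarrow> 'a) \<Rightarrow> (real \<Rightarrow> 'a) \<Rightarrow> bool" where
  "path_homotopic X p q \<longleftrightarrow> homotopic_with (\<lambda>r. r 0 = p 0 \<and> r 1 = p 1) I01 X p q"

lemma path_homotopicI:
  fixes h :: "real \<times> real \<Rightarrow> 'a"
  assumes "continuous_map (top_of_set ({0..1} \<times> {0..1})) X h"
    and "\<And>s. s \<in> {0..1} \<Longrightarrow> h (0, s) = p s" "\<And>s. s \<in> {0..1} \<Longrightarrow> h (1, s) = q s"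
    and "\<And>t. t \<in> {0..1} \<Longrightarrow> h (t, 0) = p 0" "\<And>t. t \<in> {0..1} \<Longrightarrow> h (t, 1) = p 1"
  shows "path_homotopic X p q"
  unfolding path_homotopic_def
proof (subst homotopic_with)
  show "\<exists>h. continuous_map (prod_topology I01 I01) X h \<and> (\<forall>x\<in>topspace I01. h (0, x) = p x) \<and>
      (\<forall>x\<in>topspace I01. h (1, x) = q x) \<and> (\<forall>t\<in>{0..1}. h (t, 0) = p 0 \<and> h (t, 1) = p 1)"
    by (intro exI[of _ h] conjI ballI) (use assms in simp_all)
qed auto

lemma path_homotopicE:
  assumes "path_homotopic X p q"
  obtains h :: "real \<times> real \<Rightarrow> 'a" where "continuous_map (top_of_set ({0..1} \<times> {0..1})) X h"
    "\<And>s. h (0, s) = p s" "\<And>s. h (1, s) = q s"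
    "\<And>t. t \<in> {0..1} \<Longrightarrow> h (t, 0) = p 0" "\<And>t. t \<in> {0..1} \<Longrightarrow> h (t, 1) = p 1"
proof -
  obtain h where "continuous_map (prod_topology I01 I01) X h"
    "\<forall>s. h (0, s) = p s" "\<forall>s. h (1, s) = q s" "\<forall>t\<in>{0..1}. h (t, 0) = p 0 \<and> h (t, 1) = p 1"
    using assms unfolding path_homotopic_def homotopic_with_def by blast
  then show ?thesis
    by (intro that[of h]) simp_all
qed

lemma path_homotopic_imp:
  assumes "path_homotopic X p q"
  shows "pathin X p" "pathin X q" "p 0 = q 0" "p 1 = q 1"
  using homotopic_with_imp_continuous_maps[OF assms[unfolded path_homotopic_def]]
    homotopic_with_imp_property[OF assms[unfolded path_homotopic_def]]
  by (auto simp: pathin_def)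

lemma path_homotopic_sym: "path_homotopic X p q \<Longrightarrow> path_homotopic X q p"
  using path_homotopic_imp(3,4)[of X p q] homotopic_with_symD[of _ I01 X p q]
  unfolding path_homotopic_def by simp

lemma path_homotopic_trans [trans]:
  "path_homotopic X p q \<Longrightarrow> path_homotopic X q r \<Longrightarrow> path_homotopic X p r"
  using path_homotopic_imp(3,4)[of X p q] homotopic_with_trans[of _ I01 X p q r]
  unfolding path_homotopic_def by simp

lemma path_homotopic_eq:
  assumes "pathin X p" "\<And>t. t \<in> {0..1} \<Longrightarrow> p t = q t"
  shows "path_homotopic X p q"
proof -
  have "continuous_map (top_of_set ({0..1} \<times> {0..1 :: real})) X (\<lambda>z :: real \<times> real. p (snd z))"
    using assms(1) unfolding pathin_def
    by (intro continuous_map_compose[of _ I01 snd X p, unfolded o_def])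
      (auto intro!: continuous_intros simp: continuous_map_in_subtopology)
  then show ?thesis
    by (rule path_homotopicI) (auto simp: assms)
qed

lemma path_homotopic_refl: "pathin X p \<Longrightarrow> path_homotopic X p p"
  by (rule path_homotopic_eq) auto

lemma path_homotopic_image:
  assumes "path_homotopic X p q" "continuous_map X Y f"
  shows "path_homotopic Y (f \<circ> p) (f \<circ> q)"
  using assms unfolding path_homotopic_def
  by (rule homotopic_with_compose_continuous_map_left) auto

lemma path_homotopic_convex:
  fixes C :: "'v::real_normed_vector set"
  assumes "convex C" "continuous_on {0..1} p" "continuous_on {0..1} q"
    and "p \<in> {0..1} \<rightarrow> C" "q \<in> {0..1} \<rightarrow> C" "p 0 = q 0" "p 1 = q 1"
  shows "path_homotopic (top_of_set C) p q"
proof (rule path_homotopicI)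
  let ?h = "\<lambda>(t, s). (1 - t) *\<^sub>R p s + t *\<^sub>R q s"
  have "continuous_on ({0..1} \<times> {0..1}) (\<lambda>z. p (snd z))" "continuous_on ({0..1} \<times> {0..1}) (\<lambda>z. q (snd z))"
    by (auto intro!: continuous_on_compose2[OF assms(2)] continuous_on_compose2[OF assms(3)] continuous_intros)
  then have "continuous_on ({0..1} \<times> {0..1}) ?h"
    unfolding split_beta by (intro continuous_intros)
  moreover have "?h z \<in> C" if "z \<in> {0..1} \<times> {0..1}" for z
    using that assms(1,4,5) by (auto simp: convex_def Pi_iff)
  ultimately show "continuous_map (top_of_set ({0..1} \<times> {0..1})) (top_of_set C) ?h"
    by (auto simp: continuous_map_in_subtopology)
qed (auto simp: assms(6,7) algebra_simps simp flip: scaleR_add_left)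

lemma pathin_compose_real:
  assumes "pathin X p" "continuous_on {0..1} f" "f \<in> {0..1} \<rightarrow> {0..1}"
  shows "pathin X (p \<circ> f)"
  using assms unfolding pathin_def
  by (intro continuous_map_compose[of _ I01]) (auto simp: continuous_map_in_subtopology)

lemma path_homotopic_reparametrize:
  assumes "pathin X p" "continuous_on {0..1} f" "continuous_on {0..1} g"
    and "f \<in> {0..1} \<rightarrow> {0..1}" "g \<in> {0..1} \<rightarrow> {0..1}" "f 0 = g 0" "f 1 = g 1"
  shows "path_homotopic X (p \<circ> f) (p \<circ> g)"
  by (rule path_homotopic_image[OF path_homotopic_convex])
    (use assms in \<open>auto simp: pathin_def\<close>)

lemma path_homotopic_reparametrize_to:
  assumes "pathin X p" "continuous_on {0..1} f" "f \<in> {0..1} \<rightarrow> {0..1}"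
    and "continuous_on {0..1} g" "g \<in> {0..1} \<rightarrow> {0..1}" "f 0 = g 0" "f 1 = g 1"
    and "\<And>t. t \<in> {0..1} \<Longrightarrow> q t = p (f t)" "\<And>t. t \<in> {0..1} \<Longrightarrow> r t = p (g t)"
  shows "path_homotopic X q r"
proof -
  have "path_homotopic X (p \<circ> f) q" "path_homotopic X (p \<circ> g) r"
    using assms by (auto intro!: path_homotopic_eq pathin_compose_real)
  then show ?thesis
    using path_homotopic_reparametrize[OF assms(1,2,4,3,5,6,7)]
      path_homotopic_sym path_homotopic_trans by blast
qed

subsection \<open>Concatenation\<close>

lemma continuous_map_concat:
  fixes f g :: "real \<times> real \<Rightarrow> 'a"
  assumes "continuous_map (top_of_set ({0..1} \<times> {0..1})) X f"
    and "continuous_map (top_of_set ({0..1} \<times> {0..1})) X g"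
    and "\<And>t. t \<in> {0..1} \<Longrightarrow> f (t, 1) = g (t, 0)"
  shows "continuous_map (top_of_set ({0..1} \<times> {0..1})) X (\<lambda>(t, s). path_concat (\<lambda>r. f (t, r)) (\<lambda>r. g (t, r)) s)"
proof -
  have "continuous_map (top_of_set ({0..1} \<times> {0..1})) X
      (\<lambda>z. if snd z \<le> 1 / 2 then f (fst z, 2 * snd z) else g (fst z, 2 * snd z - 1))"
  proof (rule continuous_map_cases_le)
    have "continuous_map (subtopology (top_of_set ({0..1} \<times> {0..1})) {z \<in> topspace (top_of_set ({0..1} \<times> {0..1})). snd z \<le> 1/2})
        X (f \<circ> (\<lambda>z. (fst z, 2 * snd z)))"
      by (rule continuous_map_compose[OF _ assms(1)])
        (auto simp: continuous_map_in_subtopology subtopology_subtopology intro!: continuous_intros)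
    then show "continuous_map (subtopology (top_of_set ({0..1} \<times> {0..1})) {z \<in> topspace (top_of_set ({0..1} \<times> {0..1})). snd z \<le> 1/2})
        X (\<lambda>z. f (fst z, 2 * snd z))"
      by (simp add: o_def)
    have "continuous_map (subtopology (top_of_set ({0..1} \<times> {0..1})) {z \<in> topspace (top_of_set ({0..1} \<times> {0..1})). 1/2 \<le> snd z})
        X (g \<circ> (\<lambda>z. (fst z, 2 * snd z - 1)))"
      by (rule continuous_map_compose[OF _ assms(2)])
        (auto simp: continuous_map_in_subtopology subtopology_subtopology intro!: continuous_intros)
    then show "continuous_map (subtopology (top_of_set ({0..1} \<times> {0..1})) {z \<in> topspace (top_of_set ({0..1} \<times> {0..1})). 1/2 \<le> snd z})
        X (\<lambda>z. g (fst z, 2 * snd z - 1))"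
      by (simp add: o_def)
    fix z assume "z \<in> topspace (top_of_set ({0..1} \<times> {0..1 :: real}) :: (real \<times> real) topology)" "snd z = 1 / 2"
    then have "2 * snd z = 1" "fst z \<in> {0..1}"
      by auto
    then show "f (fst z, 2 * snd z) = g (fst z, 2 * snd z - 1)"
      using assms(3) by simp
  qed (auto intro!: continuous_intros)
  then show ?thesis
    by (simp add: path_concat_def case_prod_unfold)
qed

lemma path_concat_ends [simp]: "path_concat p q 0 = p 0" "path_concat p q 1 = q 1"
  by (simp_all add: path_concat_def)

lemma comp_path_concat: "f \<circ> path_concat p q = path_concat (f \<circ> p) (f \<circ> q)"
  by (auto simp: path_concat_def)

lemma path_homotopic_concat:
  assumes "path_homotopic X p p'" "path_homotopic X q q'" "p 1 = q 0"
  shows "path_homotopic X (path_concat p q) (path_concat p' q')"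
proof -
  obtain h :: "real \<times> real \<Rightarrow> 'a" where h: "continuous_map (top_of_set ({0..1} \<times> {0..1})) X h"
      "\<And>s. h (0, s) = p s" "\<And>s. h (1, s) = p' s"
      "\<And>t. t \<in> {0..1} \<Longrightarrow> h (t, 0) = p 0" "\<And>t. t \<in> {0..1} \<Longrightarrow> h (t, 1) = p 1"
    by (rule path_homotopicE[OF assms(1)], rule that)
  obtain k :: "real \<times> real \<Rightarrow> 'a" where k: "continuous_map (top_of_set ({0..1} \<times> {0..1})) X k"
      "\<And>s. k (0, s) = q s" "\<And>s. k (1, s) = q' s"
      "\<And>t. t \<in> {0..1} \<Longrightarrow> k (t, 0) = q 0" "\<And>t. t \<in> {0..1} \<Longrightarrow> k (t, 1) = q 1"
    by (rule path_homotopicE[OF assms(2)], rule that)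
  have "continuous_map (top_of_set ({0..1} \<times> {0..1})) X (\<lambda>(t, s). path_concat (\<lambda>r. h (t, r)) (\<lambda>r. k (t, r)) s)"
    using h k assms(3) by (intro continuous_map_concat) auto
  then show ?thesis
    by (rule path_homotopicI) (auto simp: h k)
qed

lemma pathin_concat:
  assumes "pathin X p" "pathin X q" "p 1 = q 0"
  shows "pathin X (path_concat p q)"
  using path_homotopic_concat[of X p p q q] assms path_homotopic_imp path_homotopic_refl by metis

lemma path_concat_assoc:
  assumes "pathin X p" "pathin X q" "pathin X r" "p 1 = q 0" "q 1 = r 0"
  shows "path_homotopic X (path_concat (path_concat p q) r) (path_concat p (path_concat q r))"
proof -
  let ?c = "path_concat p (path_concat q r)"
  define f :: "real \<Rightarrow> real" where "f = (\<lambda>t. min (min (2 * t) (t + 1 / 4)) ((t + 1) / 2))"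
  have eq: "path_concat (path_concat p q) r t = ?c (f t)" if "t \<in> {0..1}" for t
  proof -
    consider "t \<le> 1/4" | "1/4 < t" "t \<le> 1/2" | "1/2 < t"
      by linarith
    then show ?thesis
    proof cases
      case 1
      then have "f t = 2 * t" by (auto simp: f_def)
      then show ?thesis using 1 by (simp add: path_concat_def)
    next
      case 2
      then have "f t = t + 1/4" by (auto simp: f_def)
      then show ?thesis using 2 by (simp add: path_concat_def algebra_simps)
    next
      case 3
      then have "f t = (t + 1) / 2" by (auto simp: f_def)
      then show ?thesis using 3 by (simp add: path_concat_def field_simps)
    qed
  qed
  have "pathin X ?c"
    using assms by (intro pathin_concat) auto
  then show ?thesis
    by (rule path_homotopic_reparametrize_to[where f = f and g = "\<lambda>t. t"])
      (simp_all add: eq, auto simp: f_def min_le_iff_disj intro!: continuous_intros)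
qed

lemma path_concat_const_left:
  assumes "pathin X p"
  shows "path_homotopic X (path_concat (\<lambda>_. p 0) p) p"
proof (rule path_homotopic_reparametrize_to[OF assms, where f = "\<lambda>t. max 0 (2 * t - 1)" and g = "\<lambda>t. t"])
  show "path_concat (\<lambda>_. p 0) p t = p (max 0 (2 * t - 1))" for t
    by (cases "t \<le> 1 / 2") (simp_all add: path_concat_def)
qed (auto intro!: continuous_intros)

lemma path_concat_const_right:
  assumes "pathin X p"
  shows "path_homotopic X (path_concat p (\<lambda>_. p 1)) p"
proof (rule path_homotopic_reparametrize_to[OF assms, where f = "\<lambda>t. min 1 (2 * t)" and g = "\<lambda>t. t"])
  show "path_concat p (\<lambda>_. p 1) t = p (min 1 (2 * t))" for t
    by (cases "t \<le> 1 / 2") (simp_all add: path_concat_def)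
qed (auto intro!: continuous_intros)

definition path_reverse :: "(real \<Rightarrow> 'a) \<Rightarrow> real \<Rightarrow> 'a" where
  "path_reverse p = (\<lambda>t. p (1 - t))"

lemma path_reverse_simps [simp]:
  "path_reverse p 0 = p 1" "path_reverse p 1 = p 0" "path_reverse (path_reverse p) = p"
  by (simp_all add: path_reverse_def)

lemma pathin_reverse: "pathin X p \<Longrightarrow> pathin X (path_reverse p)"
  unfolding path_reverse_def
  by (rule pathin_compose_real[of X p "\<lambda>t. 1 - t", unfolded o_def]) (auto intro!: continuous_intros)

lemma path_concat_reverse:
  assumes "pathin X p"
  shows "path_homotopic X (path_concat p (path_reverse p)) (\<lambda>_. p 0)"
proof (rule path_homotopic_reparametrize_to[OF assms, where f = "\<lambda>t. min (2 * t) (2 - 2 * t)" and g = "\<lambda>_. 0"])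
  show "path_concat p (path_reverse p) t = p (min (2 * t) (2 - 2 * t))" for t
    by (cases "t \<le> 1 / 2") (simp_all add: path_concat_def path_reverse_def)
qed (auto intro!: continuous_intros)

lemma path_reverse_concat:
  assumes "pathin X p"
  shows "path_homotopic X (path_concat (path_reverse p) p) (\<lambda>_. p 1)"
  using path_concat_reverse[OF pathin_reverse[OF assms]] by simp

lemma path_homotopic_square:
  fixes h :: "real \<times> real \<Rightarrow> 'a"
  assumes "continuous_map (top_of_set ({0..1} \<times> {0..1})) X h"
  shows "path_homotopic X (path_concat (\<lambda>s. h (s, 0)) (\<lambda>t. h (1, t)))
           (path_concat (\<lambda>t. h (0, t)) (\<lambda>s. h (s, 1)))"
proof -
  let ?p = "path_concat (\<lambda>s. (s, 0)) (\<lambda>t. (1, t)) :: real \<Rightarrow> real \<times> real"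
  let ?q = "path_concat (\<lambda>t. (0, t)) (\<lambda>s. (s, 1)) :: real \<Rightarrow> real \<times> real"
  let ?S = "top_of_set ({0..1} \<times> {0..1 :: real}) :: (real \<times> real) topology"
  have "pathin ?S ?p"
    by (rule pathin_concat; auto simp: pathin_def continuous_map_in_subtopology intro!: continuous_intros)
  moreover have "pathin ?S ?q"
    by (rule pathin_concat; auto simp: pathin_def continuous_map_in_subtopology intro!: continuous_intros)
  ultimately have "path_homotopic ?S ?p ?q"
    by (intro path_homotopic_convex convex_Times)
      (simp_all add: pathin_def continuous_map_in_subtopology image_subset_iff_funcset)
  from path_homotopic_image[OF this assms] show ?thesis
    by (simp add: comp_path_concat) (simp add: o_def)
qed

definition path_part :: "(real \<Rightarrow> 'a) \<Rightarrow> real \<Rightarrow> real \<Rightarrow> real \<Rightarrow> 'a" where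
  "path_part p a b = (\<lambda>s. p (a + (b - a) * s))"

lemma path_part_ends [simp]: "path_part p a b 0 = p a" "path_part p a b 1 = p b" "path_part p 0 1 = p"
  by (simp_all add: path_part_def)

lemma segment_in_unit:
  assumes "0 \<le> a" "a \<le> b" "b \<le> 1" "s \<in> {0..1 :: real}"
  shows "a + (b - a) * s \<in> {a..b}" "a + (b - a) * s \<in> {0..1}"
proof -
  have "0 \<le> (b - a) * s"
    by (rule mult_nonneg_nonneg) (use assms in simp_all)
  moreover have "(b - a) * s \<le> (b - a) * 1"
    by (rule mult_left_mono) (use assms in simp_all)
  ultimately show "a + (b - a) * s \<in> {a..b}" "a + (b - a) * s \<in> {0..1}"
    using assms by auto
qed

lemma pathin_part:
  assumes "pathin X p" "0 \<le> a" "a \<le> b" "b \<le> 1"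
  shows "pathin X (path_part p a b)"
  unfolding path_part_def
  by (rule pathin_compose_real[of X p "\<lambda>s. a + (b - a) * s", unfolded o_def])
    (use assms segment_in_unit(2)[OF assms(2-4)] in \<open>auto intro!: continuous_intros\<close>)

lemma path_part_concat:
  assumes "pathin X p" "0 \<le> a" "a \<le> b" "b \<le> c" "c \<le> 1"
  shows "path_homotopic X (path_part p a c) (path_concat (path_part p a b) (path_part p b c))"
proof (rule path_homotopic_reparametrize_to[OF assms(1), where f = "\<lambda>s. a + (c - a) * s"
      and g = "path_concat (\<lambda>s. a + (b - a) * s) (\<lambda>s. b + (c - b) * s)"])
  let ?g = "path_concat (\<lambda>s. a + (b - a) * s) (\<lambda>s. b + (c - b) * s)"
  have "pathin (top_of_set {0..1}) ?g"
    by (rule pathin_concat; use segment_in_unit[of a b] segment_in_unit[of b c] assms in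
        \<open>auto simp: pathin_def continuous_map_in_subtopology intro!: continuous_intros\<close>)
  then show "continuous_on {0..1} ?g" "?g \<in> {0..1} \<rightarrow> {0..1}"
    by (auto simp: pathin_def continuous_map_in_subtopology)
qed (use segment_in_unit[of a c] assms in \<open>auto simp: path_part_def path_concat_def intro!: continuous_intros\<close>)

section \<open>The fundamental group is a group\<close>

lemma loop_homotopic_iff: "p \<in> loops X x \<Longrightarrow> loop_homotopic X x p q \<longleftrightarrow> path_homotopic X p q"
  by (simp add: loops_def loop_homotopic_def path_homotopic_def)

lemma path_homotopic_loops: "path_homotopic X p q \<Longrightarrow> p \<in> loops X x \<Longrightarrow> q \<in> loops X x"
  using path_homotopic_imp[of X p q] by (simp add: loops_def)

lemma loop_class_eq: "p \<in> loops X x \<Longrightarrow> loop_class X x p = {q. path_homotopic X p q}"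
  using path_homotopic_loops[of X p _ x] by (auto simp: loop_class_def loop_homotopic_iff)

lemma loop_class_eq_iff:
  assumes "p \<in> loops X x" "q \<in> loops X x"
  shows "loop_class X x p = loop_class X x q \<longleftrightarrow> path_homotopic X p q"
proof
  have "path_homotopic X q q"
    using assms(2) by (simp add: loops_def path_homotopic_refl)
  then show "loop_class X x p = loop_class X x q \<Longrightarrow> path_homotopic X p q"
    using assms by (auto simp: loop_class_eq)
  assume "path_homotopic X p q"
  then have "path_homotopic X p r \<longleftrightarrow> path_homotopic X q r" for r
    using path_homotopic_sym path_homotopic_trans by blast
  then show "loop_class X x p = loop_class X x q"
    using assms by (simp add: loop_class_eq)
qed

lemma path_concat_loops: "p \<in> loops X x \<Longrightarrow> q \<in> loops X x \<Longrightarrow> path_concat p q \<in> loops X x"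
  by (simp add: loops_def pathin_concat)

lemma mult_loop_class:
  assumes "p \<in> loops X x" "q \<in> loops X x"
  shows "loop_class X x p \<otimes>\<^bsub>fundamental_group X x\<^esub> loop_class X x q = loop_class X x (path_concat p q)"
proof -
  have eq: "loop_class X x (path_concat p' q') = loop_class X x (path_concat p q)"
    if "p' \<in> loop_class X x p" "q' \<in> loop_class X x q" for p' q'
  proof -
    have "path_homotopic X p p'" "path_homotopic X q q'"
      using that assms by (auto simp: loop_class_eq)
    then have h: "path_homotopic X (path_concat p q) (path_concat p' q')"
      using assms by (intro path_homotopic_concat) (auto simp: loops_def)
    show ?thesis
      using loop_class_eq_iff[OF path_concat_loops[OF assms] path_homotopic_loops[OF h path_concat_loops[OF assms]]] h
      by simp
  qed
  have "p \<in> loop_class X x p" "q \<in> loop_class X x q"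
    using assms by (simp_all add: loop_class_eq loops_def path_homotopic_refl)
  then have ne: "loop_class X x p \<noteq> {}" "loop_class X x q \<noteq> {}"
    by blast+
  have "(\<Union>p'\<in>loop_class X x p. \<Union>q'\<in>loop_class X x q. loop_class X x (path_concat p' q')) =
      (\<Union>p'\<in>loop_class X x p. \<Union>q'\<in>loop_class X x q. loop_class X x (path_concat p q))"
    by (intro SUP_cong refl eq)
  then show ?thesis
    using ne by (simp add: fundamental_group_def)
qed

lemma carrier_fundamental_group: "carrier (fundamental_group X x) = loop_class X x ` loops X x"
  by (simp add: fundamental_group_def)

lemma one_fundamental_group: "\<one>\<^bsub>fundamental_group X x\<^esub> = loop_class X x (\<lambda>_. x)"
  by (simp add: fundamental_group_def)

lemma reverse_loops: "p \<in> loops X x \<Longrightarrow> path_reverse p \<in> loops X x"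
  by (simp add: loops_def pathin_reverse)

lemma loop_class_reverse:
  assumes "p \<in> loops X x"
  shows "loop_class X x (path_reverse p) \<otimes>\<^bsub>fundamental_group X x\<^esub> loop_class X x p =
    \<one>\<^bsub>fundamental_group X x\<^esub>"
proof -
  have h: "path_homotopic X (path_concat (path_reverse p) p) (\<lambda>_. x)"
    using path_reverse_concat[of X p] assms by (simp add: loops_def)
  have l: "path_concat (path_reverse p) p \<in> loops X x"
    by (rule path_concat_loops[OF reverse_loops[OF assms] assms])
  show ?thesis
    unfolding mult_loop_class[OF reverse_loops[OF assms] assms] one_fundamental_group
    using loop_class_eq_iff[OF l path_homotopic_loops[OF h l]] h by simp
qed

lemma group_fundamental_group:
  assumes "x \<in> topspace X"
  shows "group (fundamental_group X x)"
proof (rule groupI)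
  have const: "(\<lambda>_. x) \<in> loops X x"
    using assms by (simp add: loops_def)
  then show "\<one>\<^bsub>fundamental_group X x\<^esub> \<in> carrier (fundamental_group X x)"
    by (simp add: fundamental_group_def)
  fix A assume "A \<in> carrier (fundamental_group X x)"
  then obtain p where p: "p \<in> loops X x" "A = loop_class X x p"
    by (auto simp: carrier_fundamental_group)
  have "path_homotopic X (path_concat (\<lambda>_. x) p) p"
    using p path_concat_const_left[of X p] by (simp add: loops_def)
  then show "\<one>\<^bsub>fundamental_group X x\<^esub> \<otimes>\<^bsub>fundamental_group X x\<^esub> A = A"
    using p const by (simp add: one_fundamental_group mult_loop_class loop_class_eq_iff path_concat_loops)
  show "\<exists>B\<in>carrier (fundamental_group X x). B \<otimes>\<^bsub>fundamental_group X x\<^esub> A = \<one>\<^bsub>fundamental_group X x\<^esub>"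
    using p(2) loop_class_reverse[OF p(1)] reverse_loops[OF p(1)]
    by (intro bexI[of _ "loop_class X x (path_reverse p)"]) (simp_all add: carrier_fundamental_group)
  fix B assume "B \<in> carrier (fundamental_group X x)"
  then obtain q where q: "q \<in> loops X x" "B = loop_class X x q"
    by (auto simp: carrier_fundamental_group)
  show "A \<otimes>\<^bsub>fundamental_group X x\<^esub> B \<in> carrier (fundamental_group X x)"
    using p q by (simp add: mult_loop_class path_concat_loops carrier_fundamental_group)
  fix C assume "C \<in> carrier (fundamental_group X x)"
  then obtain r where r: "r \<in> loops X x" "C = loop_class X x r"
    by (auto simp: carrier_fundamental_group)
  have "path_homotopic X (path_concat (path_concat p q) r) (path_concat p (path_concat q r))"
    using p q r by (intro path_concat_assoc) (auto simp: loops_def)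
  then show "A \<otimes>\<^bsub>fundamental_group X x\<^esub> B \<otimes>\<^bsub>fundamental_group X x\<^esub> C =
      A \<otimes>\<^bsub>fundamental_group X x\<^esub> (B \<otimes>\<^bsub>fundamental_group X x\<^esub> C)"
    using p q r by (simp add: mult_loop_class path_concat_loops loop_class_eq_iff)
qed

section \<open>Lifting paths to covering spaces\<close>

definition sheets :: "'b topology \<Rightarrow> 'a topology \<Rightarrow> ('b \<Rightarrow> 'a) \<Rightarrow> 'a set \<Rightarrow> 'b set set \<Rightarrow> bool" where
  "sheets Y X p U \<V> \<longleftrightarrow> openin X U \<and> (\<forall>y\<in>topspace Y. p y \<in> U \<longrightarrow> (\<exists>V\<in>\<V>. y \<in> V)) \<and>
     (\<forall>V\<in>\<V>. openin Y V) \<and> (\<forall>V\<in>\<V>. inj_on p V) \<and>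
     (\<forall>V\<in>\<V>. \<forall>W\<in>\<V>. V \<noteq> W \<longrightarrow> V \<inter> W = {}) \<and>
     (\<forall>V\<in>\<V>. \<exists>s. continuous_map (subtopology X U) Y s \<and> (\<forall>u\<in>U. s u \<in> V \<and> p (s u) = u))"

lemma sheetsD:
  assumes "sheets Y X p U \<V>"
  shows "openin X U" "\<And>y. y \<in> topspace Y \<Longrightarrow> p y \<in> U \<Longrightarrow> \<exists>V\<in>\<V>. y \<in> V"
    "\<And>V. V \<in> \<V> \<Longrightarrow> openin Y V" "\<And>V. V \<in> \<V> \<Longrightarrow> inj_on p V"
    "\<And>V W. V \<in> \<V> \<Longrightarrow> W \<in> \<V> \<Longrightarrow> V \<noteq> W \<Longrightarrow> V \<inter> W = {}"
    "\<And>V. V \<in> \<V> \<Longrightarrow> \<exists>s. continuous_map (subtopology X U) Y s \<and> (\<forall>u\<in>U. s u \<in> V \<and> p (s u) = u)"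
  using assms unfolding sheets_def by simp_all

lemma covering_map_sheets:
  assumes "covering_map Y X p" "x \<in> topspace X"
  shows "\<exists>U \<V>. x \<in> U \<and> sheets Y X p U \<V>"
proof -
  obtain U \<V> where U: "x \<in> U" "openin X U" "\<Union>\<V> = {y \<in> topspace Y. p y \<in> U}"
    and V: "\<forall>V\<in>\<V>. openin Y V" "pairwise disjnt \<V>"
    and hom: "\<forall>V\<in>\<V>. homeomorphic_map (subtopology Y V) (subtopology X U) p"
    using assms unfolding covering_map_def by meson
  show ?thesis
    unfolding sheets_def
  proof (intro exI[of _ U] exI[of _ \<V>] conjI ballI impI U(1,2))
    show "\<exists>V\<in>\<V>. y \<in> V" if "y \<in> topspace Y" "p y \<in> U" for y
      using U(3) that by blast
    show "openin Y V" if "V \<in> \<V>" for V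
      using V(1) that by blast
    show "V \<inter> W = {}" if "V \<in> \<V>" "W \<in> \<V>" "V \<noteq> W" for V W
      using V(2) that by (simp add: pairwise_def disjnt_def)
    fix V assume "V \<in> \<V>"
    then have h: "homeomorphic_map (subtopology Y V) (subtopology X U) p" and "openin Y V"
      using hom V(1) by blast+
    then have top: "topspace (subtopology Y V) = V" "topspace (subtopology X U) = U"
      using U(2) openin_subset by (auto simp: topspace_subtopology)
    show "inj_on p V"
      using homeomorphic_imp_injective_map[OF h] top by simp
    obtain s where s: "homeomorphic_maps (subtopology Y V) (subtopology X U) p s"
      using h by (auto simp: homeomorphic_map_maps)
    then have "continuous_map (subtopology X U) (subtopology Y V) s" "\<forall>u\<in>U. p (s u) = u"
      using top unfolding homeomorphic_maps_def by auto
    then have "continuous_map (subtopology X U) Y s" "\<forall>u\<in>U. s u \<in> V \<and> p (s u) = u"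
      using continuous_map_image_subset_topspace[of "subtopology X U" "subtopology Y V" s] top
      by (auto simp: continuous_map_in_subtopology)
    then show "\<exists>s. continuous_map (subtopology X U) Y s \<and> (\<forall>u\<in>U. s u \<in> V \<and> p (s u) = u)"
      by blast
  qed
qed

lemma covering_map_continuous: "covering_map Y X p \<Longrightarrow> continuous_map Y X p"
  by (simp add: covering_map_def)

lemma unique_lifting:
  assumes cov: "covering_map Y X p" and "connected_space Z"
    and f: "continuous_map Z Y f" and g: "continuous_map Z Y g"
    and eq: "\<And>z. z \<in> topspace Z \<Longrightarrow> p (f z) = p (g z)"
    and z0: "z0 \<in> topspace Z" "f z0 = g z0" and z: "z \<in> topspace Z"
  shows "f z = g z"
proof -
  let ?A = "{z \<in> topspace Z. f z = g z}" and ?B = "{z \<in> topspace Z. f z \<noteq> g z}"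
  have fY: "f z \<in> topspace Y" and gY: "g z \<in> topspace Y" if "z \<in> topspace Z" for z
    using that continuous_map_image_subset_topspace[OF f] continuous_map_image_subset_topspace[OF g] by auto
  have nbhd: "\<exists>V W. openin Y V \<and> openin Y W \<and> f z \<in> V \<and> g z \<in> W \<and> (V = W \<and> inj_on p V \<or> V \<inter> W = {})"
    if z: "z \<in> topspace Z" for z
  proof -
    have "p (f z) \<in> topspace X"
      using fY[OF z] continuous_map_image_subset_topspace[OF covering_map_continuous[OF cov]] by auto
    then obtain U \<V> where U0: "p (f z) \<in> U" "sheets Y X p U \<V>"
      using covering_map_sheets[OF cov] by blast
    note U = sheetsD[OF U0(2)]
    obtain V where V: "V \<in> \<V>" "f z \<in> V"
      using U(2)[OF fY[OF z] U0(1)] by blast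
    obtain W where W: "W \<in> \<V>" "g z \<in> W"
      using U(2)[OF gY[OF z]] U0(1) eq[OF z] by auto
    show ?thesis
      using U(3,4)[OF V(1)] U(3)[OF W(1)] U(5)[OF V(1) W(1)] V(2) W(2) by metis
  qed
  have "openin Z ?A"
  proof (subst openin_subopen, intro ballI)
    fix z assume "z \<in> ?A"
    then have zZ: "z \<in> topspace Z" "f z = g z"
      by auto
    obtain V W where "openin Y V" "openin Y W" "f z \<in> V" "g z \<in> W" "V = W \<and> inj_on p V \<or> V \<inter> W = {}"
      using nbhd[OF zZ(1)] by blast
    with zZ have V: "z \<in> topspace Z" "f z = g z" "openin Y V" "openin Y W" "f z \<in> V" "g z \<in> W"
        "V = W \<and> inj_on p V \<or> V \<inter> W = {}"
      by blast+
    then have inj: "V = W" "inj_on p V"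
      by auto
    let ?T = "{z \<in> topspace Z. f z \<in> V} \<inter> {z \<in> topspace Z. g z \<in> V}"
    have "openin Z ?T"
      using V(3) openin_continuous_map_preimage[OF f] openin_continuous_map_preimage[OF g] by (intro openin_Int)
    moreover have "?T \<subseteq> ?A"
      using eq inj_onD[OF inj(2)] by auto
    ultimately show "\<exists>T. openin Z T \<and> z \<in> T \<and> T \<subseteq> ?A"
      using V inj(1) by (intro exI[of _ ?T]) auto
  qed
  moreover have "openin Z ?B"
  proof (subst openin_subopen, intro ballI)
    fix z assume "z \<in> ?B"
    then have zZ: "z \<in> topspace Z" "f z \<noteq> g z"
      by auto
    obtain V W where "openin Y V" "openin Y W" "f z \<in> V" "g z \<in> W" "V = W \<and> inj_on p V \<or> V \<inter> W = {}"
      using nbhd[OF zZ(1)] by blast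
    with zZ have V: "z \<in> topspace Z" "f z \<noteq> g z" "openin Y V" "openin Y W" "f z \<in> V" "g z \<in> W"
        "V = W \<and> inj_on p V \<or> V \<inter> W = {}"
      by blast+
    then have disj: "V \<inter> W = {}"
      using eq[OF V(1)] by (auto dest: inj_onD)
    let ?T = "{z \<in> topspace Z. f z \<in> V} \<inter> {z \<in> topspace Z. g z \<in> W}"
    have "openin Z ?T"
      using V(3,4) openin_continuous_map_preimage[OF f] openin_continuous_map_preimage[OF g] by (intro openin_Int)
    moreover have "?T \<subseteq> ?B"
      using disj by auto
    ultimately show "\<exists>T. openin Z T \<and> z \<in> T \<and> T \<subseteq> ?B"
      using V by (intro exI[of _ ?T]) auto
  qed
  moreover have "?A \<union> ?B = topspace Z" "?A \<inter> ?B = {}"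
    by auto
  ultimately have "?A = {} \<or> ?B = {}"
    using \<open>connected_space Z\<close> unfolding connected_space_def by blast
  then show ?thesis
    using z0 z by blast
qed

lemma connected_space_interval: "connected_space (top_of_set {a..b::real})"
  using connected_Icc[of a b] connectedin_iff_connected[of "{a..b}"] by (simp add: connectedin_def)

lemma continuous_map_metric_nbhd:
  fixes f :: "'m::metric_space \<Rightarrow> 'a"
  assumes "continuous_map (top_of_set S) X f" "z0 \<in> S" "openin X U" "f z0 \<in> U"
  obtains e where "e > 0" "\<And>z. z \<in> S \<Longrightarrow> dist z z0 < e \<Longrightarrow> f z \<in> U"
proof -
  have "openin (top_of_set S) {z \<in> S. f z \<in> U}"
    using openin_continuous_map_preimage[OF assms(1,3)] by simp
  then obtain e where "e > 0" "\<forall>z\<in>S. dist z z0 < e \<longrightarrow> z \<in> {z \<in> S. f z \<in> U}"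
    using assms(2,4) unfolding openin_euclidean_subtopology_iff by blast
  then show ?thesis
    using that by blast
qed

definition lifts_to :: "'b topology \<Rightarrow> ('b \<Rightarrow> 'a) \<Rightarrow> (real \<Rightarrow> 'a) \<Rightarrow> 'b \<Rightarrow> 'b \<Rightarrow> bool" where
  "lifts_to Y p \<sigma> y y' \<longleftrightarrow>
     (\<exists>\<tau>. pathin Y \<tau> \<and> (\<forall>t\<in>{0..1}. p (\<tau> t) = \<sigma> t) \<and> \<tau> 0 = y \<and> \<tau> 1 = y')"

lemma continuous_map_glue_intervals:
  fixes f g :: "real \<Rightarrow> 'a"
  assumes "continuous_map (top_of_set {a..b}) X f" "continuous_map (top_of_set {b..c}) X g"
    and "f b = g b"
  shows "continuous_map (top_of_set {a..c}) X (\<lambda>t. if t \<le> b then f t else g t)"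
proof (rule continuous_map_cases_le)
  have "{a..c} \<inter> {t \<in> {a..c}. t \<le> b} \<subseteq> {a..b}" "{a..c} \<inter> {t \<in> {a..c}. b \<le> t} \<subseteq> {b..c}"
    by auto
  then show "continuous_map (subtopology (top_of_set {a..c}) {t \<in> topspace (top_of_set {a..c}). t \<le> b}) X f"
    "continuous_map (subtopology (top_of_set {a..c}) {t \<in> topspace (top_of_set {a..c}). b \<le> t}) X g"
    using continuous_map_from_subtopology_mono assms(1,2)
    by (simp_all add: subtopology_subtopology) (blast intro: continuous_map_from_subtopology_mono)+
qed (use assms(3) in auto)

lemma path_lifting:
  assumes cov: "covering_map Y X p" and \<sigma>: "pathin X \<sigma>" and y: "y \<in> topspace Y" "p y = \<sigma> 0"
  obtains \<tau> where "pathin Y \<tau>" "\<And>t. t \<in> {0..1} \<Longrightarrow> p (\<tau> t) = \<sigma> t" "\<tau> 0 = y"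
proof -
  define P where "P a b \<longleftrightarrow> (0 \<le> a \<longrightarrow> b \<le> 1 \<longrightarrow> (\<forall>y\<in>topspace Y. p y = \<sigma> a \<longrightarrow>
    (\<exists>\<tau>. continuous_map (top_of_set {a..b}) Y \<tau> \<and> (\<forall>t\<in>{a..b}. p (\<tau> t) = \<sigma> t) \<and> \<tau> a = y)))"
    for a b :: real
  have "P 0 1"
  proof (rule Bolzano)
    fix a b c :: real assume ab: "P a b" and bc: "P b c" and le: "a \<le> b" "b \<le> c"
    show "P a c"
      unfolding P_def
    proof (intro impI ballI)
      fix y assume ac: "0 \<le> a" "c \<le> 1" and y: "y \<in> topspace Y" "p y = \<sigma> a"
      obtain \<tau> where \<tau>: "continuous_map (top_of_set {a..b}) Y \<tau>" "\<forall>t\<in>{a..b}. p (\<tau> t) = \<sigma> t" "\<tau> a = y"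
        using ab ac le y unfolding P_def by (meson order_trans)
      then have "\<tau> b \<in> topspace Y" "p (\<tau> b) = \<sigma> b"
        using continuous_map_image_subset_topspace[OF \<tau>(1)] le by auto
      then obtain \<tau>' where \<tau>': "continuous_map (top_of_set {b..c}) Y \<tau>'" "\<forall>t\<in>{b..c}. p (\<tau>' t) = \<sigma> t" "\<tau>' b = \<tau> b"
        using bc ac le unfolding P_def by (meson order_trans)
      show "\<exists>\<tau>. continuous_map (top_of_set {a..c}) Y \<tau> \<and> (\<forall>t\<in>{a..c}. p (\<tau> t) = \<sigma> t) \<and> \<tau> a = y"
        by (rule exI[of _ "\<lambda>t. if t \<le> b then \<tau> t else \<tau>' t"])
          (use \<tau> \<tau>' le continuous_map_glue_intervals[OF \<tau>(1) \<tau>'(1)] in auto)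
    qed
  next
    fix t0 :: real assume t0: "0 \<le> t0" "t0 \<le> 1"
    then have "\<sigma> t0 \<in> topspace X"
      using continuous_map_image_subset_topspace[of I01 X \<sigma>] \<sigma> by (auto simp: pathin_def)
    then obtain U \<V> where U0: "\<sigma> t0 \<in> U" "sheets Y X p U \<V>"
      using covering_map_sheets[OF cov] by blast
    note U = sheetsD[OF U0(2)]
    obtain e where e: "e > 0" "\<And>t. t \<in> {0..1} \<Longrightarrow> dist t t0 < e \<Longrightarrow> \<sigma> t \<in> U"
      using continuous_map_metric_nbhd[of "{0..1}" X \<sigma> t0 U] \<sigma> t0 U(1) U0(1) unfolding pathin_def by auto
    have "P a b" if ab: "a \<le> t0" "t0 \<le> b" "b - a < e" for a b
      unfolding P_def
    proof (intro impI ballI)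
      fix y assume ac: "0 \<le> a" "b \<le> 1" and y: "y \<in> topspace Y" "p y = \<sigma> a"
      have in_U: "\<sigma> t \<in> U" if "t \<in> {a..b}" for t
        using that ab ac by (intro e(2)) (auto simp: dist_real_def)
      obtain V where V: "V \<in> \<V>" "y \<in> V"
        using U(2)[OF y(1)] in_U[of a] y(2) ab by auto
      obtain s where s: "continuous_map (subtopology X U) Y s" "\<forall>u\<in>U. s u \<in> V \<and> p (s u) = u"
        using U(6)[OF V(1)] by blast
      have "continuous_map (top_of_set {a..b}) X \<sigma>"
        using \<sigma> ac unfolding pathin_def by (rule_tac continuous_map_from_subtopology_mono) auto
      then have "continuous_map (top_of_set {a..b}) (subtopology X U) \<sigma>"
        using in_U by (auto simp: continuous_map_in_subtopology)
      then have "continuous_map (top_of_set {a..b}) Y (s \<circ> \<sigma>)"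
        using s(1) by (rule continuous_map_compose)
      moreover have "s (\<sigma> a) = y"
        using s(2) in_U[of a] ab V(2) y(2) by (intro inj_onD[OF U(4)[OF V(1)]]) auto
      ultimately show "\<exists>\<tau>. continuous_map (top_of_set {a..b}) Y \<tau> \<and> (\<forall>t\<in>{a..b}. p (\<tau> t) = \<sigma> t) \<and> \<tau> a = y"
        using s(2) in_U by (intro exI[of _ "s \<circ> \<sigma>"]) auto
    qed
    then show "\<exists>d>0. \<forall>a b. a \<le> t0 \<and> t0 \<le> b \<and> b - a < d \<longrightarrow> P a b"
      using e(1) by blast
  qed simp
  then show ?thesis
    using that y unfolding P_def pathin_def by auto
qed

text \<open>
  What is needed of a covering map in the sequel.  Unlike being a covering map, this property is
  inherited by composites.
\<close>
definition path_lifting_map :: "'b topology \<Rightarrow> 'a topology \<Rightarrow> ('b \<Rightarrow> 'a) \<Rightarrow> bool" where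
  "path_lifting_map Y X p \<longleftrightarrow> continuous_map Y X p \<and>
     (\<forall>\<sigma> y. pathin X \<sigma> \<longrightarrow> y \<in> topspace Y \<longrightarrow> p y = \<sigma> 0 \<longrightarrow>
        (\<exists>\<tau>. pathin Y \<tau> \<and> (\<forall>t\<in>{0..1}. p (\<tau> t) = \<sigma> t) \<and> \<tau> 0 = y)) \<and>
     (\<forall>\<tau> \<tau>'. pathin Y \<tau> \<longrightarrow> pathin Y \<tau>' \<longrightarrow> \<tau> 0 = \<tau>' 0 \<longrightarrow>
        (\<forall>t\<in>{0..1}. p (\<tau> t) = p (\<tau>' t)) \<longrightarrow> (\<forall>t\<in>{0..1}. \<tau> t = \<tau>' t)) \<and>
     (\<forall>\<tau> \<sigma>'. pathin Y \<tau> \<longrightarrow> path_homotopic X (p \<circ> \<tau>) \<sigma>' \<longrightarrow>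
        (\<exists>\<tau>'. path_homotopic Y \<tau> \<tau>' \<and> (\<forall>t\<in>{0..1}. p (\<tau>' t) = \<sigma>' t)))"

lemma path_lifting_mapD:
  assumes "path_lifting_map Y X p"
  shows "continuous_map Y X p"
    "pathin X \<sigma> \<Longrightarrow> y \<in> topspace Y \<Longrightarrow> p y = \<sigma> 0 \<Longrightarrow>
      \<exists>\<tau>. pathin Y \<tau> \<and> (\<forall>t\<in>{0..1}. p (\<tau> t) = \<sigma> t) \<and> \<tau> 0 = y"
    "pathin Y \<tau> \<Longrightarrow> pathin Y \<tau>' \<Longrightarrow> \<tau> 0 = \<tau>' 0 \<Longrightarrow> \<forall>t\<in>{0..1}. p (\<tau> t) = p (\<tau>' t) \<Longrightarrow>
      \<forall>t\<in>{0..1}. \<tau> t = \<tau>' t"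
    "pathin Y \<tau> \<Longrightarrow> path_homotopic X (p \<circ> \<tau>) \<sigma>' \<Longrightarrow>
      \<exists>\<tau>'. path_homotopic Y \<tau> \<tau>' \<and> (\<forall>t\<in>{0..1}. p (\<tau>' t) = \<sigma>' t)"
  using assms unfolding path_lifting_map_def by simp_all

lemma path_lifting_map_compose:
  assumes p: "path_lifting_map Y X p" and q: "path_lifting_map Z Y q"
  shows "path_lifting_map Z X (p \<circ> q)"
  unfolding path_lifting_map_def
proof (intro conjI allI impI)
  show "continuous_map Z X (p \<circ> q)"
    by (rule continuous_map_compose[OF path_lifting_mapD(1)[OF q] path_lifting_mapD(1)[OF p]])
  have push: "pathin Y (q \<circ> \<tau>)" if "pathin Z \<tau>" for \<tau>
    by (rule pathin_compose[OF that path_lifting_mapD(1)[OF q]])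
  show "\<exists>\<tau>. pathin Z \<tau> \<and> (\<forall>t\<in>{0..1}. (p \<circ> q) (\<tau> t) = \<sigma> t) \<and> \<tau> 0 = z"
    if \<sigma>: "pathin X \<sigma>" and z: "z \<in> topspace Z" "(p \<circ> q) z = \<sigma> 0" for \<sigma> z
  proof -
    have "q z \<in> topspace Y" "p (q z) = \<sigma> 0"
      using z continuous_map_image_subset_topspace[OF path_lifting_mapD(1)[OF q]] by auto
    then obtain \<tau> where \<tau>: "pathin Y \<tau>" "\<forall>t\<in>{0..1}. p (\<tau> t) = \<sigma> t" "\<tau> 0 = q z"
      using path_lifting_mapD(2)[OF p \<sigma>] by blast
    then obtain \<tau>' where "pathin Z \<tau>'" "\<forall>t\<in>{0..1}. q (\<tau>' t) = \<tau> t" "\<tau>' 0 = z"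
      using path_lifting_mapD(2)[OF q \<tau>(1) z(1)] by auto
    then show ?thesis
      using \<tau>(2) by (intro exI[of _ \<tau>']) simp
  qed
  show "\<forall>t\<in>{0..1}. \<tau> t = \<tau>' t"
    if \<tau>: "pathin Z \<tau>" "pathin Z \<tau>'" "\<tau> 0 = \<tau>' 0" "\<forall>t\<in>{0..1}. (p \<circ> q) (\<tau> t) = (p \<circ> q) (\<tau>' t)" for \<tau> \<tau>'
  proof (rule path_lifting_mapD(3)[OF q \<tau>(1-3)])
    show "\<forall>t\<in>{0..1}. q (\<tau> t) = q (\<tau>' t)"
      using path_lifting_mapD(3)[OF p push[OF \<tau>(1)] push[OF \<tau>(2)]] \<tau>(3,4) by simp
  qed
  show "\<exists>\<tau>'. path_homotopic Z \<tau> \<tau>' \<and> (\<forall>t\<in>{0..1}. (p \<circ> q) (\<tau>' t) = \<sigma>' t)"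
    if \<tau>: "pathin Z \<tau>" "path_homotopic X (p \<circ> q \<circ> \<tau>) \<sigma>'" for \<tau> \<sigma>'
  proof -
    obtain \<upsilon> where \<upsilon>: "path_homotopic Y (q \<circ> \<tau>) \<upsilon>" "\<forall>t\<in>{0..1}. p (\<upsilon> t) = \<sigma>' t"
      using path_lifting_mapD(4)[OF p push[OF \<tau>(1)]] \<tau>(2) by (auto simp: comp_assoc)
    obtain \<tau>' where "path_homotopic Z \<tau> \<tau>'" "\<forall>t\<in>{0..1}. q (\<tau>' t) = \<upsilon> t"
      using path_lifting_mapD(4)[OF q \<tau>(1) \<upsilon>(1)] by blast
    then show ?thesis
      using \<upsilon>(2) by (intro exI[of _ \<tau>']) simp
  qed
qed

lemma lifts_to_exists:
  assumes "path_lifting_map Y X p" "pathin X \<sigma>" "y \<in> topspace Y" "p y = \<sigma> 0"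
  shows "\<exists>y'. lifts_to Y p \<sigma> y y'"
  using path_lifting_mapD(2)[OF assms] unfolding lifts_to_def by blast

lemma lifts_to_unique:
  assumes "path_lifting_map Y X p" "lifts_to Y p \<sigma> y y1" "lifts_to Y p \<sigma> y y2"
  shows "y1 = y2"
proof -
  obtain f where f: "pathin Y f" "\<forall>t\<in>{0..1}. p (f t) = \<sigma> t" "f 0 = y" "f 1 = y1"
    using assms(2) unfolding lifts_to_def by blast
  obtain g where g: "pathin Y g" "\<forall>t\<in>{0..1}. p (g t) = \<sigma> t" "g 0 = y" "g 1 = y2"
    using assms(3) unfolding lifts_to_def by blast
  have "\<forall>t\<in>{0..1}. f t = g t"
    using f g by (intro path_lifting_mapD(3)[OF assms(1)]) simp_all
  then show ?thesis
    using f g by simp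
qed

lemma lifts_to_homotopic:
  assumes p: "path_lifting_map Y X p" and h: "path_homotopic X \<sigma> \<sigma>'" and l: "lifts_to Y p \<sigma> y y'"
  shows "lifts_to Y p \<sigma>' y y'"
proof -
  obtain \<tau> where \<tau>: "pathin Y \<tau>" "\<forall>t\<in>{0..1}. p (\<tau> t) = \<sigma> t" "\<tau> 0 = y" "\<tau> 1 = y'"
    using l unfolding lifts_to_def by blast
  have "path_homotopic X (p \<circ> \<tau>) \<sigma>"
    using pathin_compose[OF \<tau>(1) path_lifting_mapD(1)[OF p]] \<tau>(2) by (intro path_homotopic_eq) simp_all
  then have "path_homotopic X (p \<circ> \<tau>) \<sigma>'"
    using h by (rule path_homotopic_trans)
  then obtain \<tau>' where "path_homotopic Y \<tau> \<tau>'" "\<forall>t\<in>{0..1}. p (\<tau>' t) = \<sigma>' t"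
    using path_lifting_mapD(4)[OF p \<tau>(1)] by blast
  then show ?thesis
    unfolding lifts_to_def using path_homotopic_imp[of Y \<tau> \<tau>'] \<tau>(3,4) by (intro exI[of _ \<tau>']) simp
qed

lemma lifts_to_imp:
  assumes "lifts_to Y p \<sigma> y y'"
  shows "y \<in> topspace Y" "y' \<in> topspace Y" "p y = \<sigma> 0" "p y' = \<sigma> 1"
proof -
  obtain f where f: "pathin Y f" "\<forall>t\<in>{0..1}. p (f t) = \<sigma> t" "f 0 = y" "f 1 = y'"
    using assms unfolding lifts_to_def by blast
  moreover from this have "f 0 \<in> topspace Y" "f 1 \<in> topspace Y"
    using continuous_map_image_subset_topspace[of I01 Y f] by (auto simp: pathin_def)
  ultimately show "y \<in> topspace Y" "y' \<in> topspace Y" "p y = \<sigma> 0" "p y' = \<sigma> 1"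
    by auto
qed

lemma lifts_to_concat:
  assumes "lifts_to Y p \<sigma> y y'" "lifts_to Y p \<sigma>' y' y''"
  shows "lifts_to Y p (path_concat \<sigma> \<sigma>') y y''"
proof -
  obtain f where f: "pathin Y f" "\<forall>t\<in>{0..1}. p (f t) = \<sigma> t" "f 0 = y" "f 1 = y'"
    using assms(1) unfolding lifts_to_def by blast
  obtain g where g: "pathin Y g" "\<forall>t\<in>{0..1}. p (g t) = \<sigma>' t" "g 0 = y'" "g 1 = y''"
    using assms(2) unfolding lifts_to_def by blast
  show ?thesis
    unfolding lifts_to_def
    by (rule exI[of _ "path_concat f g"])
      (use f g pathin_concat[OF f(1) g(1)] in \<open>auto simp: path_concat_def\<close>)
qed

lemma lifts_to_reverse:
  assumes "lifts_to Y p \<sigma> y y'"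
  shows "lifts_to Y p (path_reverse \<sigma>) y' y"
proof -
  obtain f where f: "pathin Y f" "\<forall>t\<in>{0..1}. p (f t) = \<sigma> t" "f 0 = y" "f 1 = y'"
    using assms(1) unfolding lifts_to_def by blast
  show ?thesis
    unfolding lifts_to_def
    by (rule exI[of _ "path_reverse f"])
      (use f pathin_reverse[OF f(1)] in \<open>auto simp: path_reverse_def\<close>)
qed

lemma lifts_to_deck:
  assumes "lifts_to Y p \<sigma> y y'" "continuous_map Y Y f" "\<And>y. y \<in> topspace Y \<Longrightarrow> p (f y) = p y"
  shows "lifts_to Y p \<sigma> (f y) (f y')"
proof -
  obtain \<tau> where \<tau>: "pathin Y \<tau>" "\<forall>t\<in>{0..1}. p (\<tau> t) = \<sigma> t" "\<tau> 0 = y" "\<tau> 1 = y'"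
    using assms(1) unfolding lifts_to_def by blast
  then have "\<tau> t \<in> topspace Y" if "t \<in> {0..1}" for t
    using continuous_map_image_subset_topspace[of I01 Y \<tau>] that by (auto simp: pathin_def)
  then show ?thesis
    unfolding lifts_to_def using \<tau> assms(3) pathin_compose[OF \<tau>(1) assms(2)]
    by (intro exI[of _ "f \<circ> \<tau>"]) simp
qed

text \<open>
  Homotopies lift: lift all rows.  That the values of the lifts at \<open>s\<close> depend continuously on the
  row passes from the start to the end of short intervals, on which the lifts stay in one sheet.
  The end points form a lift of a constant path, so they are constant.
\<close>
lemma homotopy_lifting:
  fixes X :: "'a topology" and Y :: "'b topology"
  assumes cov: "covering_map Y X p" and \<tau>0: "pathin Y \<tau>0" and hom: "path_homotopic X (p \<circ> \<tau>0) \<sigma>'"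
  shows "\<exists>\<tau>'. path_homotopic Y \<tau>0 \<tau>' \<and> (\<forall>t\<in>{0..1}. p (\<tau>' t) = \<sigma>' t)"
proof -
  define \<sigma> where "\<sigma> = p \<circ> \<tau>0"
  define y where "y = \<tau>0 0"
  obtain h :: "real \<times> real \<Rightarrow> 'a" where h: "continuous_map (top_of_set ({0..1} \<times> {0..1})) X h"
      "\<And>s. h (0, s) = \<sigma> s" "\<And>s. h (1, s) = \<sigma>' s"
      "\<And>t. t \<in> {0..1} \<Longrightarrow> h (t, 0) = \<sigma> 0" "\<And>t. t \<in> {0..1} \<Longrightarrow> h (t, 1) = \<sigma> 1"
    by (rule path_homotopicE[OF hom[folded \<sigma>_def]], rule that)
  have y: "y \<in> topspace Y" "p y = \<sigma> 0"
    using \<tau>0 continuous_map_image_subset_topspace[of I01 Y \<tau>0] by (auto simp: y_def \<sigma>_def pathin_def)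
  have hX: "h z \<in> topspace X" if "z \<in> {0..1} \<times> {0..1}" for z
    using continuous_map_image_subset_topspace[OF h(1)] that by auto
  have row: "pathin X (\<lambda>s. h (t, s))" if "t \<in> {0..1}" for t
    unfolding pathin_def using that
    by (intro continuous_map_compose[OF _ h(1), of _ "\<lambda>s. (t, s)", unfolded o_def])
      (auto simp: continuous_map_in_subtopology intro!: continuous_intros)
  have "\<exists>\<tau>. pathin Y \<tau> \<and> (\<forall>s\<in>{0..1}. p (\<tau> s) = h (t, s)) \<and> \<tau> 0 = y" if t: "t \<in> {0..1}" for t
  proof -
    have "p y = h (t, 0)"
      using h(4)[OF t] y(2) by simp
    from path_lifting[OF cov row[OF t] y(1) this] show ?thesis
      by metis
  qed
  then obtain \<tau> where \<tau>: "\<And>t. t \<in> {0..1} \<Longrightarrow> pathin Y (\<tau> t)"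
    "\<And>t s. t \<in> {0..1} \<Longrightarrow> s \<in> {0..1} \<Longrightarrow> p (\<tau> t s) = h (t, s)" "\<And>t. t \<in> {0..1} \<Longrightarrow> \<tau> t 0 = y"
    by metis
  define C where "C t0 s \<longleftrightarrow> (\<forall>W. openin Y W \<longrightarrow> \<tau> t0 s \<in> W \<longrightarrow>
      (\<exists>d>0. \<forall>t\<in>{0..1}. \<bar>t - t0\<bar> < d \<longrightarrow> \<tau> t s \<in> W))" for t0 s
  \<comment> \<open>on a short interval, the lifts of the nearby rows stay in the sheet that they start in\<close>
  have loc: "\<exists>d>0. \<forall>a b. a \<le> s0 \<longrightarrow> s0 \<le> b \<longrightarrow> b - a < d \<longrightarrow> 0 \<le> a \<longrightarrow> b \<le> 1 \<longrightarrow> C t0 a \<longrightarrow>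
      (\<exists>U sec e. e > 0 \<and> openin X U \<and> continuous_map (subtopology X U) Y sec \<and>
        (\<forall>t\<in>{0..1}. \<forall>s\<in>{a..b}. \<bar>t - t0\<bar> < e \<longrightarrow> h (t, s) \<in> U \<and> \<tau> t s = sec (h (t, s))))"
    if t0: "t0 \<in> {0..1}" and s0: "s0 \<in> {0..1}" for t0 s0
  proof -
    have z0: "(t0, s0) \<in> {0..1} \<times> {0..1}"
      using t0 s0 by simp
    then have "h (t0, s0) \<in> topspace X"
      by (rule hX)
    then obtain U \<V> where U0: "h (t0, s0) \<in> U" "sheets Y X p U \<V>"
      using covering_map_sheets[OF cov] by blast
    note U = sheetsD[OF U0(2)]
    obtain e where e: "e > 0" "\<And>z. z \<in> {0..1} \<times> {0..1} \<Longrightarrow> dist z (t0, s0) < e \<Longrightarrow> h z \<in> U"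
      by (rule continuous_map_metric_nbhd[OF h(1) z0 U(1) U0(1)], rule that)
    have in_U: "h (t, s) \<in> U" if "t \<in> {0..1}" "s \<in> {0..1}" "\<bar>t - t0\<bar> < e / 2" "\<bar>s - s0\<bar> < e / 2" for t s
    proof (rule e(2))
      have "dist (t, s) (t0, s0) \<le> dist t t0 + dist s s0"
        by (simp add: dist_Pair_Pair sqrt_sum_squares_le_sum)
      then show "dist (t, s) (t0, s0) < e"
        using that by (simp add: dist_real_def)
    qed (use that in simp)
    have "\<exists>U sec e. e > 0 \<and> openin X U \<and> continuous_map (subtopology X U) Y sec \<and>
        (\<forall>t\<in>{0..1}. \<forall>s\<in>{a..b}. \<bar>t - t0\<bar> < e \<longrightarrow> h (t, s) \<in> U \<and> \<tau> t s = sec (h (t, s)))"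
      if ab: "a \<le> s0" "s0 \<le> b" "b - a < e / 2" and ab': "0 \<le> a" "b \<le> 1" and Ca: "C t0 a" for a b
    proof -
      have in_I: "a \<in> {0..1}" "b \<in> {0..1}"
        using ab ab' by auto
      have in_U': "h (t, s) \<in> U" if "t \<in> {0..1}" "s \<in> {a..b}" "\<bar>t - t0\<bar> < e / 2" for t s
      proof (rule in_U)
        have "\<bar>s - s0\<bar> \<le> b - a"
          using that(2) ab(1,2) by (simp add: abs_le_iff)
        then show "\<bar>s - s0\<bar> < e / 2"
          using ab(3) by linarith
      qed (use that ab' in auto)
      have "\<tau> t0 a \<in> topspace Y"
        using continuous_map_image_subset_topspace[of I01 Y "\<tau> t0"] \<tau>(1)[OF t0] in_I by (auto simp: pathin_def)
      moreover have "p (\<tau> t0 a) \<in> U"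
        using \<tau>(2)[OF t0 in_I(1)] in_U'[OF t0, of a] e(1) ab by simp
      ultimately obtain V where V: "V \<in> \<V>" "\<tau> t0 a \<in> V"
        using U(2) by blast
      obtain sec where sec: "continuous_map (subtopology X U) Y sec" "\<forall>u\<in>U. sec u \<in> V \<and> p (sec u) = u"
        using U(6)[OF V(1)] by blast
      have lift: "\<tau> t s = sec (h (t, s))"
        if t: "t \<in> {0..1}" "\<bar>t - t0\<bar> < e / 2" "\<tau> t a \<in> V" and s: "s \<in> {a..b}" for t s
      proof -
        have sub: "{a..b} \<subseteq> {0..1}"
          using ab' by auto
        have c1: "continuous_map (top_of_set {a..b}) Y (\<tau> t)"
          by (rule continuous_map_from_subtopology_mono[OF \<tau>(1)[OF t(1), unfolded pathin_def] sub])
        have "continuous_map (top_of_set {a..b}) X (\<lambda>s. h (t, s))"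
          by (rule continuous_map_from_subtopology_mono[OF row[OF t(1), unfolded pathin_def] sub])
        then have c2: "continuous_map (top_of_set {a..b}) Y (sec \<circ> (\<lambda>s. h (t, s)))"
          using in_U' t by (intro continuous_map_compose[OF _ sec(1)]) (auto simp: continuous_map_in_subtopology)
        have "\<tau> t s = (sec \<circ> (\<lambda>s. h (t, s))) s"
        proof (rule unique_lifting[OF cov connected_space_interval c1 c2])
          show "\<tau> t a = (sec \<circ> (\<lambda>s. h (t, s))) a"
            using t \<tau>(2)[OF t(1) in_I(1)] sec(2) in_U'[OF t(1), of a] ab
            by (intro inj_onD[OF U(4)[OF V(1)]]) auto
          show "p (\<tau> t s) = p ((sec \<circ> (\<lambda>s. h (t, s))) s)" if "s \<in> topspace (top_of_set {a..b})" for s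
            using that t \<tau>(2)[OF t(1), of s] sec(2) in_U'[OF t(1), of s] sub by auto
        qed (use ab s in auto)
        then show ?thesis by simp
      qed
      obtain d where d: "d > 0" "\<forall>t\<in>{0..1}. \<bar>t - t0\<bar> < d \<longrightarrow> \<tau> t a \<in> V"
        using Ca U(3)[OF V(1)] V(2) unfolding C_def by blast
      show ?thesis
      proof (rule exI[of _ U], rule exI[of _ sec], rule exI[of _ "min d (e / 2)"], intro conjI ballI impI)
        fix t s assume ts: "t \<in> {0..1}" "s \<in> {a..b}" "\<bar>t - t0\<bar> < min d (e / 2)"
        then have small: "\<bar>t - t0\<bar> < d" "\<bar>t - t0\<bar> < e / 2"
          by simp_all
        show "h (t, s) \<in> U"
          by (rule in_U'[OF ts(1,2) small(2)])
        show "\<tau> t s = sec (h (t, s))"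
          using d(2) ts(1) small(1) by (intro lift[OF ts(1) small(2) _ ts(2)]) blast
      qed (use d(1) e(1) U(1) sec(1) in simp_all)
    qed
    then show ?thesis
      using e(1) by (intro exI[of _ "e / 2"]) simp
  qed
  have near_sec: "\<exists>e'>0. \<forall>z\<in>{0..1} \<times> {0..1}. dist z z0 < e' \<longrightarrow> sec (h z) \<in> W"
    if U: "openin X U" "continuous_map (subtopology X U) Y sec" and W: "openin Y W"
      and z0: "z0 \<in> {0..1} \<times> {0..1}" "h z0 \<in> U" "sec (h z0) \<in> W" for U sec W z0
  proof -
    have "openin (subtopology X U) {u \<in> topspace (subtopology X U). sec u \<in> W}"
      by (rule openin_continuous_map_preimage[OF U(2) W])
    then have op: "openin X {u \<in> U. sec u \<in> W}"
      using openin_open_subtopology[OF U(1)] openin_subset[OF U(1)]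
      by (simp add: topspace_subtopology inf_absorb2)
    have hz: "h z0 \<in> {u \<in> U. sec u \<in> W}"
      using z0 by simp
    obtain e' where "e' > 0" "\<And>z. z \<in> {0..1} \<times> {0..1} \<Longrightarrow> dist z z0 < e' \<Longrightarrow> h z \<in> {u \<in> U. sec u \<in> W}"
      by (rule continuous_map_metric_nbhd[OF h(1) z0(1) op hz], rule that)
    then show ?thesis
      by blast
  qed
  have C: "C t0 r" if t0: "t0 \<in> {0..1}" and r: "r \<in> {0..1}" for t0 r
  proof -
    define P where "P a b \<longleftrightarrow> (0 \<le> a \<longrightarrow> b \<le> 1 \<longrightarrow> C t0 a \<longrightarrow> C t0 b)" for a b :: real
    have "P 0 r"
    proof (rule Bolzano)
      show "P a c" if "P a b" "P b c" "a \<le> b" "b \<le> c" for a b c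
        using that unfolding P_def by linarith
      fix s0 :: real assume s0: "0 \<le> s0" "s0 \<le> r"
      then have s0': "s0 \<in> {0..1}"
        using r by simp
      obtain d where d: "d > 0" and near: "\<forall>a b. a \<le> s0 \<longrightarrow> s0 \<le> b \<longrightarrow> b - a < d \<longrightarrow> 0 \<le> a \<longrightarrow> b \<le> 1 \<longrightarrow> C t0 a \<longrightarrow>
        (\<exists>U sec e. e > 0 \<and> openin X U \<and> continuous_map (subtopology X U) Y sec \<and>
        (\<forall>t\<in>{0..1}. \<forall>s\<in>{a..b}. \<bar>t - t0\<bar> < e \<longrightarrow> h (t, s) \<in> U \<and> \<tau> t s = sec (h (t, s))))"
        using loc[OF t0 s0'] by blast
      have "P a b" if ab: "a \<le> s0" "s0 \<le> b" "b - a < d" for a b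
        unfolding P_def
      proof (intro impI)
        assume ab': "0 \<le> a" "b \<le> 1" and Ca: "C t0 a"
        obtain U sec e where U: "e > 0" "openin X U" "continuous_map (subtopology X U) Y sec"
          and eq: "\<forall>t\<in>{0..1}. \<forall>s\<in>{a..b}. \<bar>t - t0\<bar> < e \<longrightarrow> h (t, s) \<in> U \<and> \<tau> t s = sec (h (t, s))"
          using near ab ab' Ca by blast
        have b: "b \<in> {a..b}" "b \<in> {0..1}"
          using ab ab' by auto
        show "C t0 b"
          unfolding C_def
        proof (intro allI impI)
          fix W assume W: "openin Y W" "\<tau> t0 b \<in> W"
          have z0: "(t0, b) \<in> {0..1} \<times> {0..1}" "h (t0, b) \<in> U" "sec (h (t0, b)) \<in> W"
            using t0 b eq U(1) W(2) by auto
          obtain e' where e': "e' > 0" "\<forall>z\<in>{0..1} \<times> {0..1}. dist z (t0, b) < e' \<longrightarrow> sec (h z) \<in> W"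
            using near_sec[OF U(2,3) W(1) z0] by blast
          have "\<tau> t b \<in> W" if t: "t \<in> {0..1}" "\<bar>t - t0\<bar> < min e e'" for t
          proof -
            have "dist (t, b) (t0, b) < e'"
              using t by (simp add: dist_Pair_Pair dist_real_def)
            then have "sec (h (t, b)) \<in> W"
              using e'(2) t b by simp
            then show ?thesis
              using eq t b by simp
          qed
          then show "\<exists>d>0. \<forall>t\<in>{0..1}. \<bar>t - t0\<bar> < d \<longrightarrow> \<tau> t b \<in> W"
            using U(1) e'(1) by (intro exI[of _ "min e e'"]) simp
        qed
      qed
      then show "\<exists>d>0. \<forall>a b. a \<le> s0 \<and> s0 \<le> b \<and> b - a < d \<longrightarrow> P a b"
        using d by blast
    qed (use r in simp)
    moreover have "C t0 0"
      unfolding C_def using \<tau>(3) t0 zero_less_one by (metis (no_types))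
    ultimately show ?thesis
      using r unfolding P_def by simp
  qed
  let ?S = "top_of_set ({0..1} \<times> {0..1}) :: (real \<times> real) topology" and ?H = "\<lambda>z. \<tau> (fst z) (snd z)"
  have cont: "continuous_map ?S Y ?H"
    unfolding continuous_map_def
  proof (intro conjI allI impI)
    show "?H \<in> topspace ?S \<rightarrow> topspace Y"
      using \<tau>(1) continuous_map_image_subset_topspace[of I01 Y] by (fastforce simp: pathin_def)
    fix W assume W: "openin Y W"
    have "\<exists>e>0. \<forall>z\<in>{0..1} \<times> {0..1}. dist z z0 < e \<longrightarrow> ?H z \<in> W"
      if z0: "z0 \<in> {0..1} \<times> {0..1}" "?H z0 \<in> W" for z0
    proof -
      obtain t0 s0 where ts: "z0 = (t0, s0)" "t0 \<in> {0..1}" "s0 \<in> {0..1}"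
        using z0(1) by auto
      obtain d where d: "d > 0" and near: "\<forall>a b. a \<le> s0 \<longrightarrow> s0 \<le> b \<longrightarrow> b - a < d \<longrightarrow> 0 \<le> a \<longrightarrow> b \<le> 1 \<longrightarrow> C t0 a \<longrightarrow>
        (\<exists>U sec e. e > 0 \<and> openin X U \<and> continuous_map (subtopology X U) Y sec \<and>
        (\<forall>t\<in>{0..1}. \<forall>s\<in>{a..b}. \<bar>t - t0\<bar> < e \<longrightarrow> h (t, s) \<in> U \<and> \<tau> t s = sec (h (t, s))))"
        using loc[OF ts(2,3)] by blast
      define a where "a = max 0 (s0 - d / 3)"
      define b where "b = min 1 (s0 + d / 3)"
      have ab: "a \<le> s0" "s0 \<le> b" "b - a < d" "0 \<le> a" "b \<le> 1" "a \<in> {0..1}"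
        using ts(3) d by (auto simp: a_def b_def)
      obtain U sec e where U: "e > 0" "openin X U" "continuous_map (subtopology X U) Y sec"
          and eq: "\<forall>t\<in>{0..1}. \<forall>s\<in>{a..b}. \<bar>t - t0\<bar> < e \<longrightarrow> h (t, s) \<in> U \<and> \<tau> t s = sec (h (t, s))"
        using near ab C[OF ts(2) ab(6)] by blast
      have "h z0 \<in> U" "sec (h z0) \<in> W"
        using eq ts ab(1,2) U(1) z0(2) by auto
      then obtain e' where e': "e' > 0" "\<forall>z\<in>{0..1} \<times> {0..1}. dist z z0 < e' \<longrightarrow> sec (h z) \<in> W"
        using near_sec[OF U(2,3) W z0(1)] by blast
      have "?H z \<in> W" if z: "z \<in> {0..1} \<times> {0..1}" "dist z z0 < min (d / 3) (min e e')" for z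
      proof -
        have "\<bar>fst z - t0\<bar> < e" "\<bar>snd z - s0\<bar> < d / 3"
          using z(2) dist_fst_le[of z z0] dist_snd_le[of z z0] by (simp_all add: ts(1) dist_real_def)
        moreover from this have "s0 - d / 3 \<le> snd z" "snd z \<le> s0 + d / 3"
          by linarith+
        then have "snd z \<in> {a..b}"
          using z(1) by (auto simp: a_def b_def)
        ultimately have "\<tau> (fst z) (snd z) = sec (h (fst z, snd z))"
          using eq z(1) by auto
        moreover have "sec (h z) \<in> W"
          using bspec[OF e'(2) z(1)] z(2) by simp
        ultimately show ?thesis
          by simp
      qed
      then show ?thesis
        using d U(1) e'(1) by (intro exI[of _ "min (d / 3) (min e e')"]) simp
    qed
    then show "openin ?S {z \<in> topspace ?S. ?H z \<in> W}"
      unfolding openin_euclidean_subtopology_iff by auto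
  qed
  have ends: "\<tau> t 1 = \<tau> 0 1" if t: "t \<in> {0..1}" for t
  proof -
    have "continuous_map I01 Y (?H \<circ> (\<lambda>t. (t, 1)))"
      by (rule continuous_map_compose[OF _ cont])
        (auto simp: continuous_map_in_subtopology intro!: continuous_intros)
    then have c1: "continuous_map I01 Y (\<lambda>t. \<tau> t 1)"
      by (simp add: o_def)
    have "\<tau> 0 1 \<in> topspace Y"
      using continuous_map_image_subset_topspace[OF c1] by auto
    then have c2: "continuous_map I01 Y (\<lambda>_. \<tau> 0 1)"
      by simp
    show ?thesis
    proof (rule unique_lifting[OF cov connected_space_interval c1 c2])
      show "p (\<tau> t 1) = p (\<tau> 0 1)" if "t \<in> topspace I01" for t
        using \<tau>(2)[of t 1] \<tau>(2)[of 0 1] h(5)[of t] h(5)[of 0] that by simp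
      show "0 \<in> topspace I01" "t \<in> topspace I01" "\<tau> 0 1 = \<tau> 0 1"
        using t by auto
    qed
  qed
  have "\<tau> 0 s = \<tau>0 s" if s: "s \<in> {0..1}" for s
  proof (rule unique_lifting[OF cov connected_space_interval])
    show "continuous_map I01 Y (\<tau> 0)" "continuous_map I01 Y \<tau>0"
      using \<tau>(1)[of 0] \<tau>0 by (simp_all add: pathin_def)
    show "p (\<tau> 0 s) = p (\<tau>0 s)" if "s \<in> topspace I01" for s
      using \<tau>(2)[of 0 s] h(2) that by (simp add: \<sigma>_def)
    show "0 \<in> topspace I01" "\<tau> 0 0 = \<tau>0 0" "s \<in> topspace I01"
      using \<tau>(3)[of 0] s by (auto simp: y_def)
  qed
  then have "path_homotopic Y \<tau>0 (\<tau> 1)"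
    using \<tau>(3) ends by (intro path_homotopicI[OF cont]) (auto simp: y_def)
  then show ?thesis
    using \<tau>(2)[of 1] h(3) by (intro exI[of _ "\<tau> 1"]) simp
qed

lemma covering_map_path_lifting:
  assumes cov: "covering_map Y X p"
  shows "path_lifting_map Y X p"
  unfolding path_lifting_map_def
proof (intro conjI allI impI)
  show "continuous_map Y X p"
    by (rule covering_map_continuous[OF cov])
  show "\<exists>\<tau>. pathin Y \<tau> \<and> (\<forall>t\<in>{0..1}. p (\<tau> t) = \<sigma> t) \<and> \<tau> 0 = y"
    if "pathin X \<sigma>" "y \<in> topspace Y" "p y = \<sigma> 0" for \<sigma> y
    using path_lifting[OF cov that] by metis
  show "\<forall>t\<in>{0..1}. \<tau> t = \<tau>' t"
    if "pathin Y \<tau>" "pathin Y \<tau>'" "\<tau> 0 = \<tau>' 0" "\<forall>t\<in>{0..1}. p (\<tau> t) = p (\<tau>' t)" for \<tau> \<tau>'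
  proof
    fix t :: real assume "t \<in> {0..1}"
    show "\<tau> t = \<tau>' t"
      by (rule unique_lifting[OF cov connected_space_interval[of 0 1], of \<tau> \<tau>' 0])
        (use that \<open>t \<in> {0..1}\<close> in \<open>auto simp: pathin_def\<close>)
  qed
  show "\<exists>\<tau>'. path_homotopic Y \<tau> \<tau>' \<and> (\<forall>t\<in>{0..1}. p (\<tau>' t) = \<sigma>' t)"
    if "pathin Y \<tau>" "path_homotopic X (p \<circ> \<tau>) \<sigma>'" for \<tau> \<sigma>'
    by (rule homotopy_lifting[OF cov that])
qed

section \<open>Faces of cubes\<close>

lemma topspace_cube_top [simp]: "topspace (cube_top n) = cube n"
  by (simp add: cube_top_def cube_def)

lemma cube_iff: "u \<in> cube n \<longleftrightarrow> u \<in> extensional {..<n} \<and> (\<forall>i<n. 0 \<le> u i \<and> u i \<le> 1)"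
  by (auto simp: cube_def PiE_def Pi_iff)

lemma open_cube_iff: "u \<in> open_cube n \<longleftrightarrow> u \<in> extensional {..<n} \<and> (\<forall>i<n. 0 < u i \<and> u i < 1)"
  by (auto simp: open_cube_def PiE_def Pi_iff)

lemma cube_vertices_iff:
  "u \<in> cube_vertices n \<longleftrightarrow> u \<in> extensional {..<n} \<and> (\<forall>i<n. u i = 0 \<or> u i = 1)"
  by (auto simp: cube_vertices_def PiE_def Pi_iff)

lemma open_cube_subset: "u \<in> open_cube n \<Longrightarrow> u \<in> cube n"
  by (auto simp: cube_iff open_cube_iff less_imp_le)

lemma cube_vertices_subset: "u \<in> cube_vertices n \<Longrightarrow> u \<in> cube n"
  by (force simp: cube_iff cube_vertices_iff)

definition flip :: "(nat \<Rightarrow> real) \<Rightarrow> nat \<Rightarrow> nat \<Rightarrow> real" where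
  "flip r j = r(j := 1 - r j)"

lemma flip_simps [simp]: "flip r j j = 1 - r j" "i \<noteq> j \<Longrightarrow> flip r j i = r i" "flip (flip r j) j = r"
  by (auto simp: flip_def)

lemma flip_vertex: "r \<in> cube_vertices n \<Longrightarrow> j < n \<Longrightarrow> flip r j \<in> cube_vertices n"
  by (auto simp: cube_vertices_iff flip_def extensional_def)

lemma cube_vertices_induct:
  assumes "p \<in> cube_vertices n" "q \<in> cube_vertices n" "P p"
    and "\<And>r j. r \<in> cube_vertices n \<Longrightarrow> j < n \<Longrightarrow> P r \<Longrightarrow> P (flip r j)"
  shows "P q"
proof -
  let ?r = "\<lambda>k j. if j < k then q j else p j"
  have r: "?r k \<in> cube_vertices n" for k
    using assms(1,2) by (auto simp: cube_vertices_iff extensional_def)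
  have "k \<le> n \<Longrightarrow> P (?r k)" for k
  proof (induction k)
    case 0
    then show ?case using assms(3) by simp
  next
    case (Suc k)
    show ?case
    proof (cases "q k = p k")
      case True
      then have "?r (Suc k) = ?r k"
        by (auto simp: fun_eq_iff less_Suc_eq)
      then show ?thesis
        using Suc by simp
    next
      case False
      then have "q k = 1 - p k"
        using assms(1,2) Suc.prems by (auto simp: cube_vertices_iff dest!: spec[of _ k])
      then have "?r (Suc k) = flip (?r k) k"
        by (auto simp: fun_eq_iff less_Suc_eq flip_def)
      then show ?thesis
        using assms(4)[OF r, of k k] Suc by simp
    qed
  qed
  from this[of n] have "P (?r n)"
    by simp
  moreover have "?r n = q"
    using assms(1,2) by (auto simp: cube_vertices_iff extensional_def fun_eq_iff)
  ultimately show ?thesis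
    by simp
qed

text \<open>The isometric embedding of the \<open>m\<close>-cube as a face of the \<open>n\<close>-cube with given parameters.\<close>
definition face_emb ::
    "nat \<Rightarrow> nat \<Rightarrow> (nat \<Rightarrow> nat) \<Rightarrow> (nat \<Rightarrow> bool) \<Rightarrow> (nat \<Rightarrow> real) \<Rightarrow> (nat \<Rightarrow> real) \<Rightarrow> nat \<Rightarrow> real" where
  "face_emb m n s b a w =
     (\<lambda>j\<in>{..<n}. if j \<in> s ` {..<m}
        then (let i = inv_into {..<m} s j in if b i then 1 - w i else w i) else a j)"

definition face_coord :: "nat \<Rightarrow> (nat \<Rightarrow> nat) \<Rightarrow> (nat \<Rightarrow> bool) \<Rightarrow> (nat \<Rightarrow> real) \<Rightarrow> nat \<Rightarrow> real" where
  "face_coord m s b u = (\<lambda>i\<in>{..<m}. if b i then 1 - u (s i) else u (s i))"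

locale face_parameters =
  fixes m n :: nat and s :: "nat \<Rightarrow> nat" and b :: "nat \<Rightarrow> bool" and a :: "nat \<Rightarrow> real"
  assumes inj: "inj_on s {..<m}" and range: "s ` {..<m} \<subseteq> {..<n}" and corner: "j < n \<Longrightarrow> a j \<in> {0, 1}"
begin

abbreviation "emb \<equiv> face_emb m n s b a"

lemma s_less: "i < m \<Longrightarrow> s i < n"
  using range by auto

lemma emb_on: "i < m \<Longrightarrow> emb w (s i) = (if b i then 1 - w i else w i)"
  using inj s_less by (simp add: face_emb_def)

lemma emb_off: "j < n \<Longrightarrow> j \<notin> s ` {..<m} \<Longrightarrow> emb w j = a j"
  by (simp add: face_emb_def)

lemma emb_extensional: "emb w \<in> extensional {..<n}"
  by (simp add: face_emb_def)

lemma emb_cases: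
  assumes "j < n" "\<And>i. i < m \<Longrightarrow> j = s i \<Longrightarrow> P" "j \<notin> s ` {..<m} \<Longrightarrow> P"
  shows P
  using assms by auto

lemma emb_vertex:
  assumes "w \<in> cube_vertices m"
  shows "emb w \<in> cube_vertices n"
  unfolding cube_vertices_iff
proof (intro conjI allI impI emb_extensional)
  fix j assume j: "j < n"
  show "emb w j = 0 \<or> emb w j = 1"
    by (rule emb_cases[OF j]; use assms corner[OF j] j in \<open>auto simp: emb_on emb_off cube_vertices_iff\<close>)
qed

lemma emb_eqI:
  assumes "u \<in> extensional {..<n}" "\<And>i. i < m \<Longrightarrow> u (s i) = (if b i then 1 - w i else w i)"
    and "\<And>j. j < n \<Longrightarrow> j \<notin> s ` {..<m} \<Longrightarrow> u j = a j"
  shows "emb w = u"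
proof (rule extensionalityI[OF emb_extensional assms(1)])
  fix j assume "j \<in> {..<n}"
  then have j: "j < n" by simp
  show "emb w j = u j"
    by (rule emb_cases[OF j]) (use assms j in \<open>auto simp: emb_on emb_off\<close>)
qed

lemma emb_face_coord:
  assumes "u \<in> extensional {..<n}" "\<And>j. j < n \<Longrightarrow> j \<notin> s ` {..<m} \<Longrightarrow> u j = a j"
  shows "emb (face_coord m s b u) = u"
  by (rule emb_eqI) (use assms in \<open>auto simp: face_coord_def\<close>)

lemma face_coord_vertex: "u \<in> cube_vertices n \<Longrightarrow> face_coord m s b u \<in> cube_vertices m"
  using s_less by (auto simp: face_coord_def cube_vertices_iff)

lemma face_coord_open:
  "(\<And>i. i < m \<Longrightarrow> 0 < u (s i) \<and> u (s i) < 1) \<Longrightarrow> face_coord m s b u \<in> open_cube m"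
  by (auto simp: face_coord_def open_cube_iff)

lemma emb_move:
  assumes "r \<in> cube_vertices m" "i < m" "t \<in> {0..1}"
  shows "emb (r(i := \<bar>r i - t\<bar>)) = (emb r)(s i := \<bar>emb r (s i) - t\<bar>)"
proof (rule emb_eqI)
  show "(emb r)(s i := \<bar>emb r (s i) - t\<bar>) \<in> extensional {..<n}"
    using emb_extensional s_less[OF assms(2)] by (auto simp: extensional_def)
  show "((emb r)(s i := \<bar>emb r (s i) - t\<bar>)) (s k) =
      (if b k then 1 - (r(i := \<bar>r i - t\<bar>)) k else (r(i := \<bar>r i - t\<bar>)) k)" if "k < m" for k
  proof (cases "k = i")
    case True
    moreover have "r i = 0 \<or> r i = 1"
      using assms(1,2) by (simp add: cube_vertices_iff)
    ultimately show ?thesis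
      using assms(2,3) by (auto simp: emb_on)
  next
    case False
    then have "s k \<noteq> s i"
      using inj that assms(2) by (auto dest: inj_onD)
    then show ?thesis
      using False that by (simp add: emb_on)
  qed
  show "((emb r)(s i := \<bar>emb r (s i) - t\<bar>)) j = a j" if "j < n" "j \<notin> s ` {..<m}" for j
    using that assms(2) by (auto simp: emb_off)
qed

lemma emb_flip:
  assumes "r \<in> cube_vertices m" "i < m"
  shows "emb (flip r i) = flip (emb r) (s i)"
proof -
  have v: "\<bar>x - 1\<bar> = 1 - x" if "x = 0 \<or> x = 1" for x :: real
    using that by auto
  have "r i = 0 \<or> r i = 1" "emb r (s i) = 0 \<or> emb r (s i) = 1"
    using assms emb_vertex[OF assms(1)] s_less by (auto simp: cube_vertices_iff)
  then show ?thesis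
    using emb_move[OF assms, of 1] by (simp add: flip_def v)
qed

end

text \<open>
  The characteristic map of \<open>d\<close> is the restriction of that of \<open>c\<close> to the face with the given
  parameters, with no symmetry of the cube in between.
\<close>
definition is_face ::
    "('a, 'c) cell_structure \<Rightarrow> 'c \<Rightarrow> 'c \<Rightarrow> (nat \<Rightarrow> nat) \<Rightarrow> (nat \<Rightarrow> bool) \<Rightarrow> (nat \<Rightarrow> real) \<Rightarrow> bool" where
  "is_face X d c s b a \<longleftrightarrow> d \<in> cells X \<and> face_parameters (cdim X d) (cdim X c) s a \<and>
     (\<forall>w\<in>cube (cdim X d). cmap X c (face_emb (cdim X d) (cdim X c) s b a w) = cmap X d w)"

locale cube_cx =
  fixes X :: "('a, 'c) cell_structure"
  assumes cube_complex: "cube_complex X"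
begin

abbreviation "dm \<equiv> cdim X"

lemma face_cell:
  assumes "c \<in> cells X" "cube_face_map m (dm c) \<phi>"
  shows "\<exists>d\<in>cells X. dm d = m \<and>
    (\<exists>\<psi>. cube_face_map m m \<psi> \<and> (\<forall>u\<in>cube m. cmap X c (\<phi> u) = cmap X d (\<psi> u)))"
proof -
  have "\<forall>c\<in>cells X. \<forall>m \<phi>. cube_face_map m (dm c) \<phi> \<longrightarrow> (\<exists>d\<in>cells X. dm d = m \<and>
    (\<exists>\<psi>. cube_face_map m m \<psi> \<and> (\<forall>u\<in>cube m. cmap X c (\<phi> u) = cmap X d (\<psi> u))))"
    using cube_complex unfolding cube_complex_def by (elim conjE)
  then show ?thesis
    using assms by simp
qed

text \<open>
  The definition of a cube complex glues a face to a cell only up to a symmetry of the cube.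
  Absorbing the symmetry into the parameters of the face, the characteristic map of the cell is
  itself the restriction to the face.
\<close>
lemma face_exists:
  assumes c: "c \<in> cells X" and u: "u \<in> cube (dm c)" and J: "J \<subseteq> {..<dm c}"
    and off: "\<And>j. j < dm c \<Longrightarrow> j \<notin> J \<Longrightarrow> u j = 0 \<or> u j = 1"
  shows "\<exists>d s b a. is_face X d c s b a \<and> s ` {..<dm d} = J \<and> dm d = card J \<and>
    (\<forall>j<dm c. j \<notin> J \<longrightarrow> a j = u j)"
proof -
  let ?n = "dm c" and ?m = "card J"
  have "finite J"
    using J finite_subset by blast
  then obtain s0 where s0: "bij_betw s0 {..<?m} J"
    using ex_bij_betw_nat_finite by (metis atLeast0LessThan)
  then have inj0: "inj_on s0 {..<?m}" and img0: "s0 ` {..<?m} = J"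
    by (auto simp: bij_betw_def)
  define a where "a j = (if j \<in> J then 0 else u j)" for j
  interpret F0: face_parameters ?m ?n s0 "\<lambda>_. False" a
    by standard (use inj0 img0 J off in \<open>auto simp: a_def\<close>)
  have "cube_face_map ?m ?n F0.emb"
    unfolding cube_face_map_def
  proof (intro exI conjI ballI allI impI)
    show "F0.emb w \<in> extensional {..<?n}" for w
      by (rule F0.emb_extensional)
    show "F0.emb w (s0 i) = (if False then 1 - w i else w i)" if "i < ?m" for w i
      using F0.emb_on[OF that] by simp
    show "F0.emb w j = a j" if "j \<in> {..<?n} - s0 ` {..<?m}" for w j
      using that F0.emb_off by auto
  qed (use F0.inj F0.range F0.corner in auto)
  from face_cell[OF c this] obtain d \<psi> where d: "d \<in> cells X" "dm d = ?m"
    and \<psi>: "cube_face_map ?m ?m \<psi>" and eq': "\<forall>w\<in>cube ?m. cmap X c (F0.emb w) = cmap X d (\<psi> w)"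
    by (elim bexE conjE exE)
  note eq = bspec[OF eq']
  obtain s1 b1 a1 where "inj_on s1 {..<?m} \<and> s1 ` {..<?m} \<subseteq> {..<?m} \<and> (\<forall>j<?m. a1 j \<in> {0, 1 :: real}) \<and>
      (\<forall>w\<in>cube ?m. \<psi> w \<in> extensional {..<?m} \<and>
        (\<forall>i<?m. \<psi> w (s1 i) = (if b1 i then 1 - w i else w i)) \<and>
        (\<forall>j\<in>{..<?m} - s1 ` {..<?m}. \<psi> w j = a1 j))"
    using \<psi> unfolding cube_face_map_def by (elim exE)
  then have inj1: "inj_on s1 {..<?m}" and sub1: "s1 ` {..<?m} \<subseteq> {..<?m}"
    and \<psi>': "\<forall>w\<in>cube ?m. \<psi> w \<in> extensional {..<?m} \<and> (\<forall>i<?m. \<psi> w (s1 i) = (if b1 i then 1 - w i else w i))"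
    by simp_all
  have \<psi>_ext: "\<psi> w \<in> extensional {..<?m}" if "w \<in> cube ?m" for w
    using \<psi>' that by simp
  have \<psi>_on: "\<psi> w (s1 i) = (if b1 i then 1 - w i else w i)" if "w \<in> cube ?m" "i < ?m" for w i
    using \<psi>' that by simp
  have img1: "s1 ` {..<?m} = {..<?m}"
    using inj1 sub1 by (simp add: endo_inj_surj)
  define t where "t = inv_into {..<?m} s1"
  have t: "t (s1 i) = i" if "i < ?m" for i
    using inj1 that by (simp add: t_def)
  have t': "t k < ?m" "s1 (t k) = k" if "k < ?m" for k
    using that img1 inv_into_into[of k s1 "{..<?m}"] f_inv_into_f[of k s1 "{..<?m}"] by (auto simp: t_def)
  define s where "s = s0 \<circ> t"
  define b where "b = b1 \<circ> t"
  have img: "s ` {..<?m} = J"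
  proof -
    have "t ` {..<?m} = {..<?m}"
      using t t' sub1 by (auto simp: image_iff) (metis imageI lessThan_iff subsetD)
    then show ?thesis
      using img0 by (simp only: s_def image_comp[symmetric])
  qed
  interpret F: face_parameters ?m ?n s b a
  proof
    show "inj_on s {..<?m}"
      unfolding s_def
    proof (rule comp_inj_on)
      show "inj_on t {..<?m}"
        by (rule inj_on_inverseI[of _ s1]) (simp add: t'(2))
      then show "inj_on s0 (t ` {..<?m})"
        using inj0 t'(1) by (auto intro: inj_on_subset)
    qed
    show "s ` {..<?m} \<subseteq> {..<?n}"
      using img J by simp
    show "a j \<in> {0, 1}" if "j < ?n" for j
      by (rule F0.corner[OF that])
  qed
  have "cmap X c (F.emb w) = cmap X d w" if w: "w \<in> cube ?m" for w
  proof -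
    define w0 where "w0 = (\<lambda>i\<in>{..<?m}. if b1 i then 1 - w (s1 i) else w (s1 i))"
    have w0: "w0 \<in> cube ?m"
      using w sub1 by (auto simp: w0_def cube_iff)
    have "\<psi> w0 = w"
    proof (rule extensionalityI[OF \<psi>_ext[OF w0]])
      show "w \<in> extensional {..<?m}"
        using w by (simp add: cube_iff)
      fix k assume "k \<in> {..<?m}"
      then have "\<psi> w0 (s1 (t k)) = w (s1 (t k))"
        using \<psi>_on[OF w0 t'(1)] t' by (simp add: w0_def)
      then show "\<psi> w0 k = w k"
        using t' \<open>k \<in> {..<?m}\<close> by simp
    qed
    moreover have "F.emb w = F0.emb w0"
    proof (rule F.emb_eqI[OF F0.emb_extensional])
      fix i assume i: "i < ?m"
      show "F0.emb w0 (s i) = (if b i then 1 - w i else w i)"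
        using F0.emb_on[OF t'(1)[OF i], of w0] t'[OF i] by (simp add: s_def b_def w0_def)
    next
      fix j assume "j < ?n" "j \<notin> s ` {..<?m}"
      then show "F0.emb w0 j = a j"
        using img img0 by (intro F0.emb_off) auto
    qed
    ultimately show ?thesis
      using eq[OF w0] by simp
  qed
  then have "is_face X d c s b a"
    unfolding is_face_def using d F.face_parameters_axioms by simp
  then show ?thesis
    using img d(2) by (intro exI[of _ d] exI[of _ s] exI[of _ b] exI[of _ a]) (simp add: a_def)
qed

lemma edge_at_face:
  assumes "is_face X d c s b a" "r \<in> cube_vertices (dm d)" "i < dm d"
  shows "edge_at X d r i \<alpha> \<longleftrightarrow> edge_at X c (face_emb (dm d) (dm c) s b a r) (s i) \<alpha>"
proof -
  interpret F: face_parameters "dm d" "dm c" s b a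
    using assms(1) by (simp add: is_face_def)
  have "cmap X c ((F.emb r)(s i := \<bar>F.emb r (s i) - t\<bar>)) = cmap X d (r(i := \<bar>r i - t\<bar>))"
    if t: "t \<in> {0..1}" for t
  proof -
    have "r(i := \<bar>r i - t\<bar>) \<in> cube (dm d)"
      using assms(2,3) t by (auto simp: cube_iff cube_vertices_iff extensional_def abs_if)
    then have "cmap X c (F.emb (r(i := \<bar>r i - t\<bar>))) = cmap X d (r(i := \<bar>r i - t\<bar>))"
      using assms(1) unfolding is_face_def by blast
    then show ?thesis
      by (simp only: F.emb_move[OF assms(2,3) t])
  qed
  then show ?thesis
    by (simp add: edge_at_def)
qed

subsection \<open>Edges at the corners of a cube\<close>

lemma edge_at_initial:
  assumes "edge_at X c p i \<alpha>" "p \<in> cube_vertices (dm c)" "i < dm c"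
  shows "initial X \<alpha> = cmap X c p"
proof -
  have "edge_path X \<alpha> 0 = cmap X c (p(i := \<bar>p i - 0\<bar>))"
    using assms(1) unfolding edge_at_def by simp
  moreover have "\<bar>p i - 0\<bar> = p i"
    using assms(2,3) by (auto simp: cube_vertices_iff)
  ultimately show ?thesis
    by (simp add: initial_def)
qed

lemma edge_at_terminal:
  assumes "edge_at X c p i \<alpha>" "p \<in> cube_vertices (dm c)" "i < dm c"
  shows "terminal X \<alpha> = cmap X c (flip p i)"
proof -
  have "edge_path X \<alpha> 1 = cmap X c (p(i := \<bar>p i - 1\<bar>))"
    using assms(1) unfolding edge_at_def by simp
  moreover have "p i = 0 \<or> p i = 1"
    using assms(2,3) by (simp add: cube_vertices_iff)
  then have "\<bar>p i - 1\<bar> = 1 - p i"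
    by auto
  ultimately show ?thesis
    by (simp add: terminal_def flip_def)
qed

definition rev_edge :: "'c \<times> bool \<Rightarrow> 'c \<times> bool" where
  "rev_edge \<alpha> = (fst \<alpha>, \<not> snd \<alpha>)"

lemma edge_path_rev: "edge_path X (rev_edge \<alpha>) t = edge_path X \<alpha> (1 - t)"
  by (cases \<alpha>) (simp add: edge_path_def rev_edge_def cong: restrict_cong)

lemma rev_edge_simps [simp]:
  "rev_edge (rev_edge \<alpha>) = \<alpha>" "fst (rev_edge \<alpha>) = fst \<alpha>" "snd (rev_edge \<alpha>) = (\<not> snd \<alpha>)"
  "initial X (rev_edge \<alpha>) = terminal X \<alpha>" "terminal X (rev_edge \<alpha>) = initial X \<alpha>"
  "rev_edge \<alpha> \<in> oriented_edges X \<longleftrightarrow> \<alpha> \<in> oriented_edges X"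
  by (simp_all add: initial_def terminal_def edge_path_rev)
    (auto simp: rev_edge_def oriented_edges_def prod_eq_iff mem_Times_iff)

lemma edge_at_rev:
  assumes "edge_at X c p i \<alpha>" "p \<in> cube_vertices (dm c)" "i < dm c"
  shows "edge_at X c (flip p i) i (rev_edge \<alpha>)"
proof -
  have "p i = 0 \<or> p i = 1"
    using assms by (simp add: cube_vertices_iff)
  then have "(flip p i)(i := \<bar>flip p i i - t\<bar>) = p(i := \<bar>p i - (1 - t)\<bar>)" if "t \<in> {0..1}" for t
    using that by (auto simp: flip_def)
  then show ?thesis
    using assms(1) by (simp add: edge_at_def edge_path_rev)
qed

lemma cmap_inject:
  assumes "c \<in> cells X" "d \<in> cells X" "u \<in> open_cube (dm c)" "w \<in> open_cube (dm d)" "cmap X c u = cmap X d w"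
  shows "c = d" "u = w"
proof -
  have "inj_on (\<lambda>(c, u). cmap X c u) (SIGMA c:cells X. open_cube (dm c))"
    using cube_complex by (simp add: cube_complex_def bij_betw_def)
  from inj_onD[OF this, of "(c, u)" "(d, w)"] assms show "c = d" "u = w"
    by auto
qed

lemma oriented_edge_eqI:
  assumes "\<alpha> \<in> oriented_edges X" "\<beta> \<in> oriented_edges X"
    and "edge_path X \<alpha> (1/4) = edge_path X \<beta> (1/4)"
  shows "\<alpha> = \<beta>"
proof -
  obtain e b e' b' where ab: "\<alpha> = (e, b)" "\<beta> = (e', b')"
    by fastforce
  let ?u = "\<lambda>b. \<lambda>i\<in>{..<1::nat}. if b then 1/4 else 1 - 1/4 :: real"
  have "?u b \<in> open_cube 1" for b
    by (simp add: open_cube_iff)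
  moreover have "cmap X e (?u b) = cmap X e' (?u b')"
    using assms(3) by (simp add: ab edge_path_def)
  moreover have "e \<in> cells X" "dm e = 1" "e' \<in> cells X" "dm e' = 1"
    using assms(1,2) by (auto simp: ab oriented_edges_def edges_def)
  ultimately have "e = e'" "?u b = ?u b'"
    using cmap_inject[of e e' "?u b" "?u b'"] by simp_all
  moreover have "b = b'"
    using fun_cong[OF \<open>?u b = ?u b'\<close>, of 0] by (auto split: if_splits)
  ultimately show ?thesis
    using ab by simp
qed

lemma edge_at_unique: "edge_at X c p i \<alpha> \<Longrightarrow> edge_at X c p i \<beta> \<Longrightarrow> \<alpha> = \<beta>"
  by (rule oriented_edge_eqI) (auto simp: edge_at_def)

lemma edge_at_edge:
  assumes "(e, b) \<in> oriented_edges X"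
  shows "edge_at X e (\<lambda>i\<in>{..<1}. if b then 0 else 1) 0 (e, b)"
proof -
  have "(\<lambda>i\<in>{..<1::nat}. if b then t else 1 - t) =
      (\<lambda>i\<in>{..<1::nat}. if b then 0 else 1)(0 := \<bar>(\<lambda>i\<in>{..<1::nat}. if b then 0 else 1) 0 - t\<bar>)"
    if "t \<in> {0..1}" for t :: real
    using that by (auto simp: fun_eq_iff restrict_def)
  then show ?thesis
    using assms by (simp add: edge_at_def edge_path_def)
qed

lemma edge_at_exists:
  assumes "c \<in> cells X" "p \<in> cube_vertices (dm c)" "i < dm c"
  shows "\<exists>\<alpha>. edge_at X c p i \<alpha>"
proof -
  have "\<exists>d s b a. is_face X d c s b a \<and> s ` {..<dm d} = {i} \<and> dm d = card {i} \<and>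
      (\<forall>j<dm c. j \<notin> {i} \<longrightarrow> a j = p j)"
    by (rule face_exists[OF assms(1) cube_vertices_subset[OF assms(2)]])
      (use assms in \<open>auto simp: cube_vertices_iff\<close>)
  then obtain d s b a where f: "is_face X d c s b a" "s ` {..<dm d} = {i}" "dm d = card {i}"
      "\<forall>j<dm c. j \<notin> {i} \<longrightarrow> a j = p j"
    by (elim exE conjE)
  interpret F: face_parameters "dm d" "dm c" s b a
    using f(1) by (simp add: is_face_def)
  have d: "dm d = 1" "s 0 = i" "d \<in> cells X"
    using f by (auto simp: is_face_def)
  let ?r = "face_coord (dm d) s b p"
  have emb: "F.emb ?r = p"
    using assms(2) f by (intro F.emb_face_coord) (auto simp: cube_vertices_iff)
  have r: "?r \<in> cube_vertices (dm d)"
    by (rule F.face_coord_vertex[OF assms(2)])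
  then have "?r = (\<lambda>i\<in>{..<1}. if ?r 0 = 0 then 0 else 1)"
    using d by (auto simp: cube_vertices_iff extensional_def fun_eq_iff)
  then have "edge_at X d ?r 0 (d, ?r 0 = 0)"
    using edge_at_edge[of d "?r 0 = 0"] d by (simp add: oriented_edges_def edges_def)
  then show ?thesis
    using edge_at_face[OF f(1) r, of 0] emb d by auto
qed

lemma square_face:
  assumes "c \<in> cells X" "p \<in> cube_vertices (dm c)" "i < dm c" "j < dm c" "i \<noteq> j"
  shows "\<exists>q\<in>squares X. \<exists>r\<in>cube_vertices 2. \<exists>k<2. \<exists>l<2. k \<noteq> l \<and>
    (\<forall>\<alpha>. edge_at X c p i \<alpha> \<longleftrightarrow> edge_at X q r k \<alpha>) \<and> (\<forall>\<alpha>. edge_at X c p j \<alpha> \<longleftrightarrow> edge_at X q r l \<alpha>) \<and>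
    (\<forall>\<alpha>. edge_at X c (flip p j) i \<alpha> \<longleftrightarrow> edge_at X q (flip r l) k \<alpha>)"
proof -
  have "\<exists>d s b a. is_face X d c s b a \<and> s ` {..<dm d} = {i, j} \<and> dm d = card {i, j} \<and>
      (\<forall>k<dm c. k \<notin> {i, j} \<longrightarrow> a k = p k)"
    by (rule face_exists[OF assms(1) cube_vertices_subset[OF assms(2)]])
      (use assms in \<open>auto simp: cube_vertices_iff\<close>)
  then obtain d s b a where f: "is_face X d c s b a" "s ` {..<dm d} = {i, j}" "dm d = card {i, j}"
      "\<forall>k<dm c. k \<notin> {i, j} \<longrightarrow> a k = p k"
    by (elim exE conjE)
  interpret F: face_parameters "dm d" "dm c" s b a
    using f(1) by (simp add: is_face_def)
  have d: "dm d = 2" "d \<in> squares X"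
    using f assms(5) by (auto simp: is_face_def squares_def)
  have "i \<in> s ` {..<2}" "j \<in> s ` {..<2}"
    using f(2) d(1) by simp_all
  then obtain k l where kl: "k < 2" "l < 2" "s k = i" "s l = j"
    by (elim imageE) (simp only: lessThan_iff)
  let ?r = "face_coord (dm d) s b p"
  have emb: "F.emb ?r = p"
    using assms(2) f by (intro F.emb_face_coord) (auto simp: cube_vertices_iff)
  have r: "?r \<in> cube_vertices (dm d)"
    by (rule F.face_coord_vertex[OF assms(2)])
  have fl: "flip ?r l \<in> cube_vertices (dm d)" "F.emb (flip ?r l) = flip p j"
    using flip_vertex[OF r] F.emb_flip[OF r] d kl emb by auto
  show ?thesis
  proof (rule bexI[of _ d], rule bexI[of _ ?r], rule exI[of _ k], rule conjI[OF kl(1)],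
      rule exI[of _ l], intro conjI allI)
    show "edge_at X c p i \<alpha> \<longleftrightarrow> edge_at X d ?r k \<alpha>" for \<alpha>
      using edge_at_face[OF f(1) r, of k] kl d emb by simp
    show "edge_at X c p j \<alpha> \<longleftrightarrow> edge_at X d ?r l \<alpha>" for \<alpha>
      using edge_at_face[OF f(1) r, of l] kl d emb by simp
    show "edge_at X c (flip p j) i \<alpha> \<longleftrightarrow> edge_at X d (flip ?r l) k \<alpha>" for \<alpha>
      using edge_at_face[OF f(1) fl(1), of k] kl d fl(2) by simp
  qed (use kl d r assms(5) in auto)
qed

lemma corner_cube:
  assumes "c \<in> cells X" "p \<in> cube_vertices (dm c)" "i < dm c" "j < dm c" "i \<noteq> j"
    and "edge_at X c p i \<alpha>" "edge_at X c p j \<beta>"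
  shows "corner X \<alpha> \<beta>"
  using square_face[OF assms(1-5)] assms(6,7) unfolding corner_def by meson

lemma parallel_cube:
  assumes "c \<in> cells X" "p \<in> cube_vertices (dm c)" "i < dm c" "j < dm c" "i \<noteq> j"
    and "edge_at X c p i \<alpha>" "edge_at X c (flip p j) i \<beta>"
  shows "parallel X \<alpha> \<beta>"
  using square_face[OF assms(1-5)] assms(6,7) unfolding parallel_def flip_def[symmetric] by meson

end

section \<open>Open stars of vertices\<close>

lemma pathin_in_topspace: "pathin X p \<Longrightarrow> t \<in> {0..1} \<Longrightarrow> p t \<in> topspace X"
  unfolding pathin_def using continuous_map_image_subset_topspace[of I01 X p] by (auto simp: image_subset_iff)

lemma unit_interval_combination:
  fixes x y t :: real
  assumes "x \<in> {0..1}" "y \<in> {0..1}" "t \<in> {0..1}"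
  shows "(1 - t) * x + t * y \<in> {0..1}"
proof -
  have "(1 - t) * x \<le> (1 - t) * 1" "t * y \<le> t * 1"
    using assms by (intro mult_left_mono; simp)+
  then show ?thesis
    using assms by simp
qed

lemma continuous_map_into_cube:
  assumes "\<And>z. z \<in> topspace Z \<Longrightarrow> f z \<in> cube n"
    and "\<And>i. i < n \<Longrightarrow> continuous_map Z euclideanreal (\<lambda>z. f z i)"
  shows "continuous_map Z (cube_top n) f"
  unfolding cube_top_def continuous_map_componentwise
proof (intro conjI ballI)
  show "f ` topspace Z \<subseteq> extensional {..<n}"
    using assms(1) by (auto simp: cube_iff)
  fix i assume i: "i \<in> {..<n}"
  then have "f z i \<in> {0..1}" if "z \<in> topspace Z" for z
    using assms(1)[OF that] by (simp add: cube_iff)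
  then show "continuous_map Z (top_of_set {0..1}) (\<lambda>z. f z i)"
    using assms(2) i by (auto simp: continuous_map_in_subtopology)
qed

lemma continuous_map_cube_coordinate:
  assumes "i < n"
  shows "continuous_map (cube_top n) euclideanreal (\<lambda>u. u i)"
proof -
  have "continuous_map (cube_top n) (top_of_set {0..1}) (\<lambda>u. u i)"
    unfolding cube_top_def using assms by (intro continuous_map_product_projection) simp
  then show ?thesis
    by (simp add: continuous_map_in_subtopology)
qed

lemma path_homotopic_cube:
  assumes f: "pathin (cube_top n) f" and g: "pathin (cube_top n) g" and "f 0 = g 0" "f 1 = g 1"
  shows "path_homotopic (cube_top n) f g"
proof -
  let ?S = "top_of_set ({0..1} \<times> {0..1}) :: (real \<times> real) topology"
  let ?h = "\<lambda>z. \<lambda>i\<in>{..<n}. (1 - fst z) * f (snd z) i + fst z * g (snd z) i"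
  have snd: "continuous_map ?S I01 snd"
    by (auto simp: continuous_map_in_subtopology intro!: continuous_intros)
  have in_cube: "f s \<in> cube n" "g s \<in> cube n" if "s \<in> {0..1}" for s
    using pathin_in_topspace[OF f that] pathin_in_topspace[OF g that] by simp_all
  have coord: "continuous_map ?S euclideanreal (\<lambda>z. k (snd z) i)" if "pathin (cube_top n) k" "i < n" for k i
    using continuous_map_compose[OF continuous_map_compose[OF snd that(1)[unfolded pathin_def]]
        continuous_map_cube_coordinate[OF that(2)]]
    by (simp add: o_def)
  have "continuous_map ?S euclideanreal (\<lambda>z. (1 - fst z) * f (snd z) i + fst z * g (snd z) i)" if "i < n" for i
    using coord[OF f that] coord[OF g that] by (auto intro!: continuous_intros)
  moreover have "?h z \<in> cube n" if z: "z \<in> {0..1} \<times> {0..1}" for z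
  proof -
    have "(1 - fst z) * f (snd z) i + fst z * g (snd z) i \<in> {0..1}" if i: "i < n" for i
      using z in_cube[of "snd z"] i by (intro unit_interval_combination) (auto simp: cube_iff)
    then show ?thesis
      by (simp add: cube_iff)
  qed
  ultimately have "continuous_map ?S (cube_top n) ?h"
    by (intro continuous_map_into_cube) simp_all
  then show ?thesis
  proof (rule path_homotopicI)
    fix s :: real assume s: "s \<in> {0..1}"
    show "?h (0, s) = f s" "?h (1, s) = g s"
      using in_cube[OF s] by (auto simp: cube_iff extensional_def fun_eq_iff)
    have "f 0 \<in> extensional {..<n}" "f 1 \<in> extensional {..<n}"
      using in_cube by (simp_all add: cube_iff)
    then show "?h (s, 0) = f 0" "?h (s, 1) = f 1"
      using assms(3,4) by (auto simp: extensional_def fun_eq_iff algebra_simps)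
  qed
qed

definition near :: "nat \<Rightarrow> (nat \<Rightarrow> real) \<Rightarrow> (nat \<Rightarrow> real) \<Rightarrow> bool" where
  "near n u p \<longleftrightarrow> (\<forall>i<n. \<bar>u i - p i\<bar> < 1)"

lemma openin_near: "openin (cube_top n) {u \<in> cube n. near n u p}"
proof -
  have "k \<le> n \<Longrightarrow> openin (cube_top n) {u \<in> cube n. near k u p}" for k
  proof (induction k)
    case 0
    have "openin (cube_top n) (cube n)"
      by (metis openin_topspace topspace_cube_top)
    then show ?case
      by (simp add: near_def)
  next
    case (Suc k)
    have "openin (cube_top n) {u \<in> topspace (cube_top n). u k \<in> {p k - 1<..<p k + 1}}"
      using Suc.prems by (intro openin_continuous_map_preimage[OF continuous_map_cube_coordinate]) auto
    then have "openin (cube_top n) ({u \<in> cube n. near k u p} \<inter> {u \<in> cube n. u k \<in> {p k - 1<..<p k + 1}})"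
      using Suc by (intro openin_Int) auto
    also have "{u \<in> cube n. near k u p} \<inter> {u \<in> cube n. u k \<in> {p k - 1<..<p k + 1}} = {u \<in> cube n. near (Suc k) u p}"
      by (auto simp: near_def less_Suc_eq abs_less_iff)
    finally show ?case .
  qed
  then show ?thesis
    by simp
qed

definition lerp :: "nat \<Rightarrow> real \<Rightarrow> (nat \<Rightarrow> real) \<Rightarrow> (nat \<Rightarrow> real) \<Rightarrow> nat \<Rightarrow> real" where
  "lerp n t u p = (\<lambda>i\<in>{..<n}. (1 - t) * u i + t * p i)"

lemma lerp_cube:
  assumes "u \<in> cube n" "p \<in> cube n" "t \<in> {0..1}"
  shows "lerp n t u p \<in> cube n"
proof -
  have "(1 - t) * u i + t * p i \<in> {0..1}" if "i < n" for i
    using assms that by (intro unit_interval_combination) (auto simp: cube_iff)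
  then show ?thesis
    by (simp add: lerp_def cube_iff)
qed

lemma lerp_ends: "u \<in> cube n \<Longrightarrow> lerp n 0 u p = u" "p \<in> cube n \<Longrightarrow> lerp n 1 u p = p"
  by (auto simp: lerp_def cube_iff extensional_def fun_eq_iff algebra_simps)

lemma near_lerp:
  assumes "near n u p" "t \<in> {0..1}"
  shows "near n (lerp n t u p) p"
  unfolding near_def
proof (intro allI impI)
  fix i assume i: "i < n"
  have "\<bar>lerp n t u p i - p i\<bar> = (1 - t) * \<bar>u i - p i\<bar>"
  proof -
    have "lerp n t u p i - p i = (1 - t) * (u i - p i)"
      using i by (simp add: lerp_def algebra_simps)
    then show ?thesis
      using assms(2) by (simp add: abs_mult)
  qed
  also have "\<dots> \<le> 1 * \<bar>u i - p i\<bar>"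
    using assms(2) by (intro mult_right_mono) auto
  also have "\<dots> < 1"
    using assms(1) i by (simp add: near_def)
  finally show "\<bar>lerp n t u p i - p i\<bar> < 1" .
qed

lemma continuous_map_lerp:
  assumes "p \<in> cube n" "continuous_map Z (cube_top n) f" "continuous_map Z I01 g"
  shows "continuous_map Z (cube_top n) (\<lambda>z. lerp n (g z) (f z) p)"
proof (rule continuous_map_into_cube)
  show "lerp n (g z) (f z) p \<in> cube n" if "z \<in> topspace Z" for z
    using assms that continuous_map_image_subset_topspace[OF assms(2)] continuous_map_image_subset_topspace[OF assms(3)]
    by (intro lerp_cube) auto
  fix i assume i: "i < n"
  have "continuous_map Z euclideanreal g"
    using assms(3) by (simp add: continuous_map_in_subtopology)
  moreover have "continuous_map Z euclideanreal (\<lambda>z. f z i)"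
    using continuous_map_compose[OF assms(2) continuous_map_cube_coordinate[OF i]] by (simp add: o_def)
  ultimately show "continuous_map Z euclideanreal (\<lambda>z. lerp n (g z) (f z) p i)"
    using i by (simp add: lerp_def) (intro continuous_intros; simp)
qed

lemma (in face_parameters) emb_lerp:
  "emb (lerp m t w r) = lerp n t (emb w) (emb r)"
proof (rule emb_eqI)
  show "lerp n t (emb w) (emb r) \<in> extensional {..<n}"
    by (simp add: lerp_def)
  show "lerp n t (emb w) (emb r) (s i) = (if b i then 1 - lerp m t w r i else lerp m t w r i)" if "i < m" for i
    using that s_less[OF that] by (simp add: lerp_def emb_on algebra_simps)
  show "lerp n t (emb w) (emb r) j = a j" if "j < n" "j \<notin> s ` {..<m}" for j
    using that by (simp add: lerp_def emb_off algebra_simps)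
qed

lemma (in face_parameters) near_emb:
  assumes "w \<in> open_cube m" "r \<in> cube_vertices m"
  shows "near n (emb w) (emb r)"
  unfolding near_def
proof (intro allI impI)
  fix j assume j: "j < n"
  show "\<bar>emb w j - emb r j\<bar> < 1"
  proof (rule emb_cases[OF j])
    fix i assume i: "i < m" "j = s i"
    then have "0 < w i" "w i < 1" "r i = 0 \<or> r i = 1"
      using assms by (auto simp: open_cube_iff cube_vertices_iff)
    then show ?thesis
      using i by (auto simp: emb_on)
  qed (use j in \<open>simp add: emb_off\<close>)
qed

lemma (in face_parameters) near_emb_vertex:
  assumes "p \<in> cube_vertices n" "near n (emb w) p"
  shows "emb (face_coord m s b p) = p"
proof (rule emb_face_coord)
  show "p \<in> extensional {..<n}"
    using assms(1) by (simp add: cube_vertices_iff)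
  fix j assume j: "j < n" "j \<notin> s ` {..<m}"
  then have "\<bar>a j - p j\<bar> < 1" "a j = 0 \<or> a j = 1" "p j = 0 \<or> p j = 1"
    using assms corner[of j] emb_off[OF j, of w] by (auto simp: near_def cube_vertices_iff)
  then show "p j = a j"
    by auto
qed

context cube_cx
begin

abbreviation "T \<equiv> points X"

lemma cmap_bij: "bij_betw (\<lambda>(c, u). cmap X c u) (SIGMA c:cells X. open_cube (dm c)) (topspace T)"
  using cube_complex unfolding cube_complex_def by blast

lemma openin_iff:
  "openin T U \<longleftrightarrow> U \<subseteq> topspace T \<and> (\<forall>c\<in>cells X. openin (cube_top (dm c)) {u \<in> cube (dm c). cmap X c u \<in> U})"
  using cube_complex unfolding cube_complex_def by (elim conjE) (erule allE)

definition cell_of :: "'a \<Rightarrow> 'c" where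
  "cell_of x = (THE c. c \<in> cells X \<and> (\<exists>u\<in>open_cube (dm c). cmap X c u = x))"

definition coord_of :: "'a \<Rightarrow> nat \<Rightarrow> real" where
  "coord_of x = (THE u. u \<in> open_cube (dm (cell_of x)) \<and> cmap X (cell_of x) u = x)"

lemma cell_of_eq:
  assumes "c \<in> cells X" "u \<in> open_cube (dm c)"
  shows "cell_of (cmap X c u) = c" "coord_of (cmap X c u) = u"
proof -
  show *: "cell_of (cmap X c u) = c"
    unfolding cell_of_def by (rule the_equality) (use assms cmap_inject(1) in blast)+
  show "coord_of (cmap X c u) = u"
    unfolding coord_of_def * by (rule the_equality) (use assms cmap_inject(2) in blast)+
qed

lemma cell_of:
  assumes "x \<in> topspace T"
  shows "cell_of x \<in> cells X" "coord_of x \<in> open_cube (dm (cell_of x))" "cmap X (cell_of x) (coord_of x) = x"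
proof -
  have "x \<in> (\<lambda>(c, u). cmap X c u) ` (SIGMA c:cells X. open_cube (dm c))"
    using cmap_bij assms by (simp add: bij_betw_def)
  then obtain c u where cu: "c \<in> cells X" "u \<in> open_cube (dm c)" "x = cmap X c u"
    by auto
  then show "cell_of x \<in> cells X" "coord_of x \<in> open_cube (dm (cell_of x))" "cmap X (cell_of x) (coord_of x) = x"
    using cell_of_eq[OF cu(1,2)] by simp_all
qed

text \<open>The carrier: the face of \<open>c\<close> whose open cube contains \<open>u\<close>.\<close>
lemma carrier_exists:
  assumes c: "c \<in> cells X" and u: "u \<in> cube (dm c)"
  shows "\<exists>s b a. is_face X (cell_of (cmap X c u)) c s b a \<and> cmap X c u \<in> topspace T \<and>
    face_emb (dm (cell_of (cmap X c u))) (dm c) s b a (coord_of (cmap X c u)) = u"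
proof -
  have "\<exists>d s b a. is_face X d c s b a \<and> s ` {..<dm d} = {i. i < dm c \<and> 0 < u i \<and> u i < 1} \<and>
      dm d = card {i. i < dm c \<and> 0 < u i \<and> u i < 1} \<and>
      (\<forall>j<dm c. j \<notin> {i. i < dm c \<and> 0 < u i \<and> u i < 1} \<longrightarrow> a j = u j)"
  proof (rule face_exists[OF c u])
    show "u j = 0 \<or> u j = 1" if "j < dm c" "j \<notin> {i. i < dm c \<and> 0 < u i \<and> u i < 1}" for j
    proof -
      have "0 \<le> u j" "u j \<le> 1" "\<not> (0 < u j \<and> u j < 1)"
        using u that by (auto simp: cube_iff)
      then show ?thesis
        by linarith
    qed
  qed auto
  then obtain d s b a where f: "is_face X d c s b a" "s ` {..<dm d} = {i. i < dm c \<and> 0 < u i \<and> u i < 1}"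
    "\<forall>j<dm c. j \<notin> {i. i < dm c \<and> 0 < u i \<and> u i < 1} \<longrightarrow> a j = u j"
    by (elim exE conjE)
  interpret F: face_parameters "dm d" "dm c" s b a
    using f(1) by (simp add: is_face_def)
  let ?w = "face_coord (dm d) s b u"
  have "s i \<in> {i. i < dm c \<and> 0 < u i \<and> u i < 1}" if "i < dm d" for i
    using f(2) that by blast
  then have w: "?w \<in> open_cube (dm d)"
    by (intro F.face_coord_open) simp
  have emb: "F.emb ?w = u"
    using u f(2,3) by (intro F.emb_face_coord) (simp_all add: cube_iff)
  have d: "d \<in> cells X"
    using f(1) by (simp add: is_face_def)
  have eq: "cmap X c u = cmap X d ?w"
    using f(1) open_cube_subset[OF w] emb unfolding is_face_def by metis
  have "cmap X d ?w \<in> topspace T"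
    using bij_betw_apply[OF cmap_bij, of "(d, ?w)"] d w by simp
  then show ?thesis
    using f(1) emb cell_of_eq[OF d w] eq by auto
qed

lemma cmap_cube: "c \<in> cells X \<Longrightarrow> u \<in> cube (dm c) \<Longrightarrow> cmap X c u \<in> topspace T"
  using carrier_exists by blast

lemma continuous_map_cmap:
  assumes "c \<in> cells X"
  shows "continuous_map (cube_top (dm c)) T (cmap X c)"
  unfolding continuous_map_def using assms cmap_cube openin_iff by auto

definition star :: "'a \<Rightarrow> 'a set" where
  "star v = {x \<in> topspace T. \<exists>r\<in>cube_vertices (dm (cell_of x)). cmap X (cell_of x) r = v}"

lemma carrier_vertex:
  assumes f: "is_face X (cell_of (cmap X c u)) c s b a"
    and emb: "face_emb (dm (cell_of (cmap X c u))) (dm c) s b a (coord_of (cmap X c u)) = u"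
    and p: "p \<in> cube_vertices (dm c)" "near (dm c) u p"
  shows "\<exists>r\<in>cube_vertices (dm (cell_of (cmap X c u))).
    face_emb (dm (cell_of (cmap X c u))) (dm c) s b a r = p \<and> cmap X (cell_of (cmap X c u)) r = cmap X c p"
proof -
  let ?d = "cell_of (cmap X c u)"
  interpret F: face_parameters "dm ?d" "dm c" s b a
    using f by (simp add: is_face_def)
  let ?r = "face_coord (dm ?d) s b p"
  have r: "?r \<in> cube_vertices (dm ?d)" "F.emb ?r = p"
    using F.face_coord_vertex[OF p(1)] F.near_emb_vertex[OF p(1)] p(2) emb by metis+
  then have "cmap X ?d ?r = cmap X c p"
    using f cube_vertices_subset[OF r(1)] unfolding is_face_def by metis
  then show ?thesis
    using r by blast
qed

text \<open>
  Stars are defined by the carrier of a point, but can be read off in every cell that contains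
  the point; this makes them open in the weak topology.
\<close>
lemma star_iff:
  assumes c: "c \<in> cells X" and u: "u \<in> cube (dm c)"
  shows "cmap X c u \<in> star v \<longleftrightarrow> (\<exists>p\<in>cube_vertices (dm c). near (dm c) u p \<and> cmap X c p = v)"
proof -
  let ?d = "cell_of (cmap X c u)"
  obtain s b a where f: "is_face X ?d c s b a" and x: "cmap X c u \<in> topspace T"
    and emb: "face_emb (dm ?d) (dm c) s b a (coord_of (cmap X c u)) = u"
    using carrier_exists[OF c u] by (elim exE conjE)
  interpret F: face_parameters "dm ?d" "dm c" s b a
    using f by (simp add: is_face_def)
  show ?thesis
  proof
    assume "cmap X c u \<in> star v"
    then obtain r where r: "r \<in> cube_vertices (dm ?d)" "cmap X ?d r = v"
      by (auto simp: star_def)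
    have "near (dm c) u (F.emb r)"
      using F.near_emb[OF cell_of(2)[OF x] r(1)] emb by simp
    moreover have "cmap X c (F.emb r) = v"
      using f cube_vertices_subset[OF r(1)] r(2) unfolding is_face_def by metis
    ultimately show "\<exists>p\<in>cube_vertices (dm c). near (dm c) u p \<and> cmap X c p = v"
      using F.emb_vertex[OF r(1)] by blast
  next
    assume "\<exists>p\<in>cube_vertices (dm c). near (dm c) u p \<and> cmap X c p = v"
    then show "cmap X c u \<in> star v"
      using carrier_vertex[OF f emb] x unfolding star_def by fastforce
  qed
qed

lemma star_subset: "star v \<subseteq> topspace T"
  by (auto simp: star_def)

lemma openin_star: "openin T (star v)"
  unfolding openin_iff
proof (intro conjI ballI star_subset)
  fix c assume c: "c \<in> cells X"
  have "{u \<in> cube (dm c). cmap X c u \<in> star v} =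
      \<Union>((\<lambda>p. {u \<in> cube (dm c). near (dm c) u p}) ` {p \<in> cube_vertices (dm c). cmap X c p = v})"
    using star_iff[OF c] by auto
  then show "openin (cube_top (dm c)) {u \<in> cube (dm c). cmap X c u \<in> star v}"
    using openin_near by auto
qed

definition vertex_points :: "'a set" where
  "vertex_points = {cmap X c p | c p. c \<in> cells X \<and> p \<in> cube_vertices (dm c)}"

lemma in_some_star:
  assumes "x \<in> topspace T"
  shows "\<exists>v\<in>vertex_points. x \<in> star v"
proof -
  have "(\<lambda>i\<in>{..<dm (cell_of x)}. 0) \<in> cube_vertices (dm (cell_of x))"
    by (simp add: cube_vertices_iff)
  then show ?thesis
    using cell_of(1)[OF assms] assms unfolding star_def vertex_points_def by blast
qed

lemma star_vertex: "x \<in> star v \<Longrightarrow> v \<in> vertex_points"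
  using cell_of(1) unfolding star_def vertex_points_def by blast

end

section \<open>Hyperplane labels in a C-special complex\<close>

locale special_cx = cube_cx X for X :: "('a, 'c) cell_structure" +
  assumes special: "C_special X"
begin

lemma no_loops: "\<alpha> \<in> oriented_edges X \<Longrightarrow> initial X \<alpha> \<noteq> terminal X \<alpha>"
  using special unfolding C_special_def bipartite_skeleton_def by metis

definition hyp :: "'c \<Rightarrow> 'c set" where
  "hyp e = {e' \<in> edges X. equivclp (opposite X) e e'}"

lemma hyp_hyperplane: "e \<in> edges X \<Longrightarrow> hyp e \<in> hyperplanes X"
  unfolding hyperplanes_def hyp_def quotient_def by auto

lemma in_hyp: "e \<in> edges X \<Longrightarrow> e \<in> hyp e"
  by (simp add: hyp_def)

lemma hyp_opposite:
  assumes "opposite X e e'"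
  shows "hyp e = hyp e'"
proof -
  have 1: "equivclp (opposite X) e e'"
    using assms by (rule r_into_equivclp)
  then have 2: "equivclp (opposite X) e' e"
    by (rule equivclp_sym)
  have "equivclp (opposite X) e x \<longleftrightarrow> equivclp (opposite X) e' x" for x
    using equivclp_trans[OF 1] equivclp_trans[OF 2] by blast
  then show ?thesis
    by (simp add: hyp_def)
qed

text \<open>
  As all hyperplanes are two-sided, orientations that are parallel along each hyperplane combine
  to one orientation of all edges.
\<close>
definition dir :: "'c \<Rightarrow> bool" where
  "dir e = (SOME d. parallel_orientation X (hyp e) d) e"

lemma hyp_eq:
  assumes "H \<in> hyperplanes X" "e \<in> H"
  shows "hyp e = H" "e \<in> edges X"
proof -
  obtain e0 where e0: "e0 \<in> edges X" "H = {e'. e' \<in> edges X \<and> equivclp (opposite X) e0 e'}"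
    using assms(1) unfolding hyperplanes_def quotient_def by auto
  then have 1: "equivclp (opposite X) e0 e" and e: "e \<in> edges X"
    using assms(2) by auto
  from 1 have 2: "equivclp (opposite X) e e0"
    by (rule equivclp_sym)
  have "equivclp (opposite X) e x \<longleftrightarrow> equivclp (opposite X) e0 x" for x
    using equivclp_trans[OF 1] equivclp_trans[OF 2] by blast
  then show "hyp e = H" "e \<in> edges X"
    using e0 e by (auto simp: hyp_def)
qed

lemma parallel_orientation_dir:
  assumes "H \<in> hyperplanes X"
  shows "parallel_orientation X H dir"
proof -
  have "\<exists>d. parallel_orientation X H d"
    using special assms unfolding C_special_def two_sided_def by blast
  then have "parallel_orientation X H (SOME d. parallel_orientation X H d)"
    by (rule someI_ex)
  moreover have "dir e = (SOME d. parallel_orientation X H d) e" if "e \<in> H" for e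
    using hyp_eq[OF assms that] by (simp add: dir_def)
  ultimately show ?thesis
    unfolding parallel_orientation_def by simp
qed

definition label :: "'c \<times> bool \<Rightarrow> 'c set \<times> bool" where
  "label \<alpha> = (hyp (fst \<alpha>), snd \<alpha> = dir (fst \<alpha>))"

definition crossing :: "'c set \<Rightarrow> 'c set \<Rightarrow> bool" where
  "crossing H K \<longleftrightarrow> H \<noteq> K \<and> (\<exists>e\<in>H. \<exists>e'\<in>K. consecutive X e e')"

lemma corner_sym: "corner X \<alpha> \<beta> \<Longrightarrow> corner X \<beta> \<alpha>"
  unfolding corner_def by metis

lemma crossing_sym: "symp crossing" "irreflp crossing"
proof -
  have "consecutive X e e' \<Longrightarrow> consecutive X e' e" for e e'
    unfolding consecutive_def using corner_sym by blast
  then show "symp crossing"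
    unfolding symp_def crossing_def by blast
  show "irreflp crossing"
    unfolding irreflp_def crossing_def by blast
qed

lemma edge_fst: "\<alpha> \<in> oriented_edges X \<Longrightarrow> fst \<alpha> \<in> edges X"
  by (auto simp: oriented_edges_def)

lemma label_rev: "label (rev_edge \<alpha>) = (fst (label \<alpha>), \<not> snd (label \<alpha>))"
  by (auto simp: label_def)

lemma label_parallel:
  assumes "parallel X \<alpha> \<beta>"
  shows "label \<alpha> = label \<beta>"
proof -
  obtain e b e' b' where ab: "\<alpha> = (e, b)" "\<beta> = (e', b')"
    by fastforce
  have e: "e \<in> edges X" "e' \<in> edges X"
    using assms ab unfolding parallel_def edge_at_def oriented_edges_def by auto
  have "opposite X e e'"
    using assms ab unfolding opposite_def by blast
  then have h: "hyp e = hyp e'"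
    by (rule hyp_opposite)
  moreover have "e \<in> hyp e" "e' \<in> hyp e"
    using in_hyp e h by auto
  then have "b = dir e \<longleftrightarrow> b' = dir e'"
    using parallel_orientation_dir[OF hyp_hyperplane[OF e(1)]] assms ab
    unfolding parallel_orientation_def by blast
  ultimately show ?thesis
    using ab by (simp add: label_def)
qed

lemma not_self_intersecting:
  assumes "consecutive X e e'" "e \<noteq> e'" "e \<in> edges X" "e' \<in> edges X"
  shows "hyp e \<noteq> hyp e'"
proof
  assume "hyp e = hyp e'"
  then have "self_intersects X (hyp e)"
    using assms in_hyp unfolding self_intersects_def by metis
  moreover have "\<not> self_intersects X (hyp e)"
    using special hyp_hyperplane[OF assms(3)] unfolding C_special_def by blast
  ultimately show False
    by simp
qed

text \<open>
  A hyperplane has at most one half-edge at a vertex: two half-edges on one hyperplane would be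
  consecutive, or osculate directly or indirectly.
\<close>
lemma half_edge_unique:
  assumes a: "\<alpha> \<in> oriented_edges X" and b: "\<beta> \<in> oriented_edges X"
    and i: "initial X \<alpha> = initial X \<beta>" and h: "fst (label \<alpha>) = fst (label \<beta>)"
  shows "\<alpha> = \<beta>"
proof (rule ccontr)
  assume ne: "\<alpha> \<noteq> \<beta>"
  obtain e b e' b' where ab: "\<alpha> = (e, b)" "\<beta> = (e', b')"
    by fastforce
  have e: "e \<in> edges X" "e' \<in> edges X"
    using a b edge_fst ab by auto
  have H: "hyp e = hyp e'"
    using h ab by (simp add: label_def)
  have hH: "hyp e \<in> hyperplanes X" "e \<in> hyp e" "e' \<in> hyp e"
    using e in_hyp[OF e(1)] in_hyp[OF e(2)] hyp_hyperplane[OF e(1)] H by auto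
  have ee: "e \<noteq> e'"
  proof
    assume "e = e'"
    then have "\<beta> = rev_edge \<alpha>"
      using ne ab by (simp add: rev_edge_def)
    then show False
      using no_loops[OF a] i by simp
  qed
  define v where "v = initial X \<alpha>"
  have v: "initial X (e, b) = v" "initial X (e', b') = v"
    using i ab by (simp_all add: v_def)
  have "\<not> consecutive_at X v e e'"
  proof
    assume "consecutive_at X v e e'"
    then have "consecutive X e e'"
      unfolding consecutive_at_def consecutive_def by blast
    then show False
      using not_self_intersecting ee e H by blast
  qed
  then have osc: "osculate_at X v e e'" and osc': "osculate_at X v e' e"
    using e ee v corner_sym unfolding osculate_at_def consecutive_at_def by blast+
  have rev: "terminal X (f, \<not> c) = initial X (f, c)" for f c
    using rev_edge_simps(5)[of "(f, c)"] by (simp add: rev_edge_def)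
  note po = parallel_orientation_dir[OF hH(1)]
  have no_direct: "\<not> directly_self_osculates X (hyp e)" "\<not> indirectly_self_osculates X (hyp e)"
    using special hH(1) unfolding C_special_def by blast+
  show False
  proof (cases "b = dir e")
    case True
    show False
    proof (cases "b' = dir e'")
      case b': True
      have "initial X (e, dir e) = v" "initial X (e', dir e') = v"
        using v True b' by simp_all
      then have "directly_self_osculates X (hyp e)"
        unfolding directly_self_osculates_def using po hH(2,3) osc by blast
      then show False using no_direct by simp
    next
      case False
      then have "terminal X (e', dir e') = v"
        using v rev[of e' b'] by simp
      moreover have "initial X (e, dir e) = v"
        using v True by simp
      ultimately have "indirectly_self_osculates X (hyp e)"
        unfolding indirectly_self_osculates_def using po hH(2,3) osc by blast
      then show False using no_direct by simp
    qed
  next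
    case False
    then have t: "terminal X (e, dir e) = v"
      using v rev[of e b] by simp
    show False
    proof (cases "b' = dir e'")
      case True
      then have "initial X (e', dir e') = v"
        using v by simp
      then have "indirectly_self_osculates X (hyp e)"
        unfolding indirectly_self_osculates_def using po hH(2,3) osc' t by blast
      then show False using no_direct by simp
    next
      case False
      then have "terminal X (e', dir e') = v"
        using v rev[of e' b'] by simp
      then have "directly_self_osculates X (hyp e)"
        unfolding directly_self_osculates_def using po hH(2,3) osc t by blast
      then show False using no_direct by simp
    qed
  qed
qed

lemma crossing_corner:
  assumes a: "\<alpha> \<in> oriented_edges X" and b: "\<beta> \<in> oriented_edges X"
    and i: "initial X \<alpha> = initial X \<beta>" and cr: "crossing (fst (label \<alpha>)) (fst (label \<beta>))"
  shows "corner X \<alpha> \<beta>"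
proof -
  obtain e b e' b' where ab: "\<alpha> = (e, b)" "\<beta> = (e', b')"
    by fastforce
  have e: "e \<in> edges X" "e' \<in> edges X"
    using a b edge_fst ab by auto
  have cr: "hyp e \<noteq> hyp e'" "\<exists>f\<in>hyp e. \<exists>f'\<in>hyp e'. consecutive X f f'"
    using cr ab by (simp_all add: label_def crossing_def)
  define v where "v = initial X \<alpha>"
  have v: "initial X (e, b) = v" "initial X (e', b') = v"
    using i ab by (simp_all add: v_def)
  have "\<not> inter_osculate X (hyp e) (hyp e')"
    using special hyp_hyperplane e unfolding C_special_def by blast
  then have "\<not> osculate_at X v e e'"
    using cr in_hyp e unfolding inter_osculate_def by blast
  then have "consecutive_at X v e e'"
    using e v cr(1) unfolding osculate_at_def by blast
  then obtain c c' where c: "initial X (e, c) = v" "initial X (e', c') = v" "corner X (e, c) (e', c')"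
    unfolding consecutive_at_def by blast
  have one: "c = b" if "initial X (f, c) = v" "initial X (f, b) = v" "(f, b) \<in> oriented_edges X" for f c b
  proof (rule ccontr)
    assume "c \<noteq> b"
    then have "(f, c) = rev_edge (f, b)"
      by (simp add: rev_edge_def)
    then have "initial X (f, c) = terminal X (f, b)"
      using rev_edge_simps(4) by metis
    then show False
      using no_loops that by simp
  qed
  show ?thesis
    using one[OF c(1) v(1)] one[OF c(2) v(2)] c(3) a b ab by simp
qed

subsection \<open>Labels of the edges of a cube\<close>

lemma edge_at_label:
  assumes c: "c \<in> cells X" and p: "p \<in> cube_vertices (dm c)" and q: "q \<in> cube_vertices (dm c)" and i: "i < dm c"
    and \<alpha>: "edge_at X c p i \<alpha>" and \<beta>: "edge_at X c q i \<beta>"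
  shows "fst (label \<alpha>) = fst (label \<beta>)" "snd (label \<alpha>) = snd (label \<beta>) \<longleftrightarrow> p i = q i"
proof -
  have "\<forall>\<beta>. edge_at X c q i \<beta> \<longrightarrow> label \<beta> = (fst (label \<alpha>), snd (label \<alpha>) = (p i = q i))"
  proof (rule cube_vertices_induct[OF p q])
    show "\<forall>\<beta>. edge_at X c p i \<beta> \<longrightarrow> label \<beta> = (fst (label \<alpha>), snd (label \<alpha>) = (p i = p i))"
      using edge_at_unique[OF \<alpha>] by auto
    fix r j assume r: "r \<in> cube_vertices (dm c)" "j < dm c"
      and IH: "\<forall>\<beta>. edge_at X c r i \<beta> \<longrightarrow> label \<beta> = (fst (label \<alpha>), snd (label \<alpha>) = (p i = r i))"
    obtain \<delta> where \<delta>: "edge_at X c r i \<delta>"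
      using edge_at_exists[OF c r(1) i] by blast
    show "\<forall>\<beta>. edge_at X c (flip r j) i \<beta> \<longrightarrow> label \<beta> = (fst (label \<alpha>), snd (label \<alpha>) = (p i = flip r j i))"
    proof (intro allI impI)
      fix \<beta> assume \<beta>: "edge_at X c (flip r j) i \<beta>"
      show "label \<beta> = (fst (label \<alpha>), snd (label \<alpha>) = (p i = flip r j i))"
      proof (cases "i = j")
        case True
        have "\<beta> = rev_edge \<delta>"
          using edge_at_unique[OF \<beta>] edge_at_rev[OF \<delta> r(1) i] True by blast
        moreover have "(p i = 1 - r i) = (p i \<noteq> r i)"
        proof -
          have "p i = 0 \<or> p i = 1" "r i = 0 \<or> r i = 1"
            using p r(1) i by (auto simp: cube_vertices_iff)
          then show ?thesis by auto
        qed
        moreover have "label \<delta> = (fst (label \<alpha>), snd (label \<alpha>) = (p i = r i))"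
          using IH \<delta> by blast
        ultimately have "label \<beta> = (fst (label \<alpha>), snd (label \<alpha>) \<noteq> (p i = r i))" "(p i = 1 - r i) = (p i \<noteq> r i)"
          by (simp_all add: label_rev)
        then show ?thesis
          using True by simp
      next
        case False
        then have "label \<delta> = label \<beta>"
          using parallel_cube[OF c r(1) i r(2) False \<delta> \<beta>] by (intro label_parallel)
        then show ?thesis
          using IH \<delta> False by simp
      qed
    qed
  qed
  then have "label \<beta> = (fst (label \<alpha>), snd (label \<alpha>) = (p i = q i))"
    using \<beta> by blast
  then show "fst (label \<alpha>) = fst (label \<beta>)" "snd (label \<alpha>) = snd (label \<beta>) \<longleftrightarrow> p i = q i"
    by auto
qed

lemma edge_at_oriented: "edge_at X c p i \<alpha> \<Longrightarrow> \<alpha> \<in> oriented_edges X"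
  by (simp add: edge_at_def)

text \<open>
  The edges in one direction at two corners of a cube lie on the same hyperplane; if the corners
  were glued to one vertex, they would be the same half-edge, although they point to opposite sides
  of the hyperplane when the corners differ in this direction.
\<close>
lemma cube_vertices_distinct:
  assumes c: "c \<in> cells X" and p: "p \<in> cube_vertices (dm c)" and q: "q \<in> cube_vertices (dm c)"
    and eq: "cmap X c p = cmap X c q"
  shows "p = q"
proof (rule extensionalityI)
  show "p \<in> extensional {..<dm c}" "q \<in> extensional {..<dm c}"
    using p q by (simp_all add: cube_vertices_iff)
  fix i assume "i \<in> {..<dm c}"
  then have i: "i < dm c" by simp
  obtain \<alpha> where \<alpha>: "edge_at X c p i \<alpha>"
    using edge_at_exists[OF c p i] by blast
  obtain \<beta> where \<beta>: "edge_at X c q i \<beta>"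
    using edge_at_exists[OF c q i] by blast
  have "\<alpha> = \<beta>"
    using half_edge_unique[OF edge_at_oriented[OF \<alpha>] edge_at_oriented[OF \<beta>]]
      edge_at_initial[OF \<alpha> p i] edge_at_initial[OF \<beta> q i] eq edge_at_label(1)[OF c p q i \<alpha> \<beta>] by simp
  then show "p i = q i"
    using edge_at_label(2)[OF c p q i \<alpha> \<beta>] by simp
qed

lemma crossing_cube:
  assumes c: "c \<in> cells X" and p: "p \<in> cube_vertices (dm c)" and ij: "i < dm c" "j < dm c" "i \<noteq> j"
    and \<alpha>: "edge_at X c p i \<alpha>" and \<beta>: "edge_at X c p j \<beta>"
  shows "crossing (fst (label \<alpha>)) (fst (label \<beta>))"
proof -
  have "\<alpha> \<noteq> \<beta>"
  proof
    assume "\<alpha> = \<beta>"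
    then have "cmap X c (flip p i) = cmap X c (flip p j)"
      using edge_at_terminal[OF \<alpha> p ij(1)] edge_at_terminal[OF \<beta> p ij(2)] by simp
    then have "flip p i = flip p j"
      using cube_vertices_distinct[OF c] flip_vertex p ij by blast
    then have "flip p i i = flip p j i"
      by simp
    moreover have "p i = 0 \<or> p i = 1"
      using p ij by (simp add: cube_vertices_iff)
    ultimately show False
      using ij by auto
  qed
  have ini: "initial X \<alpha> = initial X \<beta>"
    using edge_at_initial[OF \<alpha> p ij(1)] edge_at_initial[OF \<beta> p ij(2)] by simp
  have "fst (label \<alpha>) \<noteq> fst (label \<beta>)"
    using half_edge_unique[OF edge_at_oriented[OF \<alpha>] edge_at_oriented[OF \<beta>] ini] \<open>\<alpha> \<noteq> \<beta>\<close> by blast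
  moreover have "consecutive X (fst \<alpha>) (fst \<beta>)"
    using corner_cube[OF c p ij \<alpha> \<beta>] unfolding consecutive_def by (metis prod.collapse)
  ultimately show ?thesis
    using in_hyp[OF edge_fst[OF edge_at_oriented[OF \<alpha>]]] in_hyp[OF edge_fst[OF edge_at_oriented[OF \<beta>]]]
    unfolding crossing_def label_def fst_conv by blast
qed

subsection \<open>Contracting a star to its vertex\<close>

definition corner_of :: "'a \<Rightarrow> 'a \<Rightarrow> nat \<Rightarrow> real" where
  "corner_of v x = (THE r. r \<in> cube_vertices (dm (cell_of x)) \<and> cmap X (cell_of x) r = v)"

definition contract :: "'a \<Rightarrow> 'a \<Rightarrow> real \<Rightarrow> 'a" where
  "contract v x t = cmap X (cell_of x) (lerp (dm (cell_of x)) t (coord_of x) (corner_of v x))"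

lemma corner_of:
  assumes "x \<in> star v"
  shows "corner_of v x \<in> cube_vertices (dm (cell_of x))" "cmap X (cell_of x) (corner_of v x) = v"
proof -
  have c: "cell_of x \<in> cells X"
    using assms cell_of(1) star_subset by blast
  obtain r where r: "r \<in> cube_vertices (dm (cell_of x))" "cmap X (cell_of x) r = v"
    using assms by (auto simp: star_def)
  then have "corner_of v x = r"
    unfolding corner_of_def by (intro the_equality) (use cube_vertices_distinct[OF c] in auto)
  then show "corner_of v x \<in> cube_vertices (dm (cell_of x))" "cmap X (cell_of x) (corner_of v x) = v"
    using r by simp_all
qed

lemma corner_of_eq:
  assumes "x \<in> star v" "r \<in> cube_vertices (dm (cell_of x))" "cmap X (cell_of x) r = v"
  shows "corner_of v x = r"
  using cube_vertices_distinct[OF cell_of(1)] corner_of[OF assms(1)] assms star_subset by blast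

lemma corner_of_carrier:
  assumes c: "c \<in> cells X" and u: "u \<in> cube (dm c)" and p: "p \<in> cube_vertices (dm c)" "near (dm c) u p"
    and f: "is_face X (cell_of (cmap X c u)) c s b a"
    and emb: "face_emb (dm (cell_of (cmap X c u))) (dm c) s b a (coord_of (cmap X c u)) = u"
  shows "face_emb (dm (cell_of (cmap X c u))) (dm c) s b a (corner_of (cmap X c p) (cmap X c u)) = p"
proof -
  obtain r where r: "r \<in> cube_vertices (dm (cell_of (cmap X c u)))"
      "face_emb (dm (cell_of (cmap X c u))) (dm c) s b a r = p" "cmap X (cell_of (cmap X c u)) r = cmap X c p"
    using carrier_vertex[OF f emb p] by blast
  have "cmap X c u \<in> star (cmap X c p)"
    using star_iff[OF c u] p by blast
  from corner_of_eq[OF this r(1,3)] r(2) show ?thesis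
    by simp
qed

lemma contract_cube:
  assumes c: "c \<in> cells X" and u: "u \<in> cube (dm c)" and p: "p \<in> cube_vertices (dm c)" "near (dm c) u p"
    and t: "t \<in> {0..1}"
  shows "contract (cmap X c p) (cmap X c u) t = cmap X c (lerp (dm c) t u p)"
proof -
  let ?x = "cmap X c u" and ?v = "cmap X c p"
  obtain s b a where f: "is_face X (cell_of ?x) c s b a" and x: "?x \<in> topspace T"
    and emb: "face_emb (dm (cell_of ?x)) (dm c) s b a (coord_of ?x) = u"
    using carrier_exists[OF c u] by (elim exE conjE)
  interpret F: face_parameters "dm (cell_of ?x)" "dm c" s b a
    using f by (simp add: is_face_def)
  have embp: "F.emb (corner_of ?v ?x) = p"
    by (rule corner_of_carrier[OF c u p f emb])
  have st: "?x \<in> star ?v"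
    using star_iff[OF c u] p by blast
  have "lerp (dm (cell_of ?x)) t (coord_of ?x) (corner_of ?v ?x) \<in> cube (dm (cell_of ?x))"
    using open_cube_subset[OF cell_of(2)[OF x]] cube_vertices_subset[OF corner_of(1)[OF st]] t
    by (rule lerp_cube)
  then have "cmap X (cell_of ?x) (lerp (dm (cell_of ?x)) t (coord_of ?x) (corner_of ?v ?x)) =
      cmap X c (F.emb (lerp (dm (cell_of ?x)) t (coord_of ?x) (corner_of ?v ?x)))"
    using f unfolding is_face_def by metis
  also have "\<dots> = cmap X c (lerp (dm c) t u p)"
    by (simp add: F.emb_lerp emb embp)
  finally show ?thesis
    by (simp add: contract_def)
qed

lemma star_cases:
  assumes "x \<in> star v"
  obtains c u p where "c \<in> cells X" "u \<in> cube (dm c)" "p \<in> cube_vertices (dm c)" "near (dm c) u p"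
    "x = cmap X c u" "v = cmap X c p"
proof -
  have x: "x \<in> topspace T"
    using assms star_subset by blast
  note o = cell_of[OF x]
  have u: "coord_of x \<in> cube (dm (cell_of x))"
    using open_cube_subset[OF o(2)] .
  have "cmap X (cell_of x) (coord_of x) \<in> star v"
    using o(3) assms by simp
  then obtain p where "p \<in> cube_vertices (dm (cell_of x))" "near (dm (cell_of x)) (coord_of x) p" "cmap X (cell_of x) p = v"
    using star_iff[OF o(1) u] by blast
  then show ?thesis
    using that[OF o(1) u] o(3) by simp
qed

lemma contract_ends:
  assumes "x \<in> star v"
  shows "contract v x 0 = x" "contract v x 1 = v" "t \<in> {0..1} \<Longrightarrow> contract v x t \<in> star v"
proof -
  obtain c u p where cu: "c \<in> cells X" "u \<in> cube (dm c)" "p \<in> cube_vertices (dm c)" "near (dm c) u p"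
    "x = cmap X c u" "v = cmap X c p"
    by (rule star_cases[OF assms])
  note p = cube_vertices_subset[OF cu(3)]
  show "contract v x 0 = x" "contract v x 1 = v"
    using contract_cube[OF cu(1-4)] lerp_ends(1)[OF cu(2)] lerp_ends(2)[OF p] cu(5,6) by simp_all
  assume t: "t \<in> {0..1}"
  have "cmap X c (lerp (dm c) t u p) \<in> star v"
    using star_iff[OF cu(1) lerp_cube[OF cu(2) p t]] near_lerp[OF cu(4) t] cu(3,6) by blast
  then show "contract v x t \<in> star v"
    using contract_cube[OF cu(1-4) t] cu(5,6) by simp
qed

text \<open>
  The weak topology tests openness one cell at a time, but says nothing about products.  Joint
  continuity of the contraction is therefore deduced from the compactness of the set \<open>K\<close> of
  times: the projection along \<open>K\<close> is a closed map on each cell.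
\<close>
lemma openin_contract_all:
  assumes "closed K" "K \<subseteq> {0..1}" and W: "openin T W"
  shows "openin T {x \<in> star v. \<forall>t\<in>K. contract v x t \<in> W}"
  unfolding openin_iff
proof (intro conjI ballI)
  show "{x \<in> star v. \<forall>t\<in>K. contract v x t \<in> W} \<subseteq> topspace T"
    using star_subset by blast
  fix c assume c: "c \<in> cells X"
  let ?P = "{p \<in> cube_vertices (dm c). cmap X c p = v}"
  let ?N = "\<lambda>p. {u \<in> cube (dm c). near (dm c) u p}"
  let ?C = "\<lambda>p. {u \<in> cube (dm c). \<forall>t\<in>K. cmap X c (lerp (dm c) t u p) \<in> W}"
  have tube: "openin (cube_top (dm c)) (?C p)" if p: "p \<in> cube (dm c)" for p
  proof -
    let ?Z = "prod_topology (cube_top (dm c)) (top_of_set K)"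
    have snd: "continuous_map ?Z I01 snd"
    proof -
      have "continuous_map ?Z (top_of_set K) snd"
        by (rule continuous_map_snd)
      then show ?thesis
        using assms(2) by (auto simp: continuous_map_in_subtopology)
    qed
    have "continuous_map ?Z (cube_top (dm c)) (\<lambda>z. lerp (dm c) (snd z) (fst z) p)"
      by (rule continuous_map_lerp[OF p continuous_map_fst snd])
    then have "continuous_map ?Z T (cmap X c \<circ> (\<lambda>z. lerp (dm c) (snd z) (fst z) p))"
      using continuous_map_cmap[OF c] by (rule continuous_map_compose)
    from openin_continuous_map_preimage[OF this W]
    have op: "openin ?Z {z \<in> topspace ?Z. cmap X c (lerp (dm c) (snd z) (fst z) p) \<in> W}" (is "openin _ ?O")
      by simp
    have "closedin ?Z (topspace ?Z - ?O)"
      using op by (rule closedin_diff[OF closedin_topspace])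
    moreover have "compact_space (top_of_set K)"
      using assms(1,2) compact_Icc[of "0::real" 1] closed_Int_compact[of K "{0..1}"]
      by (simp add: Int_absorb2 compact_space_subtopology)
    ultimately have "closedin (cube_top (dm c)) (fst ` (topspace ?Z - ?O))"
      using closed_map_fst unfolding closed_map_def by blast
    then have "openin (cube_top (dm c)) (cube (dm c) - fst ` (topspace ?Z - ?O))"
      using openin_diff[OF openin_topspace, of "cube_top (dm c)"] by simp
    moreover have "cube (dm c) - fst ` (topspace ?Z - ?O) = ?C p"
      by (force simp: image_iff)
    ultimately show ?thesis by simp
  qed
  have "{u \<in> cube (dm c). cmap X c u \<in> {x \<in> star v. \<forall>t\<in>K. contract v x t \<in> W}} = (\<Union>p\<in>?P. ?N p \<inter> ?C p)"
  proof (intro equalityI subsetI)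
    fix u assume "u \<in> {u \<in> cube (dm c). cmap X c u \<in> {x \<in> star v. \<forall>t\<in>K. contract v x t \<in> W}}"
    then have u: "u \<in> cube (dm c)" "cmap X c u \<in> star v" "\<forall>t\<in>K. contract v (cmap X c u) t \<in> W"
      by auto
    then obtain p where p: "p \<in> cube_vertices (dm c)" "near (dm c) u p" "cmap X c p = v"
      using star_iff[OF c u(1)] by blast
    then have "\<forall>t\<in>K. cmap X c (lerp (dm c) t u p) \<in> W"
      using contract_cube[OF c u(1) p(1,2)] u(3) assms(2) by (metis subsetD)
    then show "u \<in> (\<Union>p\<in>?P. ?N p \<inter> ?C p)"
      using u p by blast
  next
    fix u assume "u \<in> (\<Union>p\<in>?P. ?N p \<inter> ?C p)"
    then obtain p where p: "p \<in> cube_vertices (dm c)" "near (dm c) u p" "cmap X c p = v"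
      and u: "u \<in> cube (dm c)" "\<forall>t\<in>K. cmap X c (lerp (dm c) t u p) \<in> W"
      by blast
    then have "\<forall>t\<in>K. contract v (cmap X c u) t \<in> W"
      using contract_cube[OF c u(1) p(1,2)] assms(2) by (metis subsetD)
    then show "u \<in> {u \<in> cube (dm c). cmap X c u \<in> {x \<in> star v. \<forall>t\<in>K. contract v x t \<in> W}}"
      using star_iff[OF c u(1)] p u(1) by blast
  qed
  moreover have "openin (cube_top (dm c)) (\<Union>p\<in>?P. ?N p \<inter> ?C p)"
    using openin_near tube cube_vertices_subset by (intro openin_Union) (auto intro!: openin_Int)
  ultimately show "openin (cube_top (dm c)) {u \<in> cube (dm c). cmap X c u \<in> {x \<in> star v. \<forall>t\<in>K. contract v x t \<in> W}}"
    by simp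
qed

lemma pathin_contract:
  assumes "x \<in> star v"
  shows "pathin T (contract v x)"
proof -
  obtain c u p where cu: "c \<in> cells X" "u \<in> cube (dm c)" "p \<in> cube_vertices (dm c)" "near (dm c) u p"
    "x = cmap X c u" "v = cmap X c p"
    by (rule star_cases[OF assms])
  have "continuous_map I01 (cube_top (dm c)) (\<lambda>t. lerp (dm c) t u p)"
    using cu by (intro continuous_map_lerp cube_vertices_subset) auto
  then have "pathin T (cmap X c \<circ> (\<lambda>t. lerp (dm c) t u p))"
    unfolding pathin_def using continuous_map_cmap[OF cu(1)] by (rule continuous_map_compose)
  then show ?thesis
    unfolding pathin_def using contract_cube[OF cu(1-4)] cu(5,6)
    by (elim continuous_map_eq) simp
qed

lemma continuous_map_contract:
  assumes \<sigma>: "pathin T \<sigma>" and st: "\<And>s. s \<in> {0..1} \<Longrightarrow> \<sigma> s \<in> star v"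
  shows "continuous_map (top_of_set ({0..1} \<times> {0..1})) T (\<lambda>z. contract v (\<sigma> (fst z)) (snd z))"
  unfolding continuous_map_def
proof (intro conjI allI impI)
  show "(\<lambda>z. contract v (\<sigma> (fst z)) (snd z)) \<in> topspace (top_of_set ({0..1} \<times> {0..1})) \<rightarrow> topspace T"
    using st contract_ends(3) star_subset by fastforce
  fix W assume W: "openin T W"
  show "openin (top_of_set ({0..1} \<times> {0..1}))
      {z \<in> topspace (top_of_set ({0..1} \<times> {0..1})). contract v (\<sigma> (fst z)) (snd z) \<in> W}"
  proof (subst openin_subopen, intro ballI)
    fix z assume "z \<in> {z \<in> topspace (top_of_set ({0..1} \<times> {0..1})). contract v (\<sigma> (fst z)) (snd z) \<in> W}"
    then obtain s t where z: "z = (s, t)" "s \<in> {0..1}" "t \<in> {0..1}" "contract v (\<sigma> s) t \<in> W"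
      by auto
    obtain e where e: "e > 0" "\<And>r. r \<in> {0..1} \<Longrightarrow> dist r t < e \<Longrightarrow> contract v (\<sigma> s) r \<in> W"
      by (rule continuous_map_metric_nbhd[OF pathin_contract[OF st[OF z(2)], unfolded pathin_def] z(3) W z(4)], rule that)
    define K where "K = {0..1} \<inter> cball t (e / 2)"
    have K: "closed K" "K \<subseteq> {0..1}"
      by (auto simp: K_def)
    let ?A = "{x \<in> star v. \<forall>t\<in>K. contract v x t \<in> W}"
    have "openin I01 {s \<in> topspace I01. \<sigma> s \<in> ?A}"
      using \<sigma> openin_contract_all[OF K W, of v] unfolding pathin_def by (rule openin_continuous_map_preimage)
    then have "openin I01 {s \<in> {0..1}. \<sigma> s \<in> ?A}"
      by simp
    moreover have "openin I01 ({0..1} \<inter> ball t (e / 2))"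
      by (rule openin_open_Int) simp
    ultimately have "openin (prod_topology I01 I01) ({s \<in> {0..1}. \<sigma> s \<in> ?A} \<times> ({0..1} \<inter> ball t (e / 2)))"
      unfolding openin_prod_Times_iff by blast
    then have op: "openin (top_of_set ({0..1} \<times> {0..1})) ({s \<in> {0..1}. \<sigma> s \<in> ?A} \<times> ({0..1} \<inter> ball t (e / 2)))"
      by simp
    have "\<sigma> s \<in> ?A"
      using st[OF z(2)] e by (auto simp: K_def dist_commute)
    then have zin: "z \<in> {s \<in> {0..1}. \<sigma> s \<in> ?A} \<times> ({0..1} \<inter> ball t (e / 2))"
      using z e(1) by simp
    have "{s \<in> {0..1}. \<sigma> s \<in> ?A} \<times> ({0..1} \<inter> ball t (e / 2)) \<subseteq>
        {z \<in> topspace (top_of_set ({0..1} \<times> {0..1})). contract v (\<sigma> (fst z)) (snd z) \<in> W}"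
      by (auto simp: K_def)
    then show "\<exists>S. openin (top_of_set ({0..1} \<times> {0..1})) S \<and> z \<in> S \<and>
        S \<subseteq> {z \<in> topspace (top_of_set ({0..1} \<times> {0..1})). contract v (\<sigma> (fst z)) (snd z) \<in> W}"
      using op zin by blast
  qed
qed

text \<open>
  Contracting the star sweeps out a square whose sides are the path, the contractions of its end
  points and the constant path at the vertex.
\<close>
lemma path_in_star:
  assumes \<sigma>: "pathin T \<sigma>" and st: "\<And>s. s \<in> {0..1} \<Longrightarrow> \<sigma> s \<in> star v"
  shows "path_homotopic T (path_concat \<sigma> (contract v (\<sigma> 1))) (contract v (\<sigma> 0))"
proof -
  have s0: "\<sigma> 0 \<in> star v" "\<sigma> 1 \<in> star v"
    using st by simp_all
  let ?h = "\<lambda>z. contract v (\<sigma> (fst z)) (snd z)"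
  have p1: "pathin T (path_concat \<sigma> (contract v (\<sigma> 1)))"
    using \<sigma> pathin_contract[OF s0(2)] contract_ends(1)[OF s0(2)] by (simp add: pathin_concat)
  have square: "path_homotopic T (path_concat (\<lambda>s. ?h (s, 0)) (\<lambda>t. ?h (1, t)))
      (path_concat (\<lambda>t. ?h (0, t)) (\<lambda>s. ?h (s, 1)))"
    by (rule path_homotopic_square[OF continuous_map_contract[OF \<sigma> st]])
  have "path_homotopic T (path_concat \<sigma> (contract v (\<sigma> 1))) (path_concat (\<lambda>s. ?h (s, 0)) (\<lambda>t. ?h (1, t)))"
    using st contract_ends(1) by (intro path_homotopic_eq p1) (auto simp: path_concat_def)
  also note square
  also have "path_homotopic T (path_concat (\<lambda>t. ?h (0, t)) (\<lambda>s. ?h (s, 1)))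
      (path_concat (contract v (\<sigma> 0)) (\<lambda>_. contract v (\<sigma> 0) 1))"
    using st contract_ends(2) by (intro path_homotopic_eq path_homotopic_imp(2)[OF square]) (auto simp: path_concat_def)
  also have "path_homotopic T (path_concat (contract v (\<sigma> 0)) (\<lambda>_. contract v (\<sigma> 0) 1)) (contract v (\<sigma> 0))"
    by (rule path_concat_const_right[OF pathin_contract[OF s0(1)]])
  finally show ?thesis .
qed

end

section \<open>Coverings from locally constant transition functions\<close>

text \<open>
  A covering of \<open>T\<close> with fibre \<open>E\<close>, given by trivialisations over open sets \<open>U v\<close>: the point
  with coordinate \<open>e\<close> over \<open>x\<close> in the trivialisation \<open>v\<close> is the pair of \<open>x\<close> and \<open>g v x e\<close>.
\<close>
locale transition_cover =
  fixes T :: "'a topology" and U :: "'v \<Rightarrow> 'a set" and g :: "'v \<Rightarrow> 'a \<Rightarrow> 'e \<Rightarrow> 'e" and E :: "'e set"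
  assumes open_U: "openin T (U v)"
    and cover: "x \<in> topspace T \<Longrightarrow> \<exists>v. x \<in> U v"
    and bij: "x \<in> U v \<Longrightarrow> bij_betw (g v x) E E"
    and transition: "e \<in> E \<Longrightarrow> e' \<in> E \<Longrightarrow> openin T {x \<in> U v \<inter> U w. g v x e = g w x e'}"
    and nonempty: "E \<noteq> {}"
begin

lemma U_subset: "U v \<subseteq> topspace T"
  using open_U by (rule openin_subset)

lemma g_in: "x \<in> U v \<Longrightarrow> e \<in> E \<Longrightarrow> g v x e \<in> E"
  using bij bij_betw_apply by metis

definition total :: "('a \<times> 'e) topology" where
  "total = topology (\<lambda>W. W \<subseteq> topspace T \<times> E \<and> (\<forall>v. \<forall>e\<in>E. openin T {x \<in> U v. (x, g v x e) \<in> W}))"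

lemma openin_total:
  "openin total W \<longleftrightarrow> W \<subseteq> topspace T \<times> E \<and> (\<forall>v. \<forall>e\<in>E. openin T {x \<in> U v. (x, g v x e) \<in> W})"
proof -
  have "istopology (\<lambda>W. W \<subseteq> topspace T \<times> E \<and> (\<forall>v. \<forall>e\<in>E. openin T {x \<in> U v. (x, g v x e) \<in> W}))"
    unfolding istopology_def
  proof (intro conjI allI impI ballI)
    fix S S' assume S: "S \<subseteq> topspace T \<times> E \<and> (\<forall>v. \<forall>e\<in>E. openin T {x \<in> U v. (x, g v x e) \<in> S})"
      and S': "S' \<subseteq> topspace T \<times> E \<and> (\<forall>v. \<forall>e\<in>E. openin T {x \<in> U v. (x, g v x e) \<in> S'})"
    show "S \<inter> S' \<subseteq> topspace T \<times> E"
      using S by blast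
    fix v e assume e: "e \<in> E"
    have "{x \<in> U v. (x, g v x e) \<in> S \<inter> S'} = {x \<in> U v. (x, g v x e) \<in> S} \<inter> {x \<in> U v. (x, g v x e) \<in> S'}"
      by blast
    then show "openin T {x \<in> U v. (x, g v x e) \<in> S \<inter> S'}"
      using S S' e by (simp only: openin_Int)
  next
    fix \<K> assume K: "\<forall>K\<in>\<K>. K \<subseteq> topspace T \<times> E \<and> (\<forall>v. \<forall>e\<in>E. openin T {x \<in> U v. (x, g v x e) \<in> K})"
    show "\<Union>\<K> \<subseteq> topspace T \<times> E"
      using K by blast
    fix v e assume e: "e \<in> E"
    have "{x \<in> U v. (x, g v x e) \<in> \<Union>\<K>} = \<Union>((\<lambda>K. {x \<in> U v. (x, g v x e) \<in> K}) ` \<K>)"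
      by blast
    moreover have "openin T (\<Union>((\<lambda>K. {x \<in> U v. (x, g v x e) \<in> K}) ` \<K>))"
      using K e by (intro openin_Union) blast
    ultimately show "openin T {x \<in> U v. (x, g v x e) \<in> \<Union>\<K>}"
      by (simp only:)
  qed
  then show ?thesis
    by (simp add: total_def topology_inverse')
qed

lemma topspace_total: "topspace total = topspace T \<times> E"
proof -
  have "{x \<in> U v. (x, g v x e) \<in> topspace T \<times> E} = U v" if "e \<in> E" for v e
    using U_subset g_in that by blast
  then have "openin total (topspace T \<times> E)"
    using open_U by (simp add: openin_total)
  then show ?thesis
    using openin_total openin_subset openin_topspace by (metis subset_antisym)
qed

lemma continuous_map_section:
  assumes "e \<in> E"
  shows "continuous_map (subtopology T (U v)) total (\<lambda>x. (x, g v x e))"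
  unfolding continuous_map_def
proof (intro conjI allI impI)
  have top: "topspace (subtopology T (U v)) = U v"
    using U_subset by (auto simp: topspace_subtopology)
  show "(\<lambda>x. (x, g v x e)) \<in> topspace (subtopology T (U v)) \<rightarrow> topspace total"
    using assms U_subset g_in by (auto simp: top topspace_total)
  fix W assume "openin total W"
  then have "openin T {x \<in> U v. (x, g v x e) \<in> W}"
    using assms by (simp add: openin_total)
  then show "openin (subtopology T (U v)) {x \<in> topspace (subtopology T (U v)). (x, g v x e) \<in> W}"
    unfolding top openin_open_subtopology[OF open_U] by blast
qed

lemma continuous_map_fst_total: "continuous_map total T fst"
  unfolding continuous_map_def
proof (intro conjI allI impI)
  show "fst \<in> topspace total \<rightarrow> topspace T"
    by (auto simp: topspace_total)
  fix W assume W: "openin T W"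
  have "{x \<in> U v. (x, g v x e) \<in> {z \<in> topspace T \<times> E. fst z \<in> W}} = U v \<inter> W" if "e \<in> E" for v e
    using U_subset g_in that by auto
  then show "openin total {z \<in> topspace total. fst z \<in> W}"
    unfolding openin_total topspace_total using open_U W by auto
qed

lemma covering_map_total: "covering_map total T fst"
  unfolding covering_map_def
proof (intro conjI ballI continuous_map_fst_total)
  show "fst ` topspace total = topspace T"
    using nonempty by (simp add: topspace_total)
  fix x assume x: "x \<in> topspace T"
  then obtain v where v: "x \<in> U v"
    using cover by blast
  define V where "V e = (\<lambda>x. (x, g v x e)) ` U v" for e
  have open_V: "openin total (V e)" if e: "e \<in> E" for e
    unfolding openin_total
  proof (intro conjI allI ballI)
    show "V e \<subseteq> topspace T \<times> E"
      using U_subset g_in e by (auto simp: V_def)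
    fix w e' assume e': "e' \<in> E"
    have "{x \<in> U w. (x, g w x e') \<in> V e} = {x \<in> U v \<inter> U w. g v x e = g w x e'}"
      by (auto simp: V_def)
    then show "openin T {x \<in> U w. (x, g w x e') \<in> V e}"
      using transition[OF e e'] by simp
  qed
  show "\<exists>N. x \<in> N \<and> openin T N \<and> (\<exists>\<V>. \<Union>\<V> = {y \<in> topspace total. fst y \<in> N} \<and>
      (\<forall>V\<in>\<V>. openin total V) \<and> pairwise disjnt \<V> \<and>
      (\<forall>V\<in>\<V>. homeomorphic_map (subtopology total V) (subtopology T N) fst))"
  proof (intro exI[of _ "U v"] exI[of _ "V ` E"] conjI ballI v open_U)
    show "\<Union>(V ` E) = {y \<in> topspace total. fst y \<in> U v}"
    proof (intro equalityI subsetI)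
      fix y assume "y \<in> {y \<in> topspace total. fst y \<in> U v}"
      then have y: "fst y \<in> U v" "snd y \<in> E"
        by (auto simp: topspace_total)
      then obtain e where "e \<in> E" "g v (fst y) e = snd y"
        using bij[OF y(1)] unfolding bij_betw_def by (metis imageE)
      then show "y \<in> \<Union>(V ` E)"
        using y(1) by (force simp: V_def)
    qed (use U_subset g_in in \<open>auto simp: V_def topspace_total\<close>)
    show "openin total W" if "W \<in> V ` E" for W
      using that open_V by blast
    show "pairwise disjnt (V ` E)"
      unfolding pairwise_def disjnt_def
    proof (intro ballI impI)
      fix W W' assume "W \<in> V ` E" "W' \<in> V ` E" "W \<noteq> W'"
      then obtain e e' where e: "e \<in> E" "e' \<in> E" "W = V e" "W' = V e'" "e \<noteq> e'"
        by blast
      have "g v x e \<noteq> g v x e'" if "x \<in> U v" for x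
        using bij[OF that] e(1,2,5) unfolding bij_betw_def inj_on_def by blast
      then show "W \<inter> W' = {}"
        using e by (auto simp: V_def)
    qed
    fix W assume "W \<in> V ` E"
    then obtain e where e: "e \<in> E" "W = V e"
      by blast
    have W: "W \<subseteq> topspace total"
      using open_V[OF e(1)] e(2) openin_subset by blast
    have "continuous_map (subtopology total W) (subtopology T (U v)) fst"
      using continuous_map_from_subtopology[OF continuous_map_fst_total] e(2) W
      by (auto simp: continuous_map_in_subtopology V_def)
    moreover have "continuous_map (subtopology T (U v)) (subtopology total W) (\<lambda>x. (x, g v x e))"
      using continuous_map_section[OF e(1)] e(2) U_subset
      by (auto simp: continuous_map_in_subtopology V_def)
    ultimately have "homeomorphic_maps (subtopology total W) (subtopology T (U v)) fst (\<lambda>x. (x, g v x e))"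
      using e(2) by (auto simp: homeomorphic_maps_def V_def)
    then show "homeomorphic_map (subtopology total W) (subtopology T (U v)) fst"
      unfolding homeomorphic_map_maps by blast
  qed
qed

lemma lifts_to_section:
  assumes "pathin T \<sigma>" "\<And>s. s \<in> {0..1} \<Longrightarrow> \<sigma> s \<in> U v" "e \<in> E"
  shows "lifts_to total fst \<sigma> (\<sigma> 0, g v (\<sigma> 0) e) (\<sigma> 1, g v (\<sigma> 1) e)"
proof -
  have "continuous_map I01 (subtopology T (U v)) \<sigma>"
    using assms(1,2) by (auto simp: pathin_def continuous_map_in_subtopology)
  then have "pathin total ((\<lambda>x. (x, g v x e)) \<circ> \<sigma>)"
    unfolding pathin_def using continuous_map_section[OF assms(3)] by (rule continuous_map_compose)
  then show ?thesis
    unfolding lifts_to_def by (intro exI[of _ "(\<lambda>x. (x, g v x e)) \<circ> \<sigma>"]) simp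
qed

end

section \<open>The covering of a C-special complex defined by an action\<close>

lemma letter_act_cancel:
  assumes "raag_action cm \<rho>"
  shows "letter_act \<rho> (x, b) (letter_act \<rho> (x, \<not> b) e) = e"
  using raag_actionD(1)[OF assms, of x]
  by (cases b) (simp_all add: letter_act_def bij_is_surj surj_f_inv_f bij_is_inj)

lemma bij_letter_act:
  assumes "raag_action cm \<rho>"
  shows "bij (letter_act \<rho> l)"
  using raag_actionD(1)[OF assms, of "fst l"] by (simp add: letter_act_def bij_imp_bij_inv)

lemma letter_act_commute:
  assumes \<rho>: "raag_action cm \<rho>" and "cm x y"
  shows "letter_act \<rho> (x, b) (letter_act \<rho> (y, c) e) = letter_act \<rho> (y, c) (letter_act \<rho> (x, b) e)"
proof -
  have base: "letter_act \<rho> (x, True) (letter_act \<rho> (y, True) e) = letter_act \<rho> (y, True) (letter_act \<rho> (x, True) e)" for e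
    using raag_actionD(4)[OF \<rho> assms(2)] by (simp add: letter_act_def)
  have 1: "letter_act \<rho> (x, b) (letter_act \<rho> (y, True) e) = letter_act \<rho> (y, True) (letter_act \<rho> (x, b) e)" for e
  proof (cases b)
    case False
    have "letter_act \<rho> (x, False) (letter_act \<rho> (y, True) (letter_act \<rho> (x, True) (letter_act \<rho> (x, False) e))) =
      letter_act \<rho> (x, False) (letter_act \<rho> (x, True) (letter_act \<rho> (y, True) (letter_act \<rho> (x, False) e)))"
      by (simp only: base)
    then show ?thesis
      using letter_act_cancel[OF \<rho>, of x True] letter_act_cancel[OF \<rho>, of x False] False by simp
  qed (use base in simp)
  show ?thesis
  proof (cases c)
    case False
    have "letter_act \<rho> (y, False) (letter_act \<rho> (x, b) (letter_act \<rho> (y, True) (letter_act \<rho> (y, False) e))) =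
      letter_act \<rho> (y, False) (letter_act \<rho> (y, True) (letter_act \<rho> (x, b) (letter_act \<rho> (y, False) e)))"
      by (simp only: 1)
    then show ?thesis
      using letter_act_cancel[OF \<rho>, of y True] letter_act_cancel[OF \<rho>, of y False] False by simp
  qed (use 1 in simp)
qed

lemma letter_act_translate:
  assumes \<rho>: "raag_action cm \<rho>"
  shows "letter_act \<rho> l (translate k e) = translate k (letter_act \<rho> l e)"
proof -
  have "letter_act \<rho> (x, b) (translate k e) = translate k (letter_act \<rho> (x, b) e)" for x b
  proof (cases b)
    case False
    have "letter_act \<rho> (x, False) (translate k (letter_act \<rho> (x, True) (letter_act \<rho> (x, False) e))) =
        letter_act \<rho> (x, False) (letter_act \<rho> (x, True) (translate k (letter_act \<rho> (x, False) e)))"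
      using raag_actionD(3)[OF \<rho>] by (simp add: letter_act_def)
    then show ?thesis
      using letter_act_cancel[OF \<rho>, of x True] letter_act_cancel[OF \<rho>, of x False] False by simp
  qed (use raag_actionD(3)[OF \<rho>] in \<open>simp add: letter_act_def\<close>)
  then show ?thesis
    by (metis surj_pair)
qed

lemma letter_act_length:
  assumes \<rho>: "raag_action cm \<rho>"
  shows "length (fst (letter_act \<rho> l e)) = length (fst e)"
proof -
  have "length (fst (letter_act \<rho> (x, b) e)) = length (fst e)" for x b
  proof (cases b)
    case False
    have "length (fst (letter_act \<rho> (x, True) (letter_act \<rho> (x, False) e))) = length (fst (letter_act \<rho> (x, False) e))"
      using raag_actionD(2)[OF \<rho>] by (simp add: letter_act_def)
    then show ?thesis
      using letter_act_cancel[OF \<rho>, of x True] False by simp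
  qed (use raag_actionD(2)[OF \<rho>] in \<open>simp add: letter_act_def\<close>)
  then show ?thesis
    by (metis surj_pair)
qed

locale acted_cx = special_cx X for X :: "('a, 'c) cell_structure" +
  fixes \<rho> :: "'c set \<Rightarrow> bool list \<times> int \<Rightarrow> bool list \<times> int" and n :: nat
  assumes action: "raag_action crossing \<rho>"
begin

abbreviation "A \<alpha> \<equiv> letter_act \<rho> (label \<alpha>)"

lemma A_rev [simp]: "A \<alpha> (A (rev_edge \<alpha>) e) = e" "A (rev_edge \<alpha>) (A \<alpha> e) = e"
  using letter_act_cancel[OF action, of "fst (label \<alpha>)" "snd (label \<alpha>)" e]
    letter_act_cancel[OF action, of "fst (label \<alpha>)" "\<not> snd (label \<alpha>)" e]
  by (simp_all add: label_rev)

text \<open>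
  The potential of a corner of a cube: the action of the labels along an edge path in the cube to
  its corner \<open>0\<close>.  As the labels of the different directions commute, the order of the
  directions does not matter.
\<close>
definition down_edge :: "'c \<Rightarrow> nat \<Rightarrow> 'c \<times> bool" where
  "down_edge c i = (SOME \<alpha>. edge_at X c (\<lambda>i\<in>{..<dm c}. 1) i \<alpha>)"

primrec partial_potential :: "'c \<Rightarrow> (nat \<Rightarrow> real) \<Rightarrow> nat \<Rightarrow> bool list \<times> int \<Rightarrow> bool list \<times> int" where
  "partial_potential c r 0 e = e"
| "partial_potential c r (Suc k) e =
     partial_potential c r k (if r k = 0 then e else A (down_edge c k) e)"

definition potential :: "'c \<Rightarrow> (nat \<Rightarrow> real) \<Rightarrow> bool list \<times> int \<Rightarrow> bool list \<times> int" where
  "potential c r = partial_potential c r (dm c)"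

lemma ones_vertex: "(\<lambda>i\<in>{..<dm c}. 1) \<in> cube_vertices (dm c)"
  by (simp add: cube_vertices_iff)

lemma down_edge: "c \<in> cells X \<Longrightarrow> i < dm c \<Longrightarrow> edge_at X c (\<lambda>i\<in>{..<dm c}. 1) i (down_edge c i)"
  unfolding down_edge_def by (rule someI_ex) (rule edge_at_exists[OF _ ones_vertex])

lemma partial_potential_flip:
  assumes c: "c \<in> cells X" and i: "i < dm c" and ri: "r i = 1"
  shows "k \<le> dm c \<Longrightarrow> partial_potential c r k e =
    partial_potential c (flip r i) k (if i < k then A (down_edge c i) e else e)"
proof (induction k arbitrary: e)
  case (Suc k)
  consider "i < k" | "i = k" | "k < i"
    by linarith
  then show ?case
  proof cases
    case 1
    have "crossing (fst (label (down_edge c i))) (fst (label (down_edge c k)))"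
      using 1 Suc.prems by (intro crossing_cube[OF c ones_vertex i _ _ down_edge[OF c i] down_edge[OF c]]) auto
    then have "A (down_edge c i) (A (down_edge c k) e) = A (down_edge c k) (A (down_edge c i) e)"
      using letter_act_commute[OF action] by (metis prod.collapse)
    then show ?thesis
      using 1 Suc by simp
  qed (use Suc ri in simp_all)
qed simp

lemma potential_edge:
  assumes c: "c \<in> cells X" and r: "r \<in> cube_vertices (dm c)" and i: "i < dm c" and \<alpha>: "edge_at X c r i \<alpha>"
  shows "potential c r e = potential c (flip r i) (A \<alpha> e)"
proof -
  have up: "potential c r e = potential c (flip r i) (A \<alpha> e)"
    if r: "r \<in> cube_vertices (dm c)" and \<alpha>: "edge_at X c r i \<alpha>" and ri: "r i = 1" for r \<alpha> e
  proof -
    have "label \<alpha> = label (down_edge c i)"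
      using edge_at_label[OF c r ones_vertex i \<alpha> down_edge[OF c i]] i ri by (simp add: prod_eq_iff)
    then show ?thesis
      using partial_potential_flip[where c = c and r = r and i = i and k = "dm c" and e = e, OF c i ri] i
      by (simp add: potential_def)
  qed
  show ?thesis
  proof (cases "r i = 1")
    case True
    then show ?thesis
      by (rule up[OF r \<alpha>])
  next
    case False
    then have "flip r i i = 1"
      using r i by (auto simp: cube_vertices_iff)
    from up[OF flip_vertex[OF r i] edge_at_rev[OF \<alpha> r i] this, of "A \<alpha> e"] show ?thesis
      by simp
  qed
qed

lemma partial_potential_action:
  "bij (partial_potential c r k)" "length (fst (partial_potential c r k e)) = length (fst e)"
  "partial_potential c r k (translate j e) = translate j (partial_potential c r k e)"
proof -
  show "bij (partial_potential c r k)"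
  proof (induction k)
    case 0
    have "partial_potential c r 0 = id"
      by (simp add: fun_eq_iff)
    then show ?case by (simp only: bij_id)
  next
    case (Suc k)
    have "partial_potential c r (Suc k) = partial_potential c r k \<circ> (if r k = 0 then id else A (down_edge c k))"
      by (simp add: fun_eq_iff)
    moreover have "bij (if r k = 0 then id else A (down_edge c k))"
      using bij_letter_act[OF action] by (simp only: bij_id split: if_split) simp
    ultimately show ?case
      using Suc by (simp only: bij_comp)
  qed
  show "length (fst (partial_potential c r k e)) = length (fst e)"
    by (induction k arbitrary: e) (simp_all add: letter_act_length[OF action])
  show "partial_potential c r k (translate j e) = translate j (partial_potential c r k e)"
    by (induction k arbitrary: e) (simp_all add: letter_act_translate[OF action])
qed

text \<open>
  A potential is determined up to a constant by the labels of the edges of a cube.  Hence the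
  potentials of a cube and of its face differ by a constant on the corners of the face.
\<close>
lemma potential_face:
  assumes f: "is_face X d c s b a" and c: "c \<in> cells X"
    and r: "r \<in> cube_vertices (dm d)" "r' \<in> cube_vertices (dm d)"
  shows "potential c (face_emb (dm d) (dm c) s b a r) e = potential c (face_emb (dm d) (dm c) s b a r') e' \<longleftrightarrow>
    potential d r e = potential d r' e'"
proof -
  interpret F: face_parameters "dm d" "dm c" s b a
    using f by (simp add: is_face_def)
  have d: "d \<in> cells X"
    using f by (simp add: is_face_def)
  have bij: "bij (potential c q)" for c q
    by (simp add: potential_def partial_potential_action(1))
  define \<kappa> where "\<kappa> = potential c (F.emb r) \<circ> inv_into UNIV (potential d r)"
  have \<kappa>_bij: "bij \<kappa>"
    unfolding \<kappa>_def using bij by (intro bij_comp bij_imp_bij_inv) auto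
  have \<kappa>: "\<forall>e. potential c (F.emb q) e = \<kappa> (potential d q e)" if "q \<in> cube_vertices (dm d)" for q
  proof (rule cube_vertices_induct[OF r(1) that])
    show "\<forall>e. potential c (F.emb r) e = \<kappa> (potential d r e)"
      using bij by (simp add: \<kappa>_def bij_is_inj)
    fix q i assume q: "q \<in> cube_vertices (dm d)" "i < dm d"
      and IH: "\<forall>e. potential c (F.emb q) e = \<kappa> (potential d q e)"
    obtain \<alpha> where \<alpha>: "edge_at X d q i \<alpha>"
      using edge_at_exists[OF d q] by blast
    then have \<alpha>': "edge_at X c (F.emb q) (s i) \<alpha>"
      using edge_at_face[OF f q] by simp
    show "\<forall>e. potential c (F.emb (flip q i)) e = \<kappa> (potential d (flip q i) e)"
    proof
      fix e
      have "potential c (F.emb q) (A (rev_edge \<alpha>) e) = potential c (flip (F.emb q) (s i)) e"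
        using potential_edge[OF c F.emb_vertex[OF q(1)] F.s_less[OF q(2)] \<alpha>'] by simp
      moreover have "potential d q (A (rev_edge \<alpha>) e) = potential d (flip q i) e"
        using potential_edge[OF d q \<alpha>] by simp
      ultimately show "potential c (F.emb (flip q i)) e = \<kappa> (potential d (flip q i) e)"
        using IH F.emb_flip[OF q] by metis
    qed
  qed
  show ?thesis
    unfolding spec[OF \<kappa>[OF r(1)], of e] spec[OF \<kappa>[OF r(2)], of e']
    using bij_is_inj[OF \<kappa>_bij] by (rule inj_eq)
qed

text \<open>
  The fibre over a point is described relative to the corner \<open>0\<close> of the carrier.  In the
  trivialisation over the star of \<open>v\<close> it is described relative to \<open>v\<close>, and the potential of the
  corner \<open>v\<close> translates between the two.
\<close>
definition gluing :: "'a \<Rightarrow> 'a \<Rightarrow> bool list \<times> int \<Rightarrow> bool list \<times> int" where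
  "gluing v x = potential (cell_of x) (corner_of v x)"

lemma gluing_cube:
  assumes c: "c \<in> cells X" and u: "u \<in> cube (dm c)"
    and p: "p \<in> cube_vertices (dm c)" "near (dm c) u p" and q: "q \<in> cube_vertices (dm c)" "near (dm c) u q"
  shows "gluing (cmap X c p) (cmap X c u) e = gluing (cmap X c q) (cmap X c u) e' \<longleftrightarrow>
    potential c p e = potential c q e'"
proof -
  let ?x = "cmap X c u"
  obtain s b a where f: "is_face X (cell_of ?x) c s b a" and x: "?x \<in> topspace T"
    and emb: "face_emb (dm (cell_of ?x)) (dm c) s b a (coord_of ?x) = u"
    using carrier_exists[OF c u] by (elim exE conjE)
  have st: "?x \<in> star (cmap X c p)" "?x \<in> star (cmap X c q)"
    using star_iff[OF c u] p q by blast+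
  show ?thesis
    using potential_face[OF f c corner_of(1)[OF st(1)] corner_of(1)[OF st(2)], of e e']
      corner_of_carrier[OF c u p f emb] corner_of_carrier[OF c u q f emb]
    by (simp add: gluing_def)
qed

definition fibre :: "(bool list \<times> int) set" where
  "fibre = {e. length (fst e) = n}"

lemma gluing_action:
  "bij (gluing v x)" "length (fst (gluing v x e)) = length (fst e)"
  "gluing v x (translate j e) = translate j (gluing v x e)"
  by (simp_all add: gluing_def potential_def partial_potential_action)

text \<open>
  The transition between two stars is locally constant: in a cell, it only depends on the corners
  at the two vertices.
\<close>
lemma openin_gluing_eq: "openin T {x \<in> star v \<inter> star w. gluing v x e = gluing w x e'}"
  unfolding openin_iff
proof (intro conjI ballI)
  show "{x \<in> star v \<inter> star w. gluing v x e = gluing w x e'} \<subseteq> topspace T"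
    using star_subset by blast
  fix c assume c: "c \<in> cells X"
  let ?N = "\<lambda>p. {u \<in> cube (dm c). near (dm c) u p}"
  let ?P = "{(p, q). p \<in> cube_vertices (dm c) \<and> q \<in> cube_vertices (dm c) \<and> cmap X c p = v \<and> cmap X c q = w \<and>
    potential c p e = potential c q e'}"
  have "{u \<in> cube (dm c). cmap X c u \<in> {x \<in> star v \<inter> star w. gluing v x e = gluing w x e'}} =
      (\<Union>(p, q)\<in>?P. ?N p \<inter> ?N q)"
  proof (intro equalityI subsetI)
    fix u assume "u \<in> {u \<in> cube (dm c). cmap X c u \<in> {x \<in> star v \<inter> star w. gluing v x e = gluing w x e'}}"
    then have u: "u \<in> cube (dm c)" "cmap X c u \<in> star v" "cmap X c u \<in> star w"
      "gluing v (cmap X c u) e = gluing w (cmap X c u) e'"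
      by auto
    obtain p where p: "p \<in> cube_vertices (dm c)" "near (dm c) u p" "cmap X c p = v"
      using star_iff[OF c u(1)] u(2) by blast
    obtain q where q: "q \<in> cube_vertices (dm c)" "near (dm c) u q" "cmap X c q = w"
      using star_iff[OF c u(1)] u(3) by blast
    have "potential c p e = potential c q e'"
      using gluing_cube[OF c u(1) p(1,2) q(1,2)] u(4) p(3) q(3) by simp
    then show "u \<in> (\<Union>(p, q)\<in>?P. ?N p \<inter> ?N q)"
      using u(1) p q by blast
  next
    fix u assume "u \<in> (\<Union>(p, q)\<in>?P. ?N p \<inter> ?N q)"
    then obtain p q where u: "u \<in> cube (dm c)" and p: "p \<in> cube_vertices (dm c)" "near (dm c) u p" "cmap X c p = v"
      and q: "q \<in> cube_vertices (dm c)" "near (dm c) u q" "cmap X c q = w" and "potential c p e = potential c q e'"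
      by blast
    then have "gluing v (cmap X c u) e = gluing w (cmap X c u) e'"
      using gluing_cube[OF c u p(1,2) q(1,2)] by simp
    then show "u \<in> {u \<in> cube (dm c). cmap X c u \<in> {x \<in> star v \<inter> star w. gluing v x e = gluing w x e'}}"
      using star_iff[OF c u] p q u by blast
  qed
  moreover have "openin (cube_top (dm c)) (\<Union>(p, q)\<in>?P. ?N p \<inter> ?N q)"
    by (rule openin_Union) (auto intro!: openin_Int openin_near)
  ultimately show "openin (cube_top (dm c))
      {u \<in> cube (dm c). cmap X c u \<in> {x \<in> star v \<inter> star w. gluing v x e = gluing w x e'}}"
    by simp
qed

sublocale covering: transition_cover T star gluing fibre
proof
  show "bij_betw (gluing v x) fibre fibre" if "x \<in> star v" for v x
  proof -
    have "gluing v x ` fibre = fibre"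
    proof (intro equalityI subsetI)
      fix e assume e: "e \<in> fibre"
      obtain e' where e': "e = gluing v x e'"
        using gluing_action(1) by (metis bij_pointE)
      then show "e \<in> gluing v x ` fibre"
        using e gluing_action(2)[of v x e'] by (simp add: fibre_def)
    qed (auto simp: fibre_def gluing_action(2))
    then show ?thesis
      using gluing_action(1)[of v x] by (simp add: bij_betw_def inj_on_subset[of _ UNIV])
  qed
  have "(replicate n True, 0) \<in> fibre"
    by (simp add: fibre_def)
  then show "fibre \<noteq> {}"
    by blast
  show "\<exists>v. x \<in> star v" if "x \<in> topspace T" for x
    using in_some_star[OF that] by blast
qed (rule openin_star openin_gluing_eq)+

subsection \<open>Lifts of edges\<close>

lemma gluing_vertex:
  assumes "v \<in> vertex_points"
  shows "gluing v v e = e"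
proof -
  obtain c p where c: "c \<in> cells X" "p \<in> cube_vertices (dm c)" "v = cmap X c p"
    using assms by (auto simp: vertex_points_def)
  obtain s b a where f: "is_face X (cell_of v) c s b a" and x: "v \<in> topspace T"
    and emb: "face_emb (dm (cell_of v)) (dm c) s b a (coord_of v) = p"
    using carrier_exists[OF c(1) cube_vertices_subset[OF c(2)]] c(3) by (elim exE conjE) simp
  interpret F: face_parameters "dm (cell_of v)" "dm c" s b a
    using f by (simp add: is_face_def)
  have "dm (cell_of v) = 0"
  proof (rule ccontr)
    assume pos: "dm (cell_of v) \<noteq> 0"
    have "p (s 0) = 0 \<or> p (s 0) = 1"
      using c(2) F.s_less[of 0] pos by (simp add: cube_vertices_iff)
    moreover from pos have "p (s 0) = (if b 0 then 1 - coord_of v 0 else coord_of v 0)" "s 0 < dm c"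
      "0 < coord_of v 0" "coord_of v 0 < 1"
      using F.emb_on[of 0 "coord_of v"] emb F.s_less[of 0] cell_of(2)[OF x] by (simp_all add: open_cube_iff)
    ultimately show False
      by (cases "b 0") auto
  qed
  then show ?thesis
    by (simp add: gluing_def potential_def)
qed

lemma lifts_to_contract:
  assumes "x \<in> star v" "e \<in> fibre"
  shows "lifts_to covering.total fst (contract v x) (x, gluing v x e) (v, e)"
  using covering.lifts_to_section[OF pathin_contract[OF assms(1)] contract_ends(3)[OF assms(1)] assms(2)]
    contract_ends(1,2)[OF assms(1)] gluing_vertex[OF star_vertex[OF assms(1)]] by simp

end

context cube_cx
begin

lemma pathin_edge_path:
  assumes "\<alpha> \<in> oriented_edges X"
  shows "pathin T (edge_path X \<alpha>)"
proof -
  obtain e b where ab: "\<alpha> = (e, b)"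
    by fastforce
  then have e: "e \<in> cells X" "dm e = 1"
    using assms by (auto simp: oriented_edges_def edges_def)
  have "continuous_map I01 (cube_top (dm e)) (\<lambda>t. \<lambda>i\<in>{..<1}. if b then t else 1 - t)"
    by (rule continuous_map_into_cube) (auto simp: e(2) cube_iff intro!: continuous_intros)
  then have "pathin T (cmap X e \<circ> (\<lambda>t. \<lambda>i\<in>{..<1}. if b then t else 1 - t))"
    unfolding pathin_def using continuous_map_cmap[OF e(1)] by (rule continuous_map_compose)
  then show ?thesis
    by (simp add: ab edge_path_def o_def)
qed

lemma edge_path_in_star:
  assumes "\<alpha> \<in> oriented_edges X" "t \<in> {0..1}"
  shows "t < 1 \<Longrightarrow> edge_path X \<alpha> t \<in> star (initial X \<alpha>)" "0 < t \<Longrightarrow> edge_path X \<alpha> t \<in> star (terminal X \<alpha>)"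
proof -
  have *: "edge_path X \<alpha> t \<in> star (initial X \<alpha>)" if \<alpha>: "\<alpha> \<in> oriented_edges X" and t: "0 \<le> t" "t < 1" for \<alpha> t
  proof -
    obtain e b where ab: "\<alpha> = (e, b)"
      by fastforce
    then have e: "e \<in> cells X" "dm e = 1"
      using \<alpha> by (auto simp: oriented_edges_def edges_def)
    let ?u = "\<lambda>t. \<lambda>i\<in>{..<1::nat}. if b then t else 1 - t :: real"
    have "?u t \<in> cube (dm e)" "?u 0 \<in> cube_vertices (dm e)" "near (dm e) (?u t) (?u 0)"
      using t by (auto simp: e(2) cube_iff cube_vertices_iff near_def)
    then have "cmap X e (?u t) \<in> star (cmap X e (?u 0))"
      using star_iff[OF e(1)] by blast
    then show ?thesis
      by (simp add: ab edge_path_def initial_def)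
  qed
  show "t < 1 \<Longrightarrow> edge_path X \<alpha> t \<in> star (initial X \<alpha>)"
    using * assms by simp
  show "0 < t \<Longrightarrow> edge_path X \<alpha> t \<in> star (terminal X \<alpha>)"
    using *[of "rev_edge \<alpha>" "1 - t"] assms by (simp add: edge_path_rev)
qed

end

context acted_cx
begin

text \<open>
  An edge lies in the star of its initial vertex up to its end, and in the star of its terminal
  vertex from its beginning on; the lift changes the trivialisation in the middle.
\<close>
lemma lifts_to_edge:
  assumes \<alpha>: "\<alpha> \<in> oriented_edges X" and e: "e \<in> fibre"
  shows "lifts_to covering.total fst (edge_path X \<alpha>) (initial X \<alpha>, e) (terminal X \<alpha>, A \<alpha> e)"
proof -
  let ?v = "initial X \<alpha>" and ?w = "terminal X \<alpha>" and ?x = "edge_path X \<alpha> (1/2)"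
  obtain f b where ab: "\<alpha> = (f, b)"
    by fastforce
  then have f: "f \<in> cells X" "dm f = 1"
    using \<alpha> by (auto simp: oriented_edges_def edges_def)
  have Ae: "A \<alpha> e \<in> fibre"
    using e by (simp add: fibre_def letter_act_length[OF action])
  let ?p = "\<lambda>i\<in>{..<1::nat}. if b then 0 else 1 :: real" and ?u = "\<lambda>i\<in>{..<1::nat}. 1/2 :: real"
  have p: "?p \<in> cube_vertices (dm f)" "flip ?p 0 \<in> cube_vertices (dm f)" and u: "?u \<in> cube (dm f)"
    and near: "near (dm f) ?u ?p" "near (dm f) ?u (flip ?p 0)"
    by (auto simp: f(2) cube_vertices_iff cube_iff near_def flip_def extensional_def)
  have edge: "edge_at X f ?p 0 \<alpha>"
    using edge_at_edge \<alpha> ab by blast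
  have ends: "?v = cmap X f ?p" "?w = cmap X f (flip ?p 0)"
    using edge_at_initial[OF edge p(1)] edge_at_terminal[OF edge p(1)] f(2) by simp_all
  have "(\<lambda>i\<in>{..<1::nat}. if b then 1/2 else 1 - 1/2) = ?u"
    by (auto simp: fun_eq_iff)
  then have mid: "?x = cmap X f ?u"
    by (simp add: ab edge_path_def)
  have "gluing ?v ?x e = gluing ?w ?x (A \<alpha> e)"
    unfolding ends mid using gluing_cube[OF f(1) u p(1) near(1) p(2) near(2)]
      potential_edge[OF f(1) p(1) _ edge] f(2) by simp
  moreover have "?v \<in> vertex_points" "?w \<in> vertex_points"
    using ends f(1) p unfolding vertex_points_def by blast+
  then have "gluing ?v ?v e = e" "gluing ?w ?w (A \<alpha> e) = A \<alpha> e"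
    by (simp_all add: gluing_vertex)
  moreover have "path_part (edge_path X \<alpha>) 0 (1/2) 0 = ?v" "path_part (edge_path X \<alpha>) (1/2) 1 1 = ?w"
    by (simp_all add: initial_def terminal_def)
  moreover have "lifts_to covering.total fst (path_part (edge_path X \<alpha>) 0 (1/2))
      (path_part (edge_path X \<alpha>) 0 (1/2) 0, gluing ?v (path_part (edge_path X \<alpha>) 0 (1/2) 0) e)
      (path_part (edge_path X \<alpha>) 0 (1/2) 1, gluing ?v (path_part (edge_path X \<alpha>) 0 (1/2) 1) e)"
    using edge_path_in_star(1)[OF \<alpha>]
    by (intro covering.lifts_to_section e pathin_part pathin_edge_path \<alpha>) (auto simp: path_part_def)
  moreover have "lifts_to covering.total fst (path_part (edge_path X \<alpha>) (1/2) 1)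
      (path_part (edge_path X \<alpha>) (1/2) 1 0, gluing ?w (path_part (edge_path X \<alpha>) (1/2) 1 0) (A \<alpha> e))
      (path_part (edge_path X \<alpha>) (1/2) 1 1, gluing ?w (path_part (edge_path X \<alpha>) (1/2) 1 1) (A \<alpha> e))"
    using edge_path_in_star(2)[OF \<alpha>]
    by (intro covering.lifts_to_section Ae pathin_part pathin_edge_path \<alpha>) (auto simp: path_part_def)
  ultimately have "lifts_to covering.total fst
      (path_concat (path_part (edge_path X \<alpha>) 0 (1/2)) (path_part (edge_path X \<alpha>) (1/2) 1)) (?v, e) (?w, A \<alpha> e)"
    by (intro lifts_to_concat[of _ _ _ _ "(?x, gluing ?v ?x e)"]) simp_all
  moreover have "path_concat (path_part (edge_path X \<alpha>) 0 (1/2)) (path_part (edge_path X \<alpha>) (1/2) 1) = edge_path X \<alpha>"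
    by (auto simp: path_concat_def path_part_def fun_eq_iff field_simps)
  ultimately show ?thesis
    by simp
qed

end

section \<open>Edge paths\<close>

context cube_cx
begin

fun walk :: "'a \<Rightarrow> ('c \<times> bool) list \<Rightarrow> 'a \<Rightarrow> bool" where
  "walk v [] w \<longleftrightarrow> v = w"
| "walk v (\<alpha> # \<omega>) w \<longleftrightarrow> \<alpha> \<in> oriented_edges X \<and> initial X \<alpha> = v \<and> walk (terminal X \<alpha>) \<omega> w"

fun walk_path :: "'a \<Rightarrow> ('c \<times> bool) list \<Rightarrow> real \<Rightarrow> 'a" where
  "walk_path v [] = (\<lambda>_. v)"
| "walk_path v (\<alpha> # \<omega>) = path_concat (edge_path X \<alpha>) (walk_path (terminal X \<alpha>) \<omega>)"

lemma edge_path_ends [simp]: "edge_path X \<alpha> 0 = initial X \<alpha>" "edge_path X \<alpha> 1 = terminal X \<alpha>"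
  by (simp_all add: initial_def terminal_def)

lemma edge_ends_in: "\<alpha> \<in> oriented_edges X \<Longrightarrow> initial X \<alpha> \<in> topspace T" "\<alpha> \<in> oriented_edges X \<Longrightarrow> terminal X \<alpha> \<in> topspace T"
  using pathin_in_topspace[OF pathin_edge_path, of \<alpha> 0] pathin_in_topspace[OF pathin_edge_path, of \<alpha> 1] by simp_all

lemma walk_path:
  assumes "walk v \<omega> w" "v \<in> topspace T"
  shows "walk_path v \<omega> 0 = v" "walk_path v \<omega> 1 = w" "pathin T (walk_path v \<omega>)" "w \<in> topspace T"
proof -
  have "walk_path v \<omega> 0 = v \<and> walk_path v \<omega> 1 = w \<and> pathin T (walk_path v \<omega>) \<and> w \<in> topspace T"
    using assms
  proof (induction \<omega> arbitrary: v)
    case (Cons \<alpha> \<omega>)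
    then have "walk_path (terminal X \<alpha>) \<omega> 0 = terminal X \<alpha>" "walk_path (terminal X \<alpha>) \<omega> 1 = w"
      "pathin T (walk_path (terminal X \<alpha>) \<omega>)" "w \<in> topspace T"
      using Cons.IH[of "terminal X \<alpha>"] edge_ends_in by simp_all
    then show ?case
      using Cons.prems pathin_edge_path by (simp add: pathin_concat)
  qed simp
  then show "walk_path v \<omega> 0 = v" "walk_path v \<omega> 1 = w" "pathin T (walk_path v \<omega>)" "w \<in> topspace T"
    by simp_all
qed

lemma walk_append:
  assumes "walk v \<omega> u" "walk u \<omega>' w" "v \<in> topspace T"
  shows "walk v (\<omega> @ \<omega>') w"
    "path_homotopic T (path_concat (walk_path v \<omega>) (walk_path u \<omega>')) (walk_path v (\<omega> @ \<omega>'))"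
proof -
  have "walk v (\<omega> @ \<omega>') w \<and>
    path_homotopic T (path_concat (walk_path v \<omega>) (walk_path u \<omega>')) (walk_path v (\<omega> @ \<omega>'))"
    using assms
  proof (induction \<omega> arbitrary: v)
    case Nil
    then have u: "v = u" "u \<in> topspace T"
      by simp_all
    then have "path_homotopic T (path_concat (\<lambda>_. walk_path u \<omega>' 0) (walk_path u \<omega>')) (walk_path u \<omega>')"
      using walk_path[OF Nil(2)] by (intro path_concat_const_left) simp
    then show ?case
      using Nil u walk_path(1)[OF Nil(2) u(2)] by simp
  next
    case (Cons \<alpha> \<omega>)
    let ?W = "walk_path (terminal X \<alpha>) \<omega>" and ?W' = "walk_path u \<omega>'" and ?e = "edge_path X \<alpha>"
    have \<alpha>: "\<alpha> \<in> oriented_edges X" "initial X \<alpha> = v" "walk (terminal X \<alpha>) \<omega> u" "terminal X \<alpha> \<in> topspace T"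
      using Cons.prems edge_ends_in by simp_all
    note W = walk_path[OF \<alpha>(3,4)]
    note W' = walk_path[OF Cons.prems(2) W(4)]
    have IH: "walk (terminal X \<alpha>) (\<omega> @ \<omega>') w"
      "path_homotopic T (path_concat ?W ?W') (walk_path (terminal X \<alpha>) (\<omega> @ \<omega>'))"
      using Cons.IH[OF \<alpha>(3) Cons.prems(2) \<alpha>(4)] by simp_all
    have "path_homotopic T (path_concat (path_concat ?e ?W) ?W') (path_concat ?e (path_concat ?W ?W'))"
      using W W' pathin_edge_path[OF \<alpha>(1)] by (intro path_concat_assoc) simp_all
    also have "path_homotopic T (path_concat ?e (path_concat ?W ?W')) (path_concat ?e (walk_path (terminal X \<alpha>) (\<omega> @ \<omega>')))"
      using W by (intro path_homotopic_concat path_homotopic_refl pathin_edge_path \<alpha>(1) IH(2)) simp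
    finally show ?case
      using \<alpha> IH(1) by simp
  qed
  then show "walk v (\<omega> @ \<omega>') w"
    "path_homotopic T (path_concat (walk_path v \<omega>) (walk_path u \<omega>')) (walk_path v (\<omega> @ \<omega>'))"
    by simp_all
qed

definition side :: "(nat \<Rightarrow> real) \<Rightarrow> nat \<Rightarrow> real \<Rightarrow> nat \<Rightarrow> real" where
  "side p i t = p(i := \<bar>p i - t\<bar>)"

lemma edge_path_side: "edge_at X c p i \<alpha> \<Longrightarrow> t \<in> {0..1} \<Longrightarrow> edge_path X \<alpha> t = cmap X c (side p i t)"
  by (simp add: edge_at_def side_def)

lemma side:
  assumes p: "p \<in> cube_vertices n" and i: "i < n"
  shows "side p i 0 = p" "side p i 1 = flip p i" "pathin (cube_top n) (side p i)"
proof -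
  have pi: "p i = 0 \<or> p i = 1"
    using p i by (simp add: cube_vertices_iff)
  then show "side p i 0 = p" "side p i 1 = flip p i"
    by (auto simp: side_def flip_def fun_eq_iff)
  show "pathin (cube_top n) (side p i)"
    unfolding pathin_def
  proof (rule continuous_map_into_cube)
    show "side p i t \<in> cube n" if "t \<in> topspace I01" for t
      using that p pi i by (auto simp: side_def cube_iff cube_vertices_iff extensional_def)
    show "continuous_map I01 euclideanreal (\<lambda>t. side p i t j)" for j
      by (cases "j = i") (auto simp: side_def intro!: continuous_intros)
  qed
qed

lemma cube_walk:
  assumes c: "c \<in> cells X" and p: "p \<in> cube_vertices (dm c)" and q: "q \<in> cube_vertices (dm c)"
  shows "\<exists>\<omega> f. walk (cmap X c p) \<omega> (cmap X c q) \<and> pathin (cube_top (dm c)) f \<and> f 0 = p \<and> f 1 = q \<and>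
    (\<forall>t\<in>{0..1}. walk_path (cmap X c p) \<omega> t = cmap X c (f t))"
proof (rule cube_vertices_induct[OF q p])
  have "q \<in> cube (dm c)"
    using q by (rule cube_vertices_subset)
  then show "\<exists>\<omega> f. walk (cmap X c q) \<omega> (cmap X c q) \<and> pathin (cube_top (dm c)) f \<and> f 0 = q \<and> f 1 = q \<and>
      (\<forall>t\<in>{0..1}. walk_path (cmap X c q) \<omega> t = cmap X c (f t))"
    by (intro exI[of _ "[]"] exI[of _ "\<lambda>_. q"]) simp
  fix r j assume r: "r \<in> cube_vertices (dm c)" "j < dm c"
  assume "\<exists>\<omega> f. walk (cmap X c r) \<omega> (cmap X c q) \<and> pathin (cube_top (dm c)) f \<and> f 0 = r \<and> f 1 = q \<and>
      (\<forall>t\<in>{0..1}. walk_path (cmap X c r) \<omega> t = cmap X c (f t))"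
  then obtain \<omega> f where \<omega>: "walk (cmap X c r) \<omega> (cmap X c q)"
    and f: "pathin (cube_top (dm c)) f" "f 0 = r" "f 1 = q"
    and eq: "\<forall>t\<in>{0..1}. walk_path (cmap X c r) \<omega> t = cmap X c (f t)"
    by blast
  have r': "flip r j \<in> cube_vertices (dm c)"
    by (rule flip_vertex[OF r])
  obtain \<alpha> where \<alpha>: "edge_at X c (flip r j) j \<alpha>"
    using edge_at_exists[OF c r' r(2)] by blast
  have ends: "initial X \<alpha> = cmap X c (flip r j)" "terminal X \<alpha> = cmap X c r"
    using edge_at_initial[OF \<alpha> r' r(2)] edge_at_terminal[OF \<alpha> r' r(2)] by simp_all
  have or: "\<alpha> \<in> oriented_edges X"
    using \<alpha> by (simp add: edge_at_def)
  note s = side[OF r' r(2)]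
  show "\<exists>\<omega> f. walk (cmap X c (flip r j)) \<omega> (cmap X c q) \<and> pathin (cube_top (dm c)) f \<and> f 0 = flip r j \<and> f 1 = q \<and>
      (\<forall>t\<in>{0..1}. walk_path (cmap X c (flip r j)) \<omega> t = cmap X c (f t))"
  proof (intro exI[of _ "\<alpha> # \<omega>"] exI[of _ "path_concat (side (flip r j) j) f"] conjI ballI)
    show "walk (cmap X c (flip r j)) (\<alpha> # \<omega>) (cmap X c q)"
      using \<omega> or ends by simp
    show "pathin (cube_top (dm c)) (path_concat (side (flip r j) j) f)"
      using s f by (intro pathin_concat) simp_all
    show "walk_path (cmap X c (flip r j)) (\<alpha> # \<omega>) t = cmap X c (path_concat (side (flip r j) j) f t)"
      if "t \<in> {0..1}" for t
      using that eq edge_path_side[OF \<alpha>] ends by (simp add: path_concat_def)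
  qed (use s f in simp_all)
qed

end

context special_cx
begin

lemma contract_change:
  assumes v: "x \<in> star v" and w: "x \<in> star w"
  shows "\<exists>\<omega>. walk v \<omega> w \<and> path_homotopic T (contract w x) (path_concat (contract v x) (walk_path v \<omega>))"
proof -
  have x: "x \<in> topspace T"
    using v star_subset by blast
  let ?c = "cell_of x" and ?u = "coord_of x" and ?p = "corner_of v x" and ?q = "corner_of w x"
  have c: "?c \<in> cells X" and u: "?u \<in> cube (dm ?c)"
    using cell_of[OF x] open_cube_subset by simp_all
  note p = corner_of[OF v] and q = corner_of[OF w]
  obtain \<omega> f where \<omega>: "walk (cmap X ?c ?p) \<omega> (cmap X ?c ?q)" and f: "pathin (cube_top (dm ?c)) f" "f 0 = ?p" "f 1 = ?q"
    and eq: "\<forall>t\<in>{0..1}. walk_path (cmap X ?c ?p) \<omega> t = cmap X ?c (f t)"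
    using cube_walk[OF c p(1) q(1)] by blast
  have l: "pathin (cube_top (dm ?c)) (\<lambda>t. lerp (dm ?c) t ?u r)" if "r \<in> cube_vertices (dm ?c)" for r
    unfolding pathin_def using u cube_vertices_subset[OF that] by (intro continuous_map_lerp) auto
  have r: "lerp (dm ?c) 0 ?u ?p = ?u" "lerp (dm ?c) 0 ?u ?q = ?u" "lerp (dm ?c) 1 ?u ?p = ?p" "lerp (dm ?c) 1 ?u ?q = ?q"
    using u p q by (simp_all add: lerp_ends cube_vertices_subset)
  let ?g = "path_concat (\<lambda>t. lerp (dm ?c) t ?u ?p) f"
  have "path_homotopic (cube_top (dm ?c)) (\<lambda>t. lerp (dm ?c) t ?u ?q) ?g"
    using l[OF q(1)] l[OF p(1)] f r by (intro path_homotopic_cube pathin_concat) simp_all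
  from path_homotopic_image[OF this continuous_map_cmap[OF c]]
  have 1: "path_homotopic T (contract w x) (cmap X ?c \<circ> ?g)"
    by (simp add: contract_def[abs_def] o_def)
  moreover have "path_homotopic T (cmap X ?c \<circ> ?g) (path_concat (contract v x) (walk_path v \<omega>))"
    by (rule path_homotopic_eq[OF path_homotopic_imp(2)[OF 1]])
      (use eq p in \<open>auto simp: path_concat_def contract_def\<close>)
  ultimately have "path_homotopic T (contract w x) (path_concat (contract v x) (walk_path v \<omega>))"
    by (rule path_homotopic_trans)
  then show ?thesis
    using \<omega> p q by auto
qed

text \<open>
  Every path is homotopic to an edge path, up to the contractions at its ends: subdivide it into
  parts that lie in stars.
\<close>
lemma path_to_walk:
  assumes \<sigma>: "pathin T \<sigma>" and "\<sigma> 0 \<in> star v" "\<sigma> 1 \<in> star w"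
  shows "\<exists>\<omega>. walk v \<omega> w \<and>
    path_homotopic T (path_concat \<sigma> (contract w (\<sigma> 1))) (path_concat (contract v (\<sigma> 0)) (walk_path v \<omega>))"
proof -
  define P where "P a b \<longleftrightarrow> (0 \<le> a \<longrightarrow> a \<le> b \<longrightarrow> b \<le> 1 \<longrightarrow>
    (\<forall>v w. \<sigma> a \<in> star v \<longrightarrow> \<sigma> b \<in> star w \<longrightarrow> (\<exists>\<omega>. walk v \<omega> w \<and>
    path_homotopic T (path_concat (path_part \<sigma> a b) (contract w (\<sigma> b)))
      (path_concat (contract v (\<sigma> a)) (walk_path v \<omega>)))))" for a b
  have vT: "v \<in> topspace T" if "x \<in> star v" for x v
    using contract_ends(2)[OF that] contract_ends(3)[OF that, of 1] star_subset by force
  note arc = pathin_contract contract_ends(1,2)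
  have "P 0 1"
  proof (rule Bolzano)
    fix a b c assume ab: "P a b" and bc: "P b c" and le: "a \<le> b" "b \<le> c"
    show "P a c"
      unfolding P_def
    proof (intro impI allI)
      fix v w assume ac: "0 \<le> a" "c \<le> 1" and v: "\<sigma> a \<in> star v" and w: "\<sigma> c \<in> star w"
      have b: "0 \<le> b" "b \<le> 1"
        using ac le by simp_all
      then obtain u where u: "\<sigma> b \<in> star u"
        using in_some_star[OF pathin_in_topspace[OF \<sigma>, of b]] by auto
      obtain \<omega>1 where 1: "walk v \<omega>1 u" "path_homotopic T (path_concat (path_part \<sigma> a b) (contract u (\<sigma> b)))
          (path_concat (contract v (\<sigma> a)) (walk_path v \<omega>1))"
        using ab ac le b v u unfolding P_def by blast
      obtain \<omega>2 where 2: "walk u \<omega>2 w" "path_homotopic T (path_concat (path_part \<sigma> b c) (contract w (\<sigma> c)))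
          (path_concat (contract u (\<sigma> b)) (walk_path u \<omega>2))"
        using bc ac le b w u unfolding P_def by blast
      let ?S1 = "path_part \<sigma> a b" and ?S2 = "path_part \<sigma> b c" and ?cv = "contract v (\<sigma> a)"
        and ?cu = "contract u (\<sigma> b)" and ?cw = "contract w (\<sigma> c)" and ?W1 = "walk_path v \<omega>1" and ?W2 = "walk_path u \<omega>2"
      have S: "pathin T ?S1" "pathin T ?S2"
        using \<sigma> ac le b by (auto intro: pathin_part)
      note W1 = walk_path[OF 1(1) vT[OF v]] and W2 = walk_path[OF 2(1) vT[OF u]]
      note ends = S W1 W2 arc[OF u] arc[OF v] arc[OF w]
      have "path_homotopic T (path_concat (path_part \<sigma> a c) ?cw) (path_concat (path_concat ?S1 ?S2) ?cw)"
        using path_part_concat[OF \<sigma> ac(1) le ac(2)] ends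
        by (intro path_homotopic_concat path_homotopic_refl) simp_all
      also have "path_homotopic T (path_concat (path_concat ?S1 ?S2) ?cw) (path_concat ?S1 (path_concat ?S2 ?cw))"
        using ends by (intro path_concat_assoc) simp_all
      also have "path_homotopic T (path_concat ?S1 (path_concat ?S2 ?cw)) (path_concat ?S1 (path_concat ?cu ?W2))"
        using ends by (intro path_homotopic_concat path_homotopic_refl 2(2)) simp_all
      also have "path_homotopic T (path_concat ?S1 (path_concat ?cu ?W2)) (path_concat (path_concat ?S1 ?cu) ?W2)"
        using ends by (intro path_homotopic_sym[OF path_concat_assoc]) simp_all
      also have "path_homotopic T (path_concat (path_concat ?S1 ?cu) ?W2) (path_concat (path_concat ?cv ?W1) ?W2)"
        using ends by (intro path_homotopic_concat path_homotopic_refl 1(2)) simp_all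
      also have "path_homotopic T (path_concat (path_concat ?cv ?W1) ?W2) (path_concat ?cv (path_concat ?W1 ?W2))"
        using ends by (intro path_concat_assoc) simp_all
      also have "path_homotopic T (path_concat ?cv (path_concat ?W1 ?W2)) (path_concat ?cv (walk_path v (\<omega>1 @ \<omega>2)))"
        using ends by (intro path_homotopic_concat path_homotopic_refl walk_append(2)[OF 1(1) 2(1) vT[OF v]]) simp_all
      finally show "\<exists>\<omega>. walk v \<omega> w \<and>
          path_homotopic T (path_concat (path_part \<sigma> a c) ?cw) (path_concat ?cv (walk_path v \<omega>))"
        using walk_append(1)[OF 1(1) 2(1) vT[OF v]] by blast
    qed
  next
    fix t0 :: real assume t0: "0 \<le> t0" "t0 \<le> 1"
    then have t0': "t0 \<in> {0..1}"
      by simp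
    obtain u where u: "\<sigma> t0 \<in> star u"
      using in_some_star[OF pathin_in_topspace[OF \<sigma> t0']] by blast
    obtain e where e: "e > 0" "\<And>t. t \<in> {0..1} \<Longrightarrow> dist t t0 < e \<Longrightarrow> \<sigma> t \<in> star u"
      by (rule continuous_map_metric_nbhd[OF \<sigma>[unfolded pathin_def] t0' openin_star u], rule that)
    have "P a b" if ab: "a \<le> t0" "t0 \<le> b" "b - a < e" for a b
      unfolding P_def
    proof (intro impI allI)
      fix v w assume ac: "0 \<le> a" "a \<le> b" "b \<le> 1" and v: "\<sigma> a \<in> star v" and w: "\<sigma> b \<in> star w"
      have in_u: "\<sigma> t \<in> star u" if "t \<in> {a..b}" for t
      proof (rule e(2))
        have "\<bar>t - t0\<bar> \<le> b - a"
          using that ab(1,2) by (simp add: abs_le_iff)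
        then show "dist t t0 < e"
          using ab(3) by (simp add: dist_real_def)
      qed (use that ac in auto)
      have ua: "\<sigma> a \<in> star u" and ub: "\<sigma> b \<in> star u"
        using in_u ac(2) by simp_all
      obtain \<omega>1 where 1: "walk v \<omega>1 u" "path_homotopic T (contract u (\<sigma> a)) (path_concat (contract v (\<sigma> a)) (walk_path v \<omega>1))"
        using contract_change[OF v ua] by blast
      obtain \<omega>2 where 2: "walk u \<omega>2 w" "path_homotopic T (contract w (\<sigma> b)) (path_concat (contract u (\<sigma> b)) (walk_path u \<omega>2))"
        using contract_change[OF ub w] by blast
      let ?S = "path_part \<sigma> a b" and ?cv = "contract v (\<sigma> a)" and ?cu = "contract u (\<sigma> b)"
        and ?cw = "contract w (\<sigma> b)" and ?W1 = "walk_path v \<omega>1" and ?W2 = "walk_path u \<omega>2"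
      have S: "pathin T ?S"
        using \<sigma> ac by (intro pathin_part)
      have "?S s \<in> star u" if "s \<in> {0..1}" for s
        unfolding path_part_def by (rule in_u[OF segment_in_unit(1)[OF ac that]])
      then have Su: "path_homotopic T (path_concat ?S ?cu) (contract u (\<sigma> a))"
        using path_in_star[OF S, of u] by simp
      note W1 = walk_path[OF 1(1) vT[OF v]] and W2 = walk_path[OF 2(1) vT[OF ub]]
      note ends = S W1 W2 arc[OF ua] arc[OF ub] arc[OF v] arc[OF w]
      have "path_homotopic T (path_concat ?S ?cw) (path_concat ?S (path_concat ?cu ?W2))"
        using ends by (intro path_homotopic_concat path_homotopic_refl 2(2)) simp_all
      also have "path_homotopic T (path_concat ?S (path_concat ?cu ?W2)) (path_concat (path_concat ?S ?cu) ?W2)"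
        using ends by (intro path_homotopic_sym[OF path_concat_assoc]) simp_all
      also have "path_homotopic T (path_concat (path_concat ?S ?cu) ?W2) (path_concat (path_concat ?cv ?W1) ?W2)"
        using ends by (intro path_homotopic_concat path_homotopic_refl path_homotopic_trans[OF Su 1(2)]) simp_all
      also have "path_homotopic T (path_concat (path_concat ?cv ?W1) ?W2) (path_concat ?cv (path_concat ?W1 ?W2))"
        using ends by (intro path_concat_assoc) simp_all
      also have "path_homotopic T (path_concat ?cv (path_concat ?W1 ?W2)) (path_concat ?cv (walk_path v (\<omega>1 @ \<omega>2)))"
        using ends by (intro path_homotopic_concat path_homotopic_refl walk_append(2)[OF 1(1) 2(1) vT[OF v]]) simp_all
      finally show "\<exists>\<omega>. walk v \<omega> w \<and> path_homotopic T (path_concat ?S ?cw) (path_concat ?cv (walk_path v \<omega>))"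
        using walk_append(1)[OF 1(1) 2(1) vT[OF v]] by blast
    qed
    then show "\<exists>d>0. \<forall>a b. a \<le> t0 \<and> t0 \<le> b \<and> b - a < d \<longrightarrow> P a b"
      using e(1) by blast
  qed simp
  then show ?thesis
    using assms(2,3) unfolding P_def by simp
qed

subsection \<open>Shortening edge paths\<close>

lemma edge_path_rev_edge: "edge_path X (rev_edge \<alpha>) = path_reverse (edge_path X \<alpha>)"
  by (simp add: fun_eq_iff edge_path_rev path_reverse_def)

lemma swap_edges:
  assumes \<alpha>: "\<alpha> \<in> oriented_edges X" and \<beta>: "\<beta> \<in> oriented_edges X" and "terminal X \<alpha> = initial X \<beta>"
    and cr: "crossing (fst (label \<alpha>)) (fst (label \<beta>))"
  shows "\<exists>\<alpha>' \<beta>'. \<alpha>' \<in> oriented_edges X \<and> \<beta>' \<in> oriented_edges X \<and> initial X \<beta>' = initial X \<alpha> \<and>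
    terminal X \<beta>' = initial X \<alpha>' \<and> terminal X \<alpha>' = terminal X \<beta> \<and> label \<alpha>' = label \<alpha> \<and> label \<beta>' = label \<beta> \<and>
    path_homotopic T (path_concat (edge_path X \<alpha>) (edge_path X \<beta>)) (path_concat (edge_path X \<beta>') (edge_path X \<alpha>'))"
proof -
  have "corner X (rev_edge \<alpha>) \<beta>"
    using crossing_corner[of "rev_edge \<alpha>" \<beta>] assms by (simp add: label_rev)
  then obtain q p i j where q: "q \<in> squares X" and p: "p \<in> cube_vertices 2" and ij: "i < 2" "j < 2" "i \<noteq> j"
    and a: "edge_at X q p i (rev_edge \<alpha>)" and b: "edge_at X q p j \<beta>"
    unfolding corner_def by blast
  have c: "q \<in> cells X" "dm q = 2"
    using q by (auto simp: squares_def)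
  have comm: "flip (flip p i) j = flip (flip p j) i"
    using ij(3) by (auto simp: flip_def fun_eq_iff)
  note v = p flip_vertex[OF p ij(1)] flip_vertex[OF p ij(2)] flip_vertex[OF flip_vertex[OF p ij(1)] ij(2)]
  note v' = v[folded c(2)] and ij' = ij(1,2)[folded c(2)]
  have a': "edge_at X q (flip p i) i \<alpha>"
    using edge_at_rev[OF a v'(1) ij'(1)] by simp
  obtain \<beta>' where \<beta>': "edge_at X q (flip p i) j \<beta>'"
    using edge_at_exists[OF c(1) v'(2) ij'(2)] by blast
  obtain \<alpha>' where \<alpha>': "edge_at X q (flip (flip p i) j) i \<alpha>'"
    using edge_at_exists[OF c(1) v'(4) ij'(1)] by blast
  have "label \<alpha>' = label \<alpha>"
    using edge_at_label[OF c(1) v'(4) v'(2) ij'(1) \<alpha>' a'] ij(3) by (simp add: prod_eq_iff)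
  moreover have "label \<beta>' = label \<beta>"
    using edge_at_label[OF c(1) v'(2) v'(1) ij'(2) \<beta>' b] ij(3) by (simp add: prod_eq_iff)
  moreover have "initial X \<beta>' = initial X \<alpha>"
    using edge_at_initial[OF \<beta>' v'(2) ij'(2)] edge_at_initial[OF a' v'(2) ij'(1)] by simp
  moreover have "terminal X \<beta>' = initial X \<alpha>'"
    using edge_at_terminal[OF \<beta>' v'(2) ij'(2)] edge_at_initial[OF \<alpha>' v'(4) ij'(1)] by simp
  moreover have "terminal X \<alpha>' = terminal X \<beta>"
    using edge_at_terminal[OF \<alpha>' v'(4) ij'(1)] edge_at_terminal[OF b v'(1) ij'(2)] comm by simp
  moreover have "path_homotopic T (path_concat (edge_path X \<alpha>) (edge_path X \<beta>)) (path_concat (edge_path X \<beta>') (edge_path X \<alpha>'))"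
  proof -
    let ?f = "path_concat (side (flip p i) i) (side p j)"
    let ?g = "path_concat (side (flip p i) j) (side (flip (flip p i) j) i)"
    note s = side[OF v'(2) ij'(1)] side[OF v'(1) ij'(2)] side[OF v'(2) ij'(2)] side[OF v'(4) ij'(1)]
    have "path_homotopic (cube_top (dm q)) ?f ?g"
      using s comm by (intro path_homotopic_cube pathin_concat) simp_all
    from path_homotopic_image[OF this continuous_map_cmap[OF c(1)]]
    have fg: "path_homotopic T (cmap X q \<circ> ?f) (cmap X q \<circ> ?g)" .
    have "path_homotopic T (path_concat (edge_path X \<alpha>) (edge_path X \<beta>)) (cmap X q \<circ> ?f)"
      using edge_path_side[OF a'] edge_path_side[OF b]
      by (intro path_homotopic_sym[OF path_homotopic_eq] path_homotopic_imp(1)[OF fg]) (simp add: path_concat_def)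
    also note fg
    also have "path_homotopic T (cmap X q \<circ> ?g) (path_concat (edge_path X \<beta>') (edge_path X \<alpha>'))"
      using edge_path_side[OF \<beta>'] edge_path_side[OF \<alpha>']
      by (intro path_homotopic_eq path_homotopic_imp(2)[OF fg]) (simp add: path_concat_def)
    finally show ?thesis .
  qed
  ultimately show ?thesis
    using edge_at_oriented[OF \<alpha>'] edge_at_oriented[OF \<beta>'] by blast
qed

text \<open>
  Cancelling letters of the label word can be carried out on the edge path.  Moving an edge across
  a crossing hyperplane needs a square, which is there because crossing hyperplanes do not
  osculate; two consecutive edges with inverse labels are a backtrack because the hyperplane has
  only one half-edge at the vertex.
\<close>
lemma walk_cancel:
  assumes "walk v (\<alpha> # \<omega>) w" "cancels_into crossing (fst (label \<alpha>)) (snd (label \<alpha>)) (map label \<omega>)"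
  shows "\<exists>\<omega>'. walk v \<omega>' w \<and> length \<omega>' < length (\<alpha> # \<omega>) \<and> path_homotopic T (walk_path v (\<alpha> # \<omega>)) (walk_path v \<omega>')"
  using assms
proof (induction \<omega> arbitrary: v \<alpha>)
  case (Cons \<beta> \<omega>)
  have \<alpha>: "\<alpha> \<in> oriented_edges X" "initial X \<alpha> = v" and \<beta>: "\<beta> \<in> oriented_edges X" "initial X \<beta> = terminal X \<alpha>"
    and \<omega>: "walk (terminal X \<beta>) \<omega> w"
    using Cons.prems(1) by simp_all
  note W = walk_path[OF \<omega> edge_ends_in(2)[OF \<beta>(1)]]
  let ?W = "walk_path (terminal X \<beta>) \<omega>" and ?a = "edge_path X \<alpha>" and ?b = "edge_path X \<beta>"
  note ends = W pathin_edge_path[OF \<alpha>(1)] pathin_edge_path[OF \<beta>(1)] \<alpha>(2) \<beta>(2)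
  have assoc: "path_homotopic T (path_concat ?a (path_concat ?b ?W)) (path_concat (path_concat ?a ?b) ?W)"
    using ends by (intro path_homotopic_sym[OF path_concat_assoc]) simp_all
  show ?case
  proof (cases "fst (label \<beta>) = fst (label \<alpha>)")
    case True
    then have \<beta>_eq: "rev_edge \<alpha> = \<beta>"
      using \<alpha>(1) \<beta> by (intro half_edge_unique) (simp_all add: label_rev)
    then have t: "terminal X \<beta> = v"
      using \<alpha>(2) by auto
    have "path_homotopic T (path_concat ?a ?b) (\<lambda>_. v)"
      using path_concat_reverse[OF pathin_edge_path[OF \<alpha>(1)]] \<beta>_eq \<alpha>(2) by (auto simp: edge_path_rev_edge)
    then have "path_homotopic T (path_concat (path_concat ?a ?b) ?W) (path_concat (\<lambda>_. v) ?W)"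
      using ends by (intro path_homotopic_concat path_homotopic_refl) simp_all
    also have "path_homotopic T (path_concat (\<lambda>_. v) ?W) ?W"
      using path_concat_const_left[OF W(3)] W(1) t by simp
    finally have "path_homotopic T (walk_path v (\<alpha> # \<beta> # \<omega>)) (walk_path v \<omega>)"
      using path_homotopic_trans[OF assoc] t by simp
    then show ?thesis
      using \<omega> t by (intro exI[of _ \<omega>]) simp
  next
    case False
    then have cr: "crossing (fst (label \<alpha>)) (fst (label \<beta>))"
      and can: "cancels_into crossing (fst (label \<alpha>)) (snd (label \<alpha>)) (map label \<omega>)"
      using Cons.prems(2) by simp_all
    obtain \<alpha>' \<beta>' where s: "\<alpha>' \<in> oriented_edges X" "\<beta>' \<in> oriented_edges X" "initial X \<beta>' = initial X \<alpha>"
      "terminal X \<beta>' = initial X \<alpha>'" "terminal X \<alpha>' = terminal X \<beta>" "label \<alpha>' = label \<alpha>" "label \<beta>' = label \<beta>"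
      "path_homotopic T (path_concat ?a ?b) (path_concat (edge_path X \<beta>') (edge_path X \<alpha>'))"
      using swap_edges[OF \<alpha>(1) \<beta>(1) \<beta>(2)[symmetric] cr] by (elim exE conjE)
    have "walk (terminal X \<beta>') (\<alpha>' # \<omega>) w"
      using s \<omega> by simp
    then obtain \<omega>' where \<omega>': "walk (terminal X \<beta>') \<omega>' w" "length \<omega>' < length (\<alpha>' # \<omega>)"
      "path_homotopic T (walk_path (terminal X \<beta>') (\<alpha>' # \<omega>)) (walk_path (terminal X \<beta>') \<omega>')"
      using Cons.IH[of "terminal X \<beta>'" \<alpha>'] can s(6) by auto
    have "path_homotopic T (path_concat (path_concat ?a ?b) ?W) (path_concat (path_concat (edge_path X \<beta>') (edge_path X \<alpha>')) ?W)"
      using ends by (intro path_homotopic_concat path_homotopic_refl s(8)) simp_all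
    also have "path_homotopic T (path_concat (path_concat (edge_path X \<beta>') (edge_path X \<alpha>')) ?W)
        (path_concat (edge_path X \<beta>') (path_concat (edge_path X \<alpha>') ?W))"
      using ends s by (intro path_concat_assoc pathin_edge_path) simp_all
    also have "path_homotopic T (path_concat (edge_path X \<beta>') (path_concat (edge_path X \<alpha>') ?W))
        (path_concat (edge_path X \<beta>') (walk_path (terminal X \<beta>') \<omega>'))"
      using \<omega>'(3) s by (intro path_homotopic_concat path_homotopic_refl pathin_edge_path) simp_all
    finally have "path_homotopic T (walk_path v (\<alpha> # \<beta> # \<omega>)) (walk_path v (\<beta>' # \<omega>'))"
      using path_homotopic_trans[OF assoc] by simp
    then show ?thesis
      using \<omega>' s \<alpha>(2) by (intro exI[of _ "\<beta>' # \<omega>'"]) simp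
  qed
qed simp

lemma walk_reduce:
  assumes "walk v \<omega> w" "v \<in> topspace T"
  shows "\<exists>\<omega>'. walk v \<omega>' w \<and> length \<omega>' \<le> length \<omega> \<and> reduced crossing (map label \<omega>') \<and>
    path_homotopic T (walk_path v \<omega>) (walk_path v \<omega>')"
  using assms
proof (induction "length \<omega>" arbitrary: \<omega> v rule: less_induct)
  case less
  show ?case
  proof (cases \<omega>)
    case Nil
    then show ?thesis
      using less.prems path_homotopic_refl[OF walk_path(3)[OF less.prems]] by (intro exI[of _ "[]"]) simp
  next
    case (Cons \<alpha> \<omega>1)
    have \<alpha>: "\<alpha> \<in> oriented_edges X" "initial X \<alpha> = v" "walk (terminal X \<alpha>) \<omega>1 w"
      using less.prems(1) Cons by simp_all
    have t: "terminal X \<alpha> \<in> topspace T"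
      using \<alpha>(1) by (rule edge_ends_in(2))
    have short: "length \<omega>1 < length \<omega>"
      using Cons by simp
    obtain \<omega>2 where 2: "walk (terminal X \<alpha>) \<omega>2 w" "length \<omega>2 \<le> length \<omega>1" "reduced crossing (map label \<omega>2)"
      "path_homotopic T (walk_path (terminal X \<alpha>) \<omega>1) (walk_path (terminal X \<alpha>) \<omega>2)"
      using less.hyps[OF short \<alpha>(3) t] by blast
    have h: "path_homotopic T (walk_path v \<omega>) (walk_path v (\<alpha> # \<omega>2))"
      unfolding Cons walk_path.simps using walk_path(1)[OF \<alpha>(3) t]
      by (intro path_homotopic_concat path_homotopic_refl pathin_edge_path \<alpha>(1) 2(4)) simp
    have w2: "walk v (\<alpha> # \<omega>2) w"
      using \<alpha> 2(1) by simp
    show ?thesis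
    proof (cases "cancels_into crossing (fst (label \<alpha>)) (snd (label \<alpha>)) (map label \<omega>2)")
      case False
      then show ?thesis
        using h w2 2 Cons by (intro exI[of _ "\<alpha> # \<omega>2"]) simp
    next
      case True
      obtain \<omega>3 where 3: "walk v \<omega>3 w" "length \<omega>3 < length (\<alpha> # \<omega>2)"
          "path_homotopic T (walk_path v (\<alpha> # \<omega>2)) (walk_path v \<omega>3)"
        using walk_cancel[OF w2 True] by blast
      have l3: "length \<omega>3 < length \<omega>"
        using 3(2) 2(2) Cons by simp
      obtain \<omega>4 where 4: "walk v \<omega>4 w" "length \<omega>4 \<le> length \<omega>3" "reduced crossing (map label \<omega>4)"
          "path_homotopic T (walk_path v \<omega>3) (walk_path v \<omega>4)"
        using less.hyps[OF l3 3(1) less.prems(2)] by blast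
      have "path_homotopic T (walk_path v \<omega>) (walk_path v \<omega>4)"
        by (rule path_homotopic_trans[OF path_homotopic_trans[OF h 3(3)] 4(4)])
      then show ?thesis
        using 4 l3 by (intro exI[of _ \<omega>4]) simp
    qed
  qed
qed

end

context acted_cx
begin

lemma lifts_to_walk:
  assumes "walk v \<omega> w" "v \<in> topspace T" "e \<in> fibre"
  shows "lifts_to covering.total fst (walk_path v \<omega>) (v, e) (w, word_act \<rho> (map label \<omega>) e)"
  using assms
proof (induction \<omega> arbitrary: v e)
  case Nil
  then show ?case
    unfolding lifts_to_def by (intro exI[of _ "\<lambda>_. (v, e)"]) (simp add: covering.topspace_total)
next
  case (Cons \<alpha> \<omega>)
  have \<alpha>: "\<alpha> \<in> oriented_edges X" "initial X \<alpha> = v" "walk (terminal X \<alpha>) \<omega> w"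
    using Cons.prems(1) by simp_all
  have "A \<alpha> e \<in> fibre"
    using Cons.prems(3) by (simp add: fibre_def letter_act_length[OF action])
  from lifts_to_concat[OF lifts_to_edge[OF \<alpha>(1) Cons.prems(3)] Cons.IH[OF \<alpha>(3) edge_ends_in(2)[OF \<alpha>(1)] this]]
  show ?case
    using \<alpha>(2) by simp
qed

lemma continuous_map_translate: "continuous_map covering.total covering.total (\<lambda>z. (fst z, translate k (snd z)))"
  unfolding continuous_map_def
proof (intro conjI allI impI)
  have tf: "translate k e \<in> fibre" if "e \<in> fibre" for k e
    using that by (simp add: fibre_def translate_def)
  then show "(\<lambda>z. (fst z, translate k (snd z))) \<in> topspace covering.total \<rightarrow> topspace covering.total"
    by (auto simp: covering.topspace_total)
  fix W assume W: "openin covering.total W"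
  have "openin T {x \<in> star v. (x, gluing v x e) \<in> {z \<in> topspace T \<times> fibre. (fst z, translate k (snd z)) \<in> W}}"
    if e: "e \<in> fibre" for v e
  proof -
    have "{x \<in> star v. (x, gluing v x e) \<in> {z \<in> topspace T \<times> fibre. (fst z, translate k (snd z)) \<in> W}} =
      {x \<in> star v. (x, gluing v x (translate k e)) \<in> W}"
      using star_subset e by (auto simp: gluing_action(3) fibre_def gluing_action(2))
    then show ?thesis
      using W tf[OF e] unfolding covering.openin_total by simp
  qed
  then show "openin covering.total {z \<in> topspace covering.total. (fst z, translate k (snd z)) \<in> W}"
    unfolding covering.openin_total covering.topspace_total by auto
qed

end

context special_cx
begin

text \<open>
  An essential loop is homotopic to an edge loop whose label word is reduced and not empty; the
  covering for an action that detects this word moves the lift of the loop by a translation.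
\<close>
theorem essential_loop_translates:
  assumes \<sigma>: "\<sigma> \<in> loops T y" and y: "y \<in> topspace T" and essential: "\<not> path_homotopic T \<sigma> (\<lambda>_. y)"
  shows "\<exists>\<rho> n e k. raag_action crossing \<rho> \<and> length (fst e) = n \<and> k \<noteq> 0 \<and>
    lifts_to (transition_cover.total T star (acted_cx.gluing X \<rho>) (acted_cx.fibre n)) fst \<sigma> (y, e) (y, translate k e)"
proof -
  have s: "pathin T \<sigma>" "\<sigma> 0 = y" "\<sigma> 1 = y"
    using \<sigma> by (simp_all add: loops_def)
  obtain v where v: "y \<in> star v"
    using in_some_star[OF y] by blast
  let ?c = "contract v y"
  note c = pathin_contract[OF v] contract_ends(1,2)[OF v]
  have vT: "v \<in> topspace T"
    using contract_ends(2)[OF v] contract_ends(3)[OF v, of 1] star_subset by force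
  obtain \<omega> where \<omega>: "walk v \<omega> v" "path_homotopic T (path_concat \<sigma> ?c) (path_concat ?c (walk_path v \<omega>))"
    using path_to_walk[OF s(1), of v v] s v by auto
  obtain \<omega>' where \<omega>': "walk v \<omega>' v" "reduced crossing (map label \<omega>')" "path_homotopic T (walk_path v \<omega>) (walk_path v \<omega>')"
    using walk_reduce[OF \<omega>(1) vT] by blast
  have W: "walk_path v \<omega> 0 = v"
    by (rule walk_path(1)[OF \<omega>(1) vT])
  have h: "path_homotopic T (path_concat \<sigma> ?c) (path_concat ?c (walk_path v \<omega>'))"
    using c W by (intro path_homotopic_trans[OF \<omega>(2)] path_homotopic_concat path_homotopic_refl \<omega>'(3)) simp_all
  have "\<omega>' \<noteq> []"
  proof
    assume "\<omega>' = []"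
    then have "path_homotopic T (path_concat ?c (walk_path v \<omega>')) ?c"
      using path_concat_const_right[OF c(1)] c by simp
    then have 1: "path_homotopic T (path_concat \<sigma> ?c) ?c"
      by (rule path_homotopic_trans[OF h])
    note r = pathin_reverse[OF c(1)]
    have inv: "path_homotopic T (path_concat ?c (path_reverse ?c)) (\<lambda>_. y)"
      using path_concat_reverse[OF c(1)] c by simp
    have "path_homotopic T \<sigma> (path_concat \<sigma> (\<lambda>_. y))"
      using path_homotopic_sym[OF path_concat_const_right[OF s(1)]] s by simp
    also have "path_homotopic T (path_concat \<sigma> (\<lambda>_. y)) (path_concat \<sigma> (path_concat ?c (path_reverse ?c)))"
      using s by (intro path_homotopic_concat path_homotopic_refl path_homotopic_sym[OF inv]) simp_all
    also have "path_homotopic T (path_concat \<sigma> (path_concat ?c (path_reverse ?c))) (path_concat (path_concat \<sigma> ?c) (path_reverse ?c))"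
      using s c r by (intro path_homotopic_sym[OF path_concat_assoc]) simp_all
    also have "path_homotopic T (path_concat (path_concat \<sigma> ?c) (path_reverse ?c)) (path_concat ?c (path_reverse ?c))"
      using r by (intro path_homotopic_concat path_homotopic_refl 1) simp_all
    also note inv
    finally show False
      using essential by simp
  qed
  then have "map label \<omega>' \<noteq> []"
    by simp
  note translates = reduced_word_translates[OF crossing_sym \<omega>'(2) this]
  obtain \<rho> l k where \<rho>: "raag_action crossing \<rho>" "k \<noteq> 0" "word_act \<rho> (map label \<omega>') (l, 0) = (l, k)"
    by (rule translates, rule that)
  interpret acted_cx X \<rho> "length l"
    by standard (rule \<rho>(1))
  note cov = covering_map_path_lifting[OF covering.covering_map_total]
  have l0: "(l, 0) \<in> fibre"
    by (simp add: fibre_def)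
  let ?e = "gluing v y (l, 0)"
  have "lifts_to covering.total fst (path_concat ?c (walk_path v \<omega>')) (y, ?e) (v, (l, k))"
    using lifts_to_concat[OF lifts_to_contract[OF v l0] lifts_to_walk[OF \<omega>'(1) vT l0]] \<rho>(3) by simp
  then have 2: "lifts_to covering.total fst (path_concat \<sigma> ?c) (y, ?e) (v, (l, k))"
    by (rule lifts_to_homotopic[OF cov path_homotopic_sym[OF h]])
  have "(y, ?e) \<in> topspace covering.total"
    using y l0 covering.g_in[OF v] by (simp add: covering.topspace_total)
  then obtain z where z: "lifts_to covering.total fst \<sigma> (y, ?e) z"
    using lifts_to_exists[OF cov s(1)] s(2) by fastforce
  have z': "fst z = y" "snd z \<in> fibre"
    using lifts_to_imp(2,4)[OF z] s(3) by (auto simp: covering.topspace_total)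
  obtain e2 where e2: "e2 \<in> fibre" "gluing v y e2 = snd z"
    using covering.bij[OF v] z'(2) unfolding bij_betw_def by (metis imageE)
  have 3: "lifts_to covering.total fst (path_concat \<sigma> ?c) (y, ?e) (v, e2)"
  proof (rule lifts_to_concat[OF z])
    have "z = (y, gluing v y e2)"
      using z'(1) e2(2) by (simp add: prod_eq_iff)
    then show "lifts_to covering.total fst ?c z (v, e2)"
      using lifts_to_contract[OF v e2(1)] by simp
  qed
  have "e2 = (l, k)"
    using lifts_to_unique[OF cov 3 2] by simp
  moreover have "(l, k) = translate k (l, 0)"
    by (simp add: translate_def)
  ultimately have "snd z = translate k ?e"
    using e2(2) gluing_action(3)[of v y k "(l, 0)"] by metis
  then have "z = (y, translate k ?e)"
    using z'(1) by (cases z) simp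
  then have "lifts_to covering.total fst \<sigma> (y, ?e) (y, translate k ?e)"
    using z by simp
  moreover have "length (fst ?e) = length l"
    by (simp add: gluing_action(2))
  ultimately show ?thesis
    using \<rho>(1,2) by blast
qed

end

section \<open>Monodromy\<close>

definition monodromy ::
    "'b topology \<Rightarrow> 'a topology \<Rightarrow> ('b \<Rightarrow> 'a) \<Rightarrow> 'a \<Rightarrow> (real \<Rightarrow> 'a) set \<Rightarrow> 'b \<Rightarrow> 'b \<Rightarrow> bool" where
  "monodromy Z T q x g z z' \<longleftrightarrow> (\<exists>\<sigma>\<in>loops T x. g = loop_class T x \<sigma> \<and> lifts_to Z q \<sigma> z z')"

lemma monodromy_loop:
  assumes q: "path_lifting_map Z T q" and "monodromy Z T q x g z z'" "\<sigma> \<in> loops T x" "g = loop_class T x \<sigma>"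
  shows "lifts_to Z q \<sigma> z z'"
proof -
  obtain \<sigma>' where s: "\<sigma>' \<in> loops T x" "g = loop_class T x \<sigma>'" "lifts_to Z q \<sigma>' z z'"
    using assms(2) unfolding monodromy_def by blast
  then have "path_homotopic T \<sigma>' \<sigma>"
    using loop_class_eq_iff[OF s(1) assms(3)] assms(4) by simp
  then show ?thesis
    by (rule lifts_to_homotopic[OF q _ s(3)])
qed

lemma monodromy_exists:
  assumes "path_lifting_map Z T q" "g \<in> carrier (fundamental_group T x)" "z \<in> topspace Z" "q z = x"
  shows "\<exists>z'. monodromy Z T q x g z z'"
proof -
  obtain \<sigma> where s: "\<sigma> \<in> loops T x" "g = loop_class T x \<sigma>"
    using assms(2) by (auto simp: carrier_fundamental_group)
  then have "\<exists>z'. lifts_to Z q \<sigma> z z'"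
    using assms(3,4) by (intro lifts_to_exists[OF assms(1)]) (simp_all add: loops_def)
  then show ?thesis
    using s unfolding monodromy_def by blast
qed

lemma monodromy_unique:
  assumes q: "path_lifting_map Z T q" and "monodromy Z T q x g z z1" "monodromy Z T q x g z z2"
  shows "z1 = z2"
proof -
  obtain \<sigma> where s: "\<sigma> \<in> loops T x" "g = loop_class T x \<sigma>" "lifts_to Z q \<sigma> z z1"
    using assms(2) unfolding monodromy_def by blast
  show ?thesis
    by (rule lifts_to_unique[OF q s(3) monodromy_loop[OF q assms(3) s(1,2)]])
qed

lemma monodromy_imp:
  assumes "monodromy Z T q x g z z'"
  shows "g \<in> carrier (fundamental_group T x)" "z' \<in> topspace Z" "q z' = x" "z \<in> topspace Z" "q z = x"
proof -
  obtain \<sigma> where s: "\<sigma> \<in> loops T x" "g = loop_class T x \<sigma>" "lifts_to Z q \<sigma> z z'"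
    using assms unfolding monodromy_def by blast
  then show "g \<in> carrier (fundamental_group T x)" "z' \<in> topspace Z" "q z' = x" "z \<in> topspace Z" "q z = x"
    using lifts_to_imp[OF s(3)] by (auto simp: carrier_fundamental_group loops_def)
qed

lemma monodromy_mult:
  assumes "monodromy Z T q x g z z'" "monodromy Z T q x h z' z''"
  shows "monodromy Z T q x (g \<otimes>\<^bsub>fundamental_group T x\<^esub> h) z z''"
proof -
  obtain \<sigma> where s: "\<sigma> \<in> loops T x" "g = loop_class T x \<sigma>" "lifts_to Z q \<sigma> z z'"
    using assms(1) unfolding monodromy_def by blast
  obtain \<tau> where t: "\<tau> \<in> loops T x" "h = loop_class T x \<tau>" "lifts_to Z q \<tau> z' z''"
    using assms(2) unfolding monodromy_def by blast
  show ?thesis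
    unfolding monodromy_def using s t
    by (intro bexI[of _ "path_concat \<sigma> \<tau>"] conjI lifts_to_concat[OF s(3) t(3)] path_concat_loops)
      (simp_all add: mult_loop_class)
qed

lemma monodromy_one:
  assumes "z \<in> topspace Z" "q z = x" "x \<in> topspace T"
  shows "monodromy Z T q x \<one>\<^bsub>fundamental_group T x\<^esub> z z"
  unfolding monodromy_def one_fundamental_group
  by (rule bexI[of _ "\<lambda>_. x"]) (use assms in \<open>auto simp: loops_def lifts_to_def intro!: exI[of _ "\<lambda>_. z"]\<close>)

lemma monodromy_inv:
  assumes "monodromy Z T q x g z z'" "x \<in> topspace T"
  shows "monodromy Z T q x (inv\<^bsub>fundamental_group T x\<^esub> g) z' z"
proof -
  interpret group "fundamental_group T x"
    by (rule group_fundamental_group[OF assms(2)])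
  obtain \<sigma> where s: "\<sigma> \<in> loops T x" "g = loop_class T x \<sigma>" "lifts_to Z q \<sigma> z z'"
    using assms(1) unfolding monodromy_def by blast
  have "inv\<^bsub>fundamental_group T x\<^esub> g = loop_class T x (path_reverse \<sigma>)"
    using loop_class_reverse[OF s(1)] s(1,2) reverse_loops[OF s(1)]
    by (intro inv_equality) (simp_all add: carrier_fundamental_group)
  then show ?thesis
    unfolding monodromy_def using reverse_loops[OF s(1)] lifts_to_reverse[OF s(3)] by blast
qed

lemma monodromy_deck:
  assumes "monodromy Z T q x g z z'" "continuous_map Z Z f" "\<And>z. z \<in> topspace Z \<Longrightarrow> q (f z) = q z"
  shows "monodromy Z T q x g (f z) (f z')"
proof -
  obtain \<sigma> where s: "\<sigma> \<in> loops T x" "g = loop_class T x \<sigma>" "lifts_to Z q \<sigma> z z'"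
    using assms(1) unfolding monodromy_def by blast
  have "lifts_to Z q \<sigma> (f z) (f z')"
    using s(3) assms(2) by (rule lifts_to_deck) (rule assms(3))
  then show ?thesis
    using s(1,2) unfolding monodromy_def by blast
qed

lemma subgroup_fundamental_groupI:
  assumes x: "x \<in> topspace T"
    and P: "\<And>g. P g \<Longrightarrow> g \<in> carrier (fundamental_group T x)" "P \<one>\<^bsub>fundamental_group T x\<^esub>"
    "\<And>g. P g \<Longrightarrow> P (inv\<^bsub>fundamental_group T x\<^esub> g)"
    "\<And>g h. P g \<Longrightarrow> P h \<Longrightarrow> P (g \<otimes>\<^bsub>fundamental_group T x\<^esub> h)"
  shows "subgroup {g. P g} (fundamental_group T x)"
proof -
  interpret group "fundamental_group T x"
    by (rule group_fundamental_group[OF x])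
  show ?thesis
    by (rule subgroupI) (use P in auto)
qed

text \<open>
  If a loop lifts to an essential loop in a C-special finite cover, its class has infinite order in
  the abelianisation of a subgroup of finite index.  The subgroup consists of the loops whose lift
  to the covering of the cover that is given by an action with finite orbits ends at a translate of
  its starting point, and the homomorphism is the amount of the translation.
\<close>
lemma essential_loop_homomorphism:
  assumes x: "x \<in> topspace T" and cov: "covering_map (points Y) T p" and Y: "C_special Y"
    and fin: "finite {y \<in> topspace (points Y). p y = x}"
    and g: "monodromy (points Y) T p x g y y" "g \<noteq> \<one>\<^bsub>fundamental_group T x\<^esub>"
  shows "\<exists>K (f :: (real \<Rightarrow> 'a) set \<Rightarrow> int). subgroup K (fundamental_group T x) \<and>
    finite (rcosets\<^bsub>fundamental_group T x\<^esub> K) \<and> g \<in> K \<and>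
    (\<forall>a\<in>K. \<forall>b\<in>K. f (a \<otimes>\<^bsub>fundamental_group T x\<^esub> b) = f a + f b) \<and> f g \<noteq> 0"
proof -
  let ?G = "fundamental_group T x"
  interpret G: group ?G
    by (rule group_fundamental_group[OF x])
  interpret special_cx Y
    by standard (use Y in \<open>simp_all add: C_special_def\<close>)
  note p = covering_map_path_lifting[OF cov]
  note y = monodromy_imp(2,3)[OF g(1)]
  obtain \<sigma> where \<sigma>: "\<sigma> \<in> loops T x" "g = loop_class T x \<sigma>" "lifts_to (points Y) p \<sigma> y y"
    using g(1) unfolding monodromy_def by blast
  obtain \<tau> where \<tau>: "pathin (points Y) \<tau>" "\<forall>t\<in>{0..1}. p (\<tau> t) = \<sigma> t" "\<tau> 0 = y" "\<tau> 1 = y"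
    using \<sigma>(3) unfolding lifts_to_def by blast
  have \<tau>_loop: "\<tau> \<in> loops (points Y) y"
    using \<tau> by (simp add: loops_def)
  have "\<not> path_homotopic (points Y) \<tau> (\<lambda>_. y)"
  proof
    assume "path_homotopic (points Y) \<tau> (\<lambda>_. y)"
    from path_homotopic_image[OF this path_lifting_mapD(1)[OF p]]
    have h: "path_homotopic T (p \<circ> \<tau>) (\<lambda>_. x)"
      using y(2) by (simp add: o_def)
    have "path_homotopic T \<sigma> (p \<circ> \<tau>)"
      using \<sigma>(1) \<tau>(2) by (intro path_homotopic_eq) (simp_all add: loops_def)
    then have "path_homotopic T \<sigma> (\<lambda>_. x)"
      using h by (rule path_homotopic_trans)
    then have "g = \<one>\<^bsub>?G\<^esub>"
      using loop_class_eq_iff[OF \<sigma>(1), of "\<lambda>_. x"] \<sigma>(2) x by (simp add: one_fundamental_group loops_def)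
    then show False
      using g(2) by simp
  qed
  from essential_loop_translates[OF \<tau>_loop y(1) this]
  obtain \<rho> n e k where \<rho>: "raag_action crossing \<rho>" and e: "length (fst e) = n" and k: "k \<noteq> 0"
    and l: "lifts_to (transition_cover.total (points Y) star (acted_cx.gluing Y \<rho>) (acted_cx.fibre n)) fst \<tau> (y, e) (y, translate k e)"
    by (elim exE conjE)
  interpret acted_cx Y \<rho> n
    by standard (rule \<rho>)
  let ?Z = covering.total and ?q = "p \<circ> fst"
  have q: "path_lifting_map ?Z T ?q"
    by (rule path_lifting_map_compose[OF p covering_map_path_lifting[OF covering.covering_map_total]])
  let ?M = "monodromy ?Z T ?q x"
  let ?tr = "\<lambda>j z. (fst z, translate j (snd z)) :: 'b \<times> bool list \<times> int"
  have tr: "?M h (?tr j z) (?tr j z')" if "?M h z z'" for h j z z'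
    by (rule monodromy_deck[OF that continuous_map_translate]) simp
  have "e \<in> fibre"
    using e by (simp add: fibre_def)
  then have z0: "(y, e) \<in> topspace ?Z" "?q (y, e) = x"
    using y by (simp_all add: covering.topspace_total)
  have tr_inj: "i = j" if "translate i e = translate j e" for i j
    using that by (simp add: translate_def)
  define P where "P h \<longleftrightarrow> (\<exists>j. ?M h (y, e) (y, translate j e))" for h
  define f where "f h = (THE j. ?M h (y, e) (y, translate j e))" for h
  have f: "f h = j" if j: "?M h (y, e) (y, translate j e)" for h j
    unfolding f_def
  proof (rule the_equality)
    show "?M h (y, e) (y, translate j e)"
      by (rule j)
    show "i = j" if "?M h (y, e) (y, translate i e)" for i
      using monodromy_unique[OF q that j] by (intro tr_inj) simp
  qed
  have mult: "?M (a \<otimes>\<^bsub>?G\<^esub> b) (y, e) (y, translate (i + j) e)"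
    if "?M a (y, e) (y, translate i e)" "?M b (y, e) (y, translate j e)" for a b i j
    using monodromy_mult[OF that(1)] tr[OF that(2), of i]
    by (simp only: fst_conv snd_conv translate_translate)
  have K: "subgroup {h. P h} ?G"
  proof (rule subgroup_fundamental_groupI[OF x])
    show "h \<in> carrier ?G" if "P h" for h
      using that unfolding P_def by (elim exE) (rule monodromy_imp(1))
    show "P \<one>\<^bsub>?G\<^esub>"
      unfolding P_def by (rule exI[of _ 0], unfold translate_0) (rule monodromy_one, rule z0(1), rule z0(2), rule x)
    show "P (inv\<^bsub>?G\<^esub> h)" if "P h" for h
    proof -
      obtain j where "?M h (y, e) (y, translate j e)"
        using \<open>P h\<close> unfolding P_def by blast
      from tr[OF monodromy_inv[OF this x], of "- j"]
      have "?M (inv\<^bsub>?G\<^esub> h) (y, e) (y, translate (- j) e)"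
        by (simp only: fst_conv snd_conv translate_translate add.left_inverse translate_0)
      then show ?thesis
        unfolding P_def by (rule exI)
    qed
    show "P (a \<otimes>\<^bsub>?G\<^esub> b)" if "P a" "P b" for a b
      using that unfolding P_def by (elim exE) (rule exI, rule mult)
  qed
  have "finite (rcosets\<^bsub>?G\<^esub> {h. P h})"
  proof (rule G.finite_rcosetsI[OF K])
    let ?end = "\<lambda>h. THE z. ?M h (y, e) z" and ?\<phi> = "\<lambda>z. (fst z, fst (snd z)) :: 'b \<times> bool list"
    have the: "?M h (y, e) (?end h)" if h: "h \<in> carrier ?G" for h
    proof -
      obtain z where z: "?M h (y, e) z"
        using monodromy_exists[OF q h z0] by blast
      have "?end h = z"
        by (rule the_equality[where a = z], rule z) (rule monodromy_unique[OF q _ z])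
      then show ?thesis
        using z by simp
    qed
    have lists_fin: "finite {l :: bool list. set l \<subseteq> UNIV \<and> length l = n}"
      by (rule finite_lists_length_eq) simp
    have "(\<lambda>h. ?\<phi> (?end h)) ` carrier ?G \<subseteq> {y \<in> topspace (points Y). p y = x} \<times> {l. set l \<subseteq> UNIV \<and> length l = n}"
    proof
      fix w assume "w \<in> (\<lambda>h. ?\<phi> (?end h)) ` carrier ?G"
      then obtain h where h: "h \<in> carrier ?G" "w = ?\<phi> (?end h)"
        by blast
      have "?end h \<in> topspace (points Y) \<times> fibre" "p (fst (?end h)) = x"
        using monodromy_imp(2,3)[OF the[OF h(1)]] by (simp_all add: covering.topspace_total)
      then show "w \<in> {y \<in> topspace (points Y). p y = x} \<times> {l. set l \<subseteq> UNIV \<and> length l = n}"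
        using h(2) by (auto simp: fibre_def)
    qed
    then show "finite ((\<lambda>h. ?\<phi> (?end h)) ` carrier ?G)"
      by (rule finite_subset) (rule finite_cartesian_product[OF fin lists_fin])
    fix a b assume ab: "a \<in> carrier ?G" "b \<in> carrier ?G" "?\<phi> (?end a) = ?\<phi> (?end b)"
    define j where "j = snd (snd (?end a)) - snd (snd (?end b))"
    have "?end a = ?tr j (?end b)"
      using ab(3) by (simp add: j_def translate_def prod_eq_iff)
    then have "?M (inv\<^bsub>?G\<^esub> b) (?end a) (y, translate j e)"
      using tr[OF monodromy_inv[OF the[OF ab(2)] x], of j] by (simp only: fst_conv snd_conv)
    from monodromy_mult[OF the[OF ab(1)] this] have "P (a \<otimes>\<^bsub>?G\<^esub> inv\<^bsub>?G\<^esub> b)"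
      unfolding P_def by (rule exI)
    then show "a \<otimes>\<^bsub>?G\<^esub> inv\<^bsub>?G\<^esub> b \<in> {h. P h}"
      by (rule CollectI)
  qed
  moreover have gk: "?M g (y, e) (y, translate k e)"
  proof -
    obtain \<upsilon> where "pathin ?Z \<upsilon>" "\<forall>t\<in>{0..1}. fst (\<upsilon> t) = \<tau> t" "\<upsilon> 0 = (y, e)" "\<upsilon> 1 = (y, translate k e)"
      using l unfolding lifts_to_def by blast
    then have "lifts_to ?Z ?q \<sigma> (y, e) (y, translate k e)"
      unfolding lifts_to_def using \<tau>(2) by (intro exI[of _ \<upsilon>]) simp
    then show ?thesis
      unfolding monodromy_def using \<sigma> by blast
  qed
  moreover have "f (a \<otimes>\<^bsub>?G\<^esub> b) = f a + f b" if "a \<in> {h. P h}" "b \<in> {h. P h}" for a b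
  proof -
    obtain i where i: "?M a (y, e) (y, translate i e)"
      using \<open>a \<in> {h. P h}\<close> unfolding P_def by (elim CollectE exE)
    obtain j where j: "?M b (y, e) (y, translate j e)"
      using \<open>b \<in> {h. P h}\<close> unfolding P_def by (elim CollectE exE)
    show ?thesis
      unfolding f[OF mult[OF i j]] f[OF i] f[OF j] by (rule refl)
  qed
  moreover have "P g"
    unfolding P_def by (rule exI[of _ k]) (rule gk)
  moreover have "f g \<noteq> 0"
    using f[OF gk] k by simp
  ultimately show ?thesis
    using K by (intro exI[of _ "{h. P h}"] exI[of _ f]) blast
qed

theorem corollary5p9:
  fixes S :: "('a, 'c) cell_structure" and x :: 'a
    and \<P> :: "(real \<Rightarrow> 'a) set set set" and \<gamma> :: "(real \<Rightarrow> 'a) set"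
  assumes "cube_complex S"
    and "compact_space (points S)"
    and "connected_space (points S)"
    and "virtually_special TYPE('b \<times> 'd) S"
    and "x \<in> topspace (points S)"
    and "finite \<P>"
    and "relatively_hyperbolic (fundamental_group (points S) x) \<P>"
    and "hyperbolic_element (fundamental_group (points S) x) \<P> \<gamma>"
  shows "virtual_retract (fundamental_group (points S) x)
           (generate (fundamental_group (points S) x) {\<gamma>})"
proof -
  let ?G = "fundamental_group (points S) x"
  interpret G: group ?G
    by (rule group_fundamental_group[OF assms(5)])
  obtain Y :: "('b, 'd) cell_structure" and p where cover: "finite_cube_cover Y S p" and Y: "C_special Y"
    using assms(4) unfolding virtually_special_def by blast
  then have cov: "covering_map (points Y) (points S) p"
    and fin: "finite {y \<in> topspace (points Y). p y = x}"
    using assms(5) unfolding finite_cube_cover_def by blast+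
  have "x \<in> p ` topspace (points Y)"
    using cov assms(5) unfolding covering_map_def by blast
  then obtain y where y: "y \<in> topspace (points Y)" "p y = x"
    by blast
  note p = covering_map_path_lifting[OF cov]
  let ?M = "monodromy (points Y) (points S) p x"
  have G0: "subgroup {g. ?M g y y} ?G"
  proof (rule subgroup_fundamental_groupI[OF assms(5)])
    show "g \<in> carrier ?G" if "?M g y y" for g
      by (rule monodromy_imp(1)[OF that])
    show "?M \<one>\<^bsub>?G\<^esub> y y"
      by (rule monodromy_one, rule y(1), rule y(2), rule assms(5))
    show "?M (inv\<^bsub>?G\<^esub> g) y y" if "?M g y y" for g
      by (rule monodromy_inv[OF that assms(5)])
    show "?M (g \<otimes>\<^bsub>?G\<^esub> h) y y" if "?M g y y" "?M h y y" for g h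
      by (rule monodromy_mult[OF that])
  qed
  have "finite (rcosets\<^bsub>?G\<^esub> {g. ?M g y y})"
  proof (rule G.finite_rcosetsI[OF G0])
    let ?end = "\<lambda>g. THE z. ?M g y z"
    have the: "?M g y (?end g)" if g: "g \<in> carrier ?G" for g
    proof -
      obtain z where z: "?M g y z"
        using monodromy_exists[OF p g y] by blast
      have "?end g = z"
        by (rule the_equality[where a = z], rule z) (rule monodromy_unique[OF p _ z])
      then show ?thesis
        using z by simp
    qed
    have "?end ` carrier ?G \<subseteq> {y \<in> topspace (points Y). p y = x}"
      using monodromy_imp(2,3)[OF the] by (intro image_subsetI CollectI conjI)
    then show "finite (?end ` carrier ?G)"
      by (rule finite_subset[OF _ fin])
    fix g h assume gh: "g \<in> carrier ?G" "h \<in> carrier ?G" "?end g = ?end h"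
    have "?M (inv\<^bsub>?G\<^esub> h) (?end g) y"
      using monodromy_inv[OF the[OF gh(2)] assms(5)] gh(3) by simp
    from monodromy_mult[OF the[OF gh(1)] this] show "g \<otimes>\<^bsub>?G\<^esub> inv\<^bsub>?G\<^esub> h \<in> {g. ?M g y y}"
      by simp
  qed
  moreover have "\<gamma> \<in> carrier ?G"
    using assms(8) by (simp add: hyperbolic_element_def)
  ultimately show ?thesis
  proof (intro G.cyclic_virtual_retract[OF _ G0])
    show "\<exists>K (f :: (real \<Rightarrow> 'a) set \<Rightarrow> int). subgroup K ?G \<and> finite (rcosets\<^bsub>?G\<^esub> K) \<and> g \<in> K \<and>
        (\<forall>a\<in>K. \<forall>b\<in>K. f (a \<otimes>\<^bsub>?G\<^esub> b) = f a + f b) \<and> f g \<noteq> 0"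
      if "g \<in> {g. ?M g y y}" "g \<noteq> \<one>\<^bsub>?G\<^esub>" for g
      using that by (intro essential_loop_homomorphism[OF assms(5) cov Y fin, of g y]) simp_all
  qed
qed

end
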